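(* Let $\tau,\sigma$ be finite types such that $\tau$ has type level $0$ or $1$ ($\sigma$ is arbitrary), and let $t\colon (\mathbb N\to\tau)\to\mathbb N$ be a closed term of system $\mathsf T$. Then the functional $\lambda G,H,s.\,\mathsf{BR}^{\tau,\sigma}(G,H,t)(s)$ is $\mathsf T$-definable, uniformly in $G$ and $H$. That is, there is a closed term $\xi\colon(\tau^*\to\sigma)\to(\tau^*\to(\tau\to\sigma)\to\sigma)\to\tau^*\to\sigma$ of system $\mathsf T$ such that for all $G\colon\tau^*\to\sigma$, all $H\colon\tau^*\to(\tau\to\sigma)\to\sigma$ (not required to be $\mathsf T$-definable) and all $s\colon\tau^*$: $$t(\hat s)<|s|\ \to\ \xi(G,H)(s)=G(s),\qquad t(\hat s)\ge|s|\ \to\ \xi(G,H)(s)=H(s)(\lambda x^\tau.\,\xi(G,H)(s*x)).$$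
   Context: Finite types: $\mathbb N$ is a finite type, and if $\tau_0,\tau_1$ are finite types then so are $\tau_0\to\tau_1$ (also written $\tau_1^{\tau_0}$) and $\tau_0^*$ (finite sequences of elements of type $\tau_0$); finite products $\tau\times\sigma$ are used as a definitional extension. Type levels: $\mathrm{level}(\mathbb N)=0$, $\mathrm{level}(\rho\to\eta)=\max\{\mathrm{level}(\rho)+1,\mathrm{level}(\eta)\}$, $\mathrm{level}(\tau\times\sigma)=\max\{\mathrm{level}(\tau),\mathrm{level}(\sigma)\}$, $\mathrm{level}(\tau^* )=\mathrm{level}(\tau)$. System $\mathsf T$ is the simply typed $\lambda$-calculus over these types with $0$, $\mathsf{Succ}$ and, for every finite type $\rho$, a recursor $\mathsf{Rec}^\rho$ with $\mathsf{Rec}^\rho(a,f)(0)=a$ and $\mathsf{Rec}^\rho(a,f)(\mathsf{Succ}(m))=f(m,\mathsf{Rec}^\rho(a,f)(m))$, where $a\colon\rho$, $f\colon\mathbb N\to\rho\to\rho$. Notation: $|s|$ is the length of $s\colon\tau^*$; $s*x$ is $s$ with $x\colon\tau$ appended; $0^\tau$ is the standard inductively defined zero object of type $\tau$; $\hat s\colon\mathbb N\to\tau$ is the extension of $s$ by infinitely many $0^\tau$. Spector's bar recursion $\mathsf{BR}^{\tau,\sigma}(G,H,Y)(s)$, for $G\colon\tau^*\to\sigma$, $H\colon\tau^*\to(\tau\to\sigma)\to\sigma$, $Y\colon(\mathbb N\to\tau)\to\mathbb N$, $s\colon\tau^*$, is the functional of type $\sigma$ satisfying $\mathsf{BR}(G,H,Y)(s)=G(s)$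 if $Y(\hat s)<|s|$, and $\mathsf{BR}(G,H,Y)(s)=H(s)(\lambda x^\tau.\mathsf{BR}(G,H,Y)(s*x))$ otherwise. The verification is understood to take place in $\mathbf{HA}^\omega$, intuitionistic Heyting arithmetic in all finite types. *)

theory Defs
  imports Main
begin

section \<open>Finite types\<close>

datatype ty =
    N
  | Fun ty ty  (infixr \<open>\<rightarrow>\<close> 70)
  | Prod ty ty (infixr \<open>\<otimes>\<close> 75)
  | Seq ty

primrec level :: "ty \<Rightarrow> nat" where
  "level N = 0"
| "level (\<rho> \<rightarrow> \<eta>) = max (level \<rho> + 1) (level \<eta>)"
| "level (\<tau> \<otimes> \<sigma>) = max (level \<tau>) (level \<sigma>)"
| "level (Seq \<tau>) = level \<tau>"


section \<open>System T\<close>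

text \<open>
  Simply typed lambda terms with de Bruijn indices and explicitly typed binders. Finite sequences
  are built from the empty sequence by appending one element at the end (\<open>Snoc\<close>). Their
  elimination constant \<open>SRec \<tau> \<rho>\<close> is primitive recursion along this generation; with it, length,
  indexing and the extension of a sequence by zeros are definable terms.
\<close>

datatype trm =
    Var nat
  | App trm trm (infixl \<open>\<cdot>\<close> 200)
  | Lam ty trm
  | Zero
  | Succ
  | Rec ty
  | Emp ty
  | Snoc ty
  | SRec ty ty
  | Pair ty ty
  | Fst ty ty
  | Snd ty ty

text \<open>A context lists the types of the free variables; \<open>Var 0\<close> refers to its head.\<close>

inductive wt :: "ty list \<Rightarrow> trm \<Rightarrow> ty \<Rightarrow> bool" (\<open>_ \<turnstile> _ : _\<close> [50, 50, 50] 50) where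
  wt_Var: "i < length \<Gamma> \<Longrightarrow> \<Gamma> \<turnstile> Var i : \<Gamma> ! i"
| wt_App: "\<Gamma> \<turnstile> t : \<rho> \<rightarrow> \<eta> \<Longrightarrow> \<Gamma> \<turnstile> u : \<rho> \<Longrightarrow> \<Gamma> \<turnstile> t \<cdot> u : \<eta>"
| wt_Lam: "\<rho> # \<Gamma> \<turnstile> t : \<eta> \<Longrightarrow> \<Gamma> \<turnstile> Lam \<rho> t : \<rho> \<rightarrow> \<eta>"
| wt_Zero: "\<Gamma> \<turnstile> Zero : N"
| wt_Succ: "\<Gamma> \<turnstile> Succ : N \<rightarrow> N"
| wt_Rec: "\<Gamma> \<turnstile> Rec \<rho> : \<rho> \<rightarrow> (N \<rightarrow> \<rho> \<rightarrow> \<rho>) \<rightarrow> N \<rightarrow> \<rho>"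
| wt_Emp: "\<Gamma> \<turnstile> Emp \<tau> : Seq \<tau>"
| wt_Snoc: "\<Gamma> \<turnstile> Snoc \<tau> : Seq \<tau> \<rightarrow> \<tau> \<rightarrow> Seq \<tau>"
| wt_SRec: "\<Gamma> \<turnstile> SRec \<tau> \<rho> : \<rho> \<rightarrow> (Seq \<tau> \<rightarrow> \<tau> \<rightarrow> \<rho> \<rightarrow> \<rho>) \<rightarrow> Seq \<tau> \<rightarrow> \<rho>"
| wt_Pair: "\<Gamma> \<turnstile> Pair \<tau> \<sigma> : \<tau> \<rightarrow> \<sigma> \<rightarrow> \<tau> \<otimes> \<sigma>"
| wt_Fst: "\<Gamma> \<turnstile> Fst \<tau> \<sigma> : \<tau> \<otimes> \<sigma> \<rightarrow> \<tau>"
| wt_Snd: "\<Gamma> \<turnstile> Snd \<tau> \<sigma> : \<tau> \<otimes> \<sigma> \<rightarrow> \<sigma>"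

text \<open>Renaming, parallel substitution, and instantiation of \<open>Var 0\<close>.\<close>

primrec ren :: "(nat \<Rightarrow> nat) \<Rightarrow> trm \<Rightarrow> trm" where
  "ren r (Var i) = Var (r i)"
| "ren r (t \<cdot> u) = ren r t \<cdot> ren r u"
| "ren r (Lam \<rho> t) = Lam \<rho> (ren (case_nat 0 (\<lambda>i. Suc (r i))) t)"
| "ren r Zero = Zero"
| "ren r Succ = Succ"
| "ren r (Rec \<rho>) = Rec \<rho>"
| "ren r (Emp \<tau>) = Emp \<tau>"
| "ren r (Snoc \<tau>) = Snoc \<tau>"
| "ren r (SRec \<tau> \<rho>) = SRec \<tau> \<rho>"
| "ren r (Pair \<tau> \<sigma>) = Pair \<tau> \<sigma>"
| "ren r (Fst \<tau> \<sigma>) = Fst \<tau> \<sigma>"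
| "ren r (Snd \<tau> \<sigma>) = Snd \<tau> \<sigma>"

abbreviation shift :: "trm \<Rightarrow> trm" where
  "shift \<equiv> ren Suc"

definition up :: "(nat \<Rightarrow> trm) \<Rightarrow> nat \<Rightarrow> trm" where
  "up \<theta> = case_nat (Var 0) (\<lambda>i. shift (\<theta> i))"

primrec sub :: "(nat \<Rightarrow> trm) \<Rightarrow> trm \<Rightarrow> trm" where
  "sub \<theta> (Var i) = \<theta> i"
| "sub \<theta> (t \<cdot> u) = sub \<theta> t \<cdot> sub \<theta> u"
| "sub \<theta> (Lam \<rho> t) = Lam \<rho> (sub (up \<theta>) t)"
| "sub \<theta> Zero = Zero"
| "sub \<theta> Succ = Succ"
| "sub \<theta> (Rec \<rho>) = Rec \<rho>"
| "sub \<theta> (Emp \<tau>) = Emp \<tau>"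
| "sub \<theta> (Snoc \<tau>) = Snoc \<tau>"
| "sub \<theta> (SRec \<tau> \<rho>) = SRec \<tau> \<rho>"
| "sub \<theta> (Pair \<tau> \<sigma>) = Pair \<tau> \<sigma>"
| "sub \<theta> (Fst \<tau> \<sigma>) = Fst \<tau> \<sigma>"
| "sub \<theta> (Snd \<tau> \<sigma>) = Snd \<tau> \<sigma>"

definition inst :: "trm \<Rightarrow> nat \<Rightarrow> trm" where
  "inst u = case_nat u Var"


section \<open>Heyting arithmetic in all finite types\<close>

datatype fm =
    Eq ty trm trm
  | Fls
  | And fm fm
  | Or fm fm
  | Imp fm fm
  | All ty fm
  | Ex ty fm

inductive wff :: "ty list \<Rightarrow> fm \<Rightarrow> bool" where
  wff_Eq: "\<Gamma> \<turnstile> t : \<tau> \<Longrightarrow> \<Gamma> \<turnstile> u : \<tau> \<Longrightarrow> wff \<Gamma> (Eq \<tau> t u)"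
| wff_Fls: "wff \<Gamma> Fls"
| wff_And: "wff \<Gamma> A \<Longrightarrow> wff \<Gamma> B \<Longrightarrow> wff \<Gamma> (And A B)"
| wff_Or: "wff \<Gamma> A \<Longrightarrow> wff \<Gamma> B \<Longrightarrow> wff \<Gamma> (Or A B)"
| wff_Imp: "wff \<Gamma> A \<Longrightarrow> wff \<Gamma> B \<Longrightarrow> wff \<Gamma> (Imp A B)"
| wff_All: "wff (\<tau> # \<Gamma>) A \<Longrightarrow> wff \<Gamma> (All \<tau> A)"
| wff_Ex: "wff (\<tau> # \<Gamma>) A \<Longrightarrow> wff \<Gamma> (Ex \<tau> A)"

primrec fren :: "(nat \<Rightarrow> nat) \<Rightarrow> fm \<Rightarrow> fm" where
  "fren r (Eq \<tau> t u) = Eq \<tau> (ren r t) (ren r u)"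
| "fren r Fls = Fls"
| "fren r (And A B) = And (fren r A) (fren r B)"
| "fren r (Or A B) = Or (fren r A) (fren r B)"
| "fren r (Imp A B) = Imp (fren r A) (fren r B)"
| "fren r (All \<tau> A) = All \<tau> (fren (case_nat 0 (\<lambda>i. Suc (r i))) A)"
| "fren r (Ex \<tau> A) = Ex \<tau> (fren (case_nat 0 (\<lambda>i. Suc (r i))) A)"

abbreviation fshift :: "fm \<Rightarrow> fm" where
  "fshift \<equiv> fren Suc"

primrec fsub :: "(nat \<Rightarrow> trm) \<Rightarrow> fm \<Rightarrow> fm" where
  "fsub \<theta> (Eq \<tau> t u) = Eq \<tau> (sub \<theta> t) (sub \<theta> u)"
| "fsub \<theta> Fls = Fls"
| "fsub \<theta> (And A B) = And (fsub \<theta> A) (fsub \<theta> B)"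
| "fsub \<theta> (Or A B) = Or (fsub \<theta> A) (fsub \<theta> B)"
| "fsub \<theta> (Imp A B) = Imp (fsub \<theta> A) (fsub \<theta> B)"
| "fsub \<theta> (All \<tau> A) = All \<tau> (fsub (up \<theta>) A)"
| "fsub \<theta> (Ex \<tau> A) = Ex \<tau> (fsub (up \<theta>) A)"

text \<open>
  Natural deduction: \<open>HA \<Gamma> \<Delta> A\<close> means that \<open>A\<close> is derivable from the hypotheses \<open>\<Delta>\<close> with free
  variables typed by \<open>\<Gamma>\<close>. Equality is a congruence at every
  type and extensional at function types (rule \<open>Ext\<close>; the eta and xi rules follow from it).
  In the two induction rules \<open>Var 0\<close> is the induction variable of \<open>A\<close>; in the step for sequences
  \<open>Var 1\<close> is the sequence \<open>s\<close> and \<open>Var 0\<close> the appended element \<open>x\<close>. Distinctness and injectivity of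
  \<open>Emp\<close> and \<open>Snoc\<close> are derivable from the recursion equations for \<open>SRec\<close>.
\<close>

inductive HA :: "ty list \<Rightarrow> fm set \<Rightarrow> fm \<Rightarrow> bool" where
  Asm: "A \<in> \<Delta> \<Longrightarrow> wff \<Gamma> A \<Longrightarrow> HA \<Gamma> \<Delta> A"
| FlsE: "HA \<Gamma> \<Delta> Fls \<Longrightarrow> wff \<Gamma> A \<Longrightarrow> HA \<Gamma> \<Delta> A"
| AndI: "HA \<Gamma> \<Delta> A \<Longrightarrow> HA \<Gamma> \<Delta> B \<Longrightarrow> HA \<Gamma> \<Delta> (And A B)"
| AndE1: "HA \<Gamma> \<Delta> (And A B) \<Longrightarrow> HA \<Gamma> \<Delta> A"
| AndE2: "HA \<Gamma> \<Delta> (And A B) \<Longrightarrow> HA \<Gamma> \<Delta> B"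
| OrI1: "HA \<Gamma> \<Delta> A \<Longrightarrow> wff \<Gamma> B \<Longrightarrow> HA \<Gamma> \<Delta> (Or A B)"
| OrI2: "HA \<Gamma> \<Delta> B \<Longrightarrow> wff \<Gamma> A \<Longrightarrow> HA \<Gamma> \<Delta> (Or A B)"
| OrE: "HA \<Gamma> \<Delta> (Or A B) \<Longrightarrow> HA \<Gamma> (insert A \<Delta>) C \<Longrightarrow> HA \<Gamma> (insert B \<Delta>) C \<Longrightarrow> HA \<Gamma> \<Delta> C"
| ImpI: "wff \<Gamma> A \<Longrightarrow> HA \<Gamma> (insert A \<Delta>) B \<Longrightarrow> HA \<Gamma> \<Delta> (Imp A B)"
| ImpE: "HA \<Gamma> \<Delta> (Imp A B) \<Longrightarrow> HA \<Gamma> \<Delta> A \<Longrightarrow> HA \<Gamma> \<Delta> B"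
| AllI: "HA (\<tau> # \<Gamma>) (fshift ` \<Delta>) A \<Longrightarrow> HA \<Gamma> \<Delta> (All \<tau> A)"
| AllE: "HA \<Gamma> \<Delta> (All \<tau> A) \<Longrightarrow> \<Gamma> \<turnstile> t : \<tau> \<Longrightarrow> HA \<Gamma> \<Delta> (fsub (inst t) A)"
| ExI: "wff (\<tau> # \<Gamma>) A \<Longrightarrow> \<Gamma> \<turnstile> t : \<tau> \<Longrightarrow> HA \<Gamma> \<Delta> (fsub (inst t) A) \<Longrightarrow> HA \<Gamma> \<Delta> (Ex \<tau> A)"
| ExE: "HA \<Gamma> \<Delta> (Ex \<tau> A) \<Longrightarrow> HA (\<tau> # \<Gamma>) (insert A (fshift ` \<Delta>)) (fshift C) \<Longrightarrow> wff \<Gamma> C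
    \<Longrightarrow> HA \<Gamma> \<Delta> C"
| Refl: "\<Gamma> \<turnstile> t : \<tau> \<Longrightarrow> HA \<Gamma> \<Delta> (Eq \<tau> t t)"
| Subst: "wff (\<tau> # \<Gamma>) A \<Longrightarrow> HA \<Gamma> \<Delta> (Eq \<tau> t u) \<Longrightarrow> HA \<Gamma> \<Delta> (fsub (inst t) A)
    \<Longrightarrow> HA \<Gamma> \<Delta> (fsub (inst u) A)"
| Ext: "\<Gamma> \<turnstile> f : \<rho> \<rightarrow> \<eta> \<Longrightarrow> \<Gamma> \<turnstile> g : \<rho> \<rightarrow> \<eta>
    \<Longrightarrow> HA \<Gamma> \<Delta> (All \<rho> (Eq \<eta> (shift f \<cdot> Var 0) (shift g \<cdot> Var 0)))
    \<Longrightarrow> HA \<Gamma> \<Delta> (Eq (\<rho> \<rightarrow> \<eta>) f g)"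
| Beta: "\<rho> # \<Gamma> \<turnstile> t : \<eta> \<Longrightarrow> \<Gamma> \<turnstile> u : \<rho> \<Longrightarrow> HA \<Gamma> \<Delta> (Eq \<eta> (Lam \<rho> t \<cdot> u) (sub (inst u) t))"
| Rec_Zero: "\<Gamma> \<turnstile> a : \<rho> \<Longrightarrow> \<Gamma> \<turnstile> f : N \<rightarrow> \<rho> \<rightarrow> \<rho>
    \<Longrightarrow> HA \<Gamma> \<Delta> (Eq \<rho> (Rec \<rho> \<cdot> a \<cdot> f \<cdot> Zero) a)"
| Rec_Succ: "\<Gamma> \<turnstile> a : \<rho> \<Longrightarrow> \<Gamma> \<turnstile> f : N \<rightarrow> \<rho> \<rightarrow> \<rho> \<Longrightarrow> \<Gamma> \<turnstile> m : N
    \<Longrightarrow> HA \<Gamma> \<Delta> (Eq \<rho> (Rec \<rho> \<cdot> a \<cdot> f \<cdot> (Succ \<cdot> m)) (f \<cdot> m \<cdot> (Rec \<rho> \<cdot> a \<cdot> f \<cdot> m)))"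
| SRec_Emp: "\<Gamma> \<turnstile> a : \<rho> \<Longrightarrow> \<Gamma> \<turnstile> f : Seq \<tau> \<rightarrow> \<tau> \<rightarrow> \<rho> \<rightarrow> \<rho>
    \<Longrightarrow> HA \<Gamma> \<Delta> (Eq \<rho> (SRec \<tau> \<rho> \<cdot> a \<cdot> f \<cdot> Emp \<tau>) a)"
| SRec_Snoc: "\<Gamma> \<turnstile> a : \<rho> \<Longrightarrow> \<Gamma> \<turnstile> f : Seq \<tau> \<rightarrow> \<tau> \<rightarrow> \<rho> \<rightarrow> \<rho> \<Longrightarrow> \<Gamma> \<turnstile> s : Seq \<tau> \<Longrightarrow> \<Gamma> \<turnstile> x : \<tau>
    \<Longrightarrow> HA \<Gamma> \<Delta> (Eq \<rho> (SRec \<tau> \<rho> \<cdot> a \<cdot> f \<cdot> (Snoc \<tau> \<cdot> s \<cdot> x)) (f \<cdot> s \<cdot> x \<cdot> (SRec \<tau> \<rho> \<cdot> a \<cdot> f \<cdot> s)))"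
| Fst_Pair: "\<Gamma> \<turnstile> x : \<tau> \<Longrightarrow> \<Gamma> \<turnstile> y : \<sigma>
    \<Longrightarrow> HA \<Gamma> \<Delta> (Eq \<tau> (Fst \<tau> \<sigma> \<cdot> (Pair \<tau> \<sigma> \<cdot> x \<cdot> y)) x)"
| Snd_Pair: "\<Gamma> \<turnstile> x : \<tau> \<Longrightarrow> \<Gamma> \<turnstile> y : \<sigma>
    \<Longrightarrow> HA \<Gamma> \<Delta> (Eq \<sigma> (Snd \<tau> \<sigma> \<cdot> (Pair \<tau> \<sigma> \<cdot> x \<cdot> y)) y)"
| Pair_Surj: "\<Gamma> \<turnstile> p : \<tau> \<otimes> \<sigma>
    \<Longrightarrow> HA \<Gamma> \<Delta> (Eq (\<tau> \<otimes> \<sigma>) (Pair \<tau> \<sigma> \<cdot> (Fst \<tau> \<sigma> \<cdot> p) \<cdot> (Snd \<tau> \<sigma> \<cdot> p)) p)"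
| Succ_not_Zero: "\<Gamma> \<turnstile> m : N \<Longrightarrow> HA \<Gamma> \<Delta> (Imp (Eq N (Succ \<cdot> m) Zero) Fls)"
| Succ_inj: "\<Gamma> \<turnstile> m : N \<Longrightarrow> \<Gamma> \<turnstile> n : N
    \<Longrightarrow> HA \<Gamma> \<Delta> (Imp (Eq N (Succ \<cdot> m) (Succ \<cdot> n)) (Eq N m n))"
| Ind: "wff (N # \<Gamma>) A \<Longrightarrow> HA \<Gamma> \<Delta> (fsub (inst Zero) A)
    \<Longrightarrow> HA (N # \<Gamma>) (insert A (fshift ` \<Delta>)) (fsub (case_nat (Succ \<cdot> Var 0) (\<lambda>i. Var (i + 1))) A)
    \<Longrightarrow> HA \<Gamma> \<Delta> (All N A)"
| Seq_Ind: "wff (Seq \<tau> # \<Gamma>) A \<Longrightarrow> HA \<Gamma> \<Delta> (fsub (inst (Emp \<tau>)) A)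
    \<Longrightarrow> HA (\<tau> # Seq \<tau> # \<Gamma>) (insert (fshift A) (fren (\<lambda>i. i + 2) ` \<Delta>))
          (fsub (case_nat (Snoc \<tau> \<cdot> Var 1 \<cdot> Var 0) (\<lambda>i. Var (i + 2))) A)
    \<Longrightarrow> HA \<Gamma> \<Delta> (All (Seq \<tau>) A)"


section \<open>Terms and formulas used for bar recursion\<close>

primrec zero :: "ty \<Rightarrow> trm" where
  "zero N = Zero"
| "zero (\<rho> \<rightarrow> \<eta>) = Lam \<rho> (zero \<eta>)"
| "zero (\<tau> \<otimes> \<sigma>) = Pair \<tau> \<sigma> \<cdot> zero \<tau> \<cdot> zero \<sigma>"
| "zero (Seq \<tau>) = Emp \<tau>"

definition len :: "ty \<Rightarrow> trm" where
  "len \<tau> = SRec \<tau> N \<cdot> Zero \<cdot> Lam (Seq \<tau>) (Lam \<tau> (Lam N (Succ \<cdot> Var 0)))"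

text \<open>
  \<open>scons \<tau>\<close> puts \<open>x\<close> in front of an infinite sequence \<open>\<beta>\<close>: its value is \<open>x\<close> at \<open>0\<close> and
  \<open>\<beta> m\<close> at \<open>m + 1\<close>. Then \<open>prepend \<tau>\<close> is concatenation of a finite with an infinite sequence,
  by \<open>prepend Emp \<beta> = \<beta>\<close> and \<open>prepend (s * x) \<beta> = prepend s (scons x \<beta>)\<close>.
\<close>

definition scons :: "ty \<Rightarrow> trm" where
  "scons \<tau> = Lam \<tau> (Lam (N \<rightarrow> \<tau>) (Rec \<tau> \<cdot> Var 1 \<cdot> Lam N (Lam \<tau> (Var 2 \<cdot> Var 1))))"

definition prepend :: "ty \<Rightarrow> trm" where
  "prepend \<tau> = SRec \<tau> ((N \<rightarrow> \<tau>) \<rightarrow> N \<rightarrow> \<tau>)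
     \<cdot> Lam (N \<rightarrow> \<tau>) (Var 0)
     \<cdot> Lam (Seq \<tau>) (Lam \<tau> (Lam ((N \<rightarrow> \<tau>) \<rightarrow> N \<rightarrow> \<tau>) (Lam (N \<rightarrow> \<tau>)
         (Var 1 \<cdot> (scons \<tau> \<cdot> Var 2 \<cdot> Var 0)))))"

text \<open>The extension of a finite sequence by infinitely many zeros.\<close>

definition hat :: "ty \<Rightarrow> trm" where
  "hat \<tau> = Lam (Seq \<tau>) (prepend \<tau> \<cdot> Var 0 \<cdot> zero (N \<rightarrow> \<tau>))"

definition nplus :: "trm \<Rightarrow> trm \<Rightarrow> trm" where
  "nplus a b = Rec N \<cdot> a \<cdot> Lam N (Lam N (Succ \<cdot> Var 0)) \<cdot> b"

definition Less :: "trm \<Rightarrow> trm \<Rightarrow> fm" where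
  "Less a b = Ex N (Eq N (shift b) (nplus (shift a) (Succ \<cdot> Var 0)))"

definition Geq :: "trm \<Rightarrow> trm \<Rightarrow> fm" where
  "Geq a b = Ex N (Eq N (shift a) (nplus (shift b) (Var 0)))"

text \<open>
  The two defining clauses of Spector's bar recursion at \<open>s\<close>, for a functional
  \<open>B : Seq \<tau> \<rightarrow> \<sigma>\<close> in the role of \<open>BR(G, H, Y)\<close>.
\<close>

definition BR_clauses :: "ty \<Rightarrow> ty \<Rightarrow> trm \<Rightarrow> trm \<Rightarrow> trm \<Rightarrow> trm \<Rightarrow> trm \<Rightarrow> fm" where
  "BR_clauses \<tau> \<sigma> G H Y B s =
     And (Imp (Less (Y \<cdot> (hat \<tau> \<cdot> s)) (len \<tau> \<cdot> s))
              (Eq \<sigma> (B \<cdot> s) (G \<cdot> s)))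
         (Imp (Geq (Y \<cdot> (hat \<tau> \<cdot> s)) (len \<tau> \<cdot> s))
              (Eq \<sigma> (B \<cdot> s) (H \<cdot> s \<cdot> Lam \<tau> (shift B \<cdot> (Snoc \<tau> \<cdot> shift s \<cdot> Var 0)))))"

end

theory Submission
  imports Defs
begin

text \<open>
  Idea: every type \<open>\<rho>\<close> is translated to \<open>st \<rho>\<close>, where \<open>st N\<close> consists of pairs \<open>(W, \<B>)\<close> that describe a
  continuous \<open>y : (N \<rightarrow> \<tau>) \<rightarrow> N\<close>: \<open>W s = v + 1\<close> means that the finite sequence \<open>s\<close> secures the value
  \<open>y = v\<close>, \<open>W s = 0\<close> that \<open>s\<close> is not known to secure any value, and \<open>\<B> G H s\<close> is bar recursion that
  stops as soon as \<open>W s \<noteq> 0\<close>. Nesting two such recursors gives bar recursion for the composition of the functionals,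
  so a function \<open>N \<rightarrow> st \<rho>\<close> extends to \<open>st N \<rightarrow> st \<rho>\<close>. A logical relation between \<open>st \<rho>\<close> and
  \<open>(N \<rightarrow> \<tau>) \<rightarrow> \<rho>\<close> then shows that every closed term has a counterpart at the translated type. The
  hypothesis \<open>level \<tau> \<le> 1\<close> is what makes the identity on \<open>N \<rightarrow> \<tau>\<close> have a counterpart: arguments of
  \<open>\<alpha> k : \<tau>\<close> are of level 0 and can be secured completely before \<open>\<alpha> k\<close> is evaluated. Applying the
  counterpart of \<open>t\<close> to that of the identity gives bar recursion up to a securing bar for \<open>t\<close>, and
  Spector's stopping condition is met within finitely many further steps.

  Sequences are handled through the code \<open>(|s|, i \<mapsto> the i-th element of s from the end)\<close>.
\<close>


subsection \<open>Renaming, substitution and typing\<close>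

text \<open>A bound on how much of \<alpha> a term reads would not be enough: it locates a bar, but
  system T gives no way to recurse down to it. So each translated number carries a recursor of its
  own. With \<open>\<tau>\<close> and \<open>\<sigma>\<close> fixed, one recursor that is uniform in
  \<open>G\<close> and \<open>H\<close> survives composition, because the recursor to be run second
  can be passed as the \<open>G\<close> of the one run first.

  A second obstacle is that the conclusion asserts derivability in a given calculus, not truth in a
  model. The relation between translated objects and the objects they describe is therefore a family
  of formulas, defined by recursion on types outside the calculus. Explicit derivations are avoided
  by treating derivability as forcing: statements about all larger worlds become derivations when
  they are applied to a world with fresh variables and the required hypotheses.\<close>

abbreviation upr :: "(nat \<Rightarrow> nat) \<Rightarrow> nat \<Rightarrow> nat" where
  "upr r \<equiv> case_nat 0 (\<lambda>i. Suc (r i))"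

lemma upr_comp: "(\<lambda>i. upr r (upr q i)) = upr (\<lambda>i. r (q i))"
  by (auto split: nat.splits)

lemma ren_ren: "ren r (ren q t) = ren (\<lambda>i. r (q i)) t"
  by (induction t arbitrary: r q) (simp_all add: upr_comp)

lemma up_Var: "up (\<lambda>i. Var (r i)) = (\<lambda>i. Var (upr r i))"
  by (auto simp: up_def split: nat.splits)

text \<open>With renamings read as substitutions, one composition law (\<open>sub_sub\<close> for
  terms, \<open>fsub_fsub\<close> for formulas) covers every mixture of the two.\<close>

lemma ren_as_sub: "ren r t = sub (\<lambda>i. Var (r i)) t"
  by (induction t arbitrary: r) (simp_all add: up_Var)

lemma up_upr: "(\<lambda>i. up \<theta> (upr r i)) = up (\<lambda>i. \<theta> (r i))"
  by (auto simp: up_def split: nat.splits)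

lemma sub_ren: "sub \<theta> (ren r t) = sub (\<lambda>i. \<theta> (r i)) t"
  by (induction t arbitrary: \<theta> r) (simp_all add: up_upr)

lemma ren_up: "(\<lambda>i. ren (upr r) (up \<theta> i)) = up (\<lambda>i. ren r (\<theta> i))"
  by (auto simp: up_def ren_ren split: nat.splits)

lemma ren_sub: "ren r (sub \<theta> t) = sub (\<lambda>i. ren r (\<theta> i)) t"
  by (induction t arbitrary: \<theta> r) (simp_all add: ren_up)

lemma sub_up_up: "(\<lambda>i. sub (up \<theta>) (up \<theta>' i)) = up (\<lambda>i. sub \<theta> (\<theta>' i))"
  by (auto simp: up_def sub_ren ren_sub split: nat.splits)

lemma sub_sub: "sub \<theta> (sub \<theta>' t) = sub (\<lambda>i. sub \<theta> (\<theta>' i)) t"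
  by (induction t arbitrary: \<theta> \<theta>') (simp_all add: sub_up_up)

text \<open>Together with \<open>sub_inst_shift\<close> this lets the simplifier instantiate under
  binders, since parameters that occur there are always written with \<open>shift\<close>.\<close>

lemma sub_up_shift [simp]: "sub (up \<theta>) (shift t) = shift (sub \<theta> t)"
  by (simp add: sub_ren ren_sub) (simp add: up_def)

lemma sub_Var: "sub Var t = t"
proof (induction t)
  case (Lam \<rho> t)
  have "up Var = Var" by (auto simp: up_def split: nat.splits)
  then show ?case using Lam by simp
qed simp_all

lemma sub_inst_shift [simp]: "sub (inst u) (shift t) = t"
  by (simp add: sub_ren inst_def sub_Var)

lemma fren_as_fsub: "fren r A = fsub (\<lambda>i. Var (r i)) A"
  by (induction A arbitrary: r) (simp_all add: ren_as_sub up_Var)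

lemma fsub_fsub: "fsub \<theta> (fsub \<theta>' A) = fsub (\<lambda>i. sub \<theta> (\<theta>' i)) A"
  by (induction A arbitrary: \<theta> \<theta>') (simp_all add: sub_sub sub_up_up)

lemma fsub_Var: "fsub Var A = A"
proof (induction A)
  have "up Var = Var" by (auto simp: up_def split: nat.splits)
  moreover case (All \<rho> A)
  ultimately show ?case by simp
next
  have "up Var = Var" by (auto simp: up_def split: nat.splits)
  moreover case (Ex \<rho> A)
  ultimately show ?case by simp
qed (simp_all add: sub_Var)

lemma fren_id: "fren (\<lambda>i. i) A = A"
  by (simp add: fren_as_fsub fsub_Var)

lemma inst_simps [simp]: "inst u 0 = u" "inst u (Suc i) = Var i" "inst u 1 = Var 0"
  by (simp_all add: inst_def)

lemma up_simps [simp]: "up \<theta> 0 = Var 0" "up \<theta> (Suc i) = shift (\<theta> i)" "up \<theta> 1 = shift (\<theta> 0)"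
  by (simp_all add: up_def)

section \<open>Typing as a computable partial function\<close>

primrec tapp :: "ty \<Rightarrow> ty option \<Rightarrow> ty option" where
  "tapp N v = None"
| "tapp (\<rho> \<rightarrow> \<eta>) v = (if v = Some \<rho> then Some \<eta> else None)"
| "tapp (\<rho> \<otimes> \<eta>) v = None"
| "tapp (Seq \<rho>) v = None"

text \<open>Kept apart from \<open>tyof\<close> because values, and not only terms, get their types
  through it (\<open>tyv_app\<close>).\<close>

definition appt :: "ty option \<Rightarrow> ty option \<Rightarrow> ty option" where
  "appt u v = (case u of None \<Rightarrow> None | Some \<rho> \<Rightarrow> tapp \<rho> v)"

lemma appt_simps [simp]: "appt None v = None" "appt (Some (\<rho> \<rightarrow> \<eta>)) v = (if v = Some \<rho> then Some \<eta> else None)"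
  "appt u None = None" "appt (Some N) v = None" "appt (Some (\<rho> \<otimes> \<eta>)) v = None" "appt (Some (Seq \<rho>)) v = None"
       apply (simp_all add: appt_def)
  apply (cases u; simp; rename_tac a; case_tac a; simp)
  done

lemma appt_Some: "appt u v = Some \<eta> \<longleftrightarrow> (\<exists>\<rho>. u = Some (\<rho> \<rightarrow> \<eta>) \<and> v = Some \<rho>)"
  by (cases u; simp; rename_tac a; case_tac a; auto)

text \<open>Types of terms are unique, so inference is a partial function, and \<open>simp\<close>
  settles typing goals by rewriting instead of a search through the rules of
  \<open>wt\<close>.\<close>

primrec tyof :: "ty list \<Rightarrow> trm \<Rightarrow> ty option" where
  "tyof \<Gamma> (Var i) = (if i < length \<Gamma> then Some (\<Gamma> ! i) else None)"
| "tyof \<Gamma> (t \<cdot> u) = appt (tyof \<Gamma> t) (tyof \<Gamma> u)"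
| "tyof \<Gamma> (Lam \<rho> t) = map_option (\<lambda>\<eta>. \<rho> \<rightarrow> \<eta>) (tyof (\<rho> # \<Gamma>) t)"
| "tyof \<Gamma> Zero = Some N"
| "tyof \<Gamma> Succ = Some (N \<rightarrow> N)"
| "tyof \<Gamma> (Rec \<rho>) = Some (\<rho> \<rightarrow> (N \<rightarrow> \<rho> \<rightarrow> \<rho>) \<rightarrow> N \<rightarrow> \<rho>)"
| "tyof \<Gamma> (Emp \<tau>) = Some (Seq \<tau>)"
| "tyof \<Gamma> (Snoc \<tau>) = Some (Seq \<tau> \<rightarrow> \<tau> \<rightarrow> Seq \<tau>)"
| "tyof \<Gamma> (SRec \<tau> \<rho>) = Some (\<rho> \<rightarrow> (Seq \<tau> \<rightarrow> \<tau> \<rightarrow> \<rho> \<rightarrow> \<rho>) \<rightarrow> Seq \<tau> \<rightarrow> \<rho>)"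
| "tyof \<Gamma> (Pair \<tau> \<sigma>) = Some (\<tau> \<rightarrow> \<sigma> \<rightarrow> \<tau> \<otimes> \<sigma>)"
| "tyof \<Gamma> (Fst \<tau> \<sigma>) = Some (\<tau> \<otimes> \<sigma> \<rightarrow> \<tau>)"
| "tyof \<Gamma> (Snd \<tau> \<sigma>) = Some (\<tau> \<otimes> \<sigma> \<rightarrow> \<sigma>)"

lemma wt_tyof: "\<Gamma> \<turnstile> t : \<rho> \<Longrightarrow> tyof \<Gamma> t = Some \<rho>"
  by (induction rule: wt.induct) auto

lemma tyof_wt: "tyof \<Gamma> t = Some \<rho> \<Longrightarrow> \<Gamma> \<turnstile> t : \<rho>"
proof (induction t arbitrary: \<Gamma> \<rho>)
  case (App t u)
  from App.prems obtain \<kappa> where "tyof \<Gamma> t = Some (\<kappa> \<rightarrow> \<rho>)" "tyof \<Gamma> u = Some \<kappa>"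
    by (auto simp: appt_Some)
  then show ?case using App.IH wt_App by blast
qed (auto intro: wt.intros split: if_splits)

lemma wt_iff: "\<Gamma> \<turnstile> t : \<rho> \<longleftrightarrow> tyof \<Gamma> t = Some \<rho>"
  using wt_tyof tyof_wt by blast

lemma wff_simps [simp]:
  "wff \<Gamma> (Eq \<rho> t u) \<longleftrightarrow> tyof \<Gamma> t = Some \<rho> \<and> tyof \<Gamma> u = Some \<rho>"
  "wff \<Gamma> Fls"
  "wff \<Gamma> (And A B) \<longleftrightarrow> wff \<Gamma> A \<and> wff \<Gamma> B"
  "wff \<Gamma> (Or A B) \<longleftrightarrow> wff \<Gamma> A \<and> wff \<Gamma> B"
  "wff \<Gamma> (Imp A B) \<longleftrightarrow> wff \<Gamma> A \<and> wff \<Gamma> B"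
  "wff \<Gamma> (All \<rho> A) \<longleftrightarrow> wff (\<rho> # \<Gamma>) A"
  "wff \<Gamma> (Ex \<rho> A) \<longleftrightarrow> wff (\<rho> # \<Gamma>) A"
  by (auto simp: wt_iff intro: wff.intros elim: wff.cases)

lemma tyof_ren:
  "(\<And>i. i < length \<Gamma> \<Longrightarrow> r i < length \<Gamma>' \<and> \<Gamma>' ! r i = \<Gamma> ! i) \<Longrightarrow> tyof \<Gamma> t = Some \<rho>
    \<Longrightarrow> tyof \<Gamma>' (ren r t) = Some \<rho>"
proof (induction t arbitrary: r \<Gamma> \<Gamma>' \<rho>)
  case (App t u)
  from App.prems(2) obtain \<kappa> where "tyof \<Gamma> t = Some (\<kappa> \<rightarrow> \<rho>)" "tyof \<Gamma> u = Some \<kappa>"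
    by (auto simp: appt_Some)
  then show ?case using App.IH[OF App.prems(1)] by (simp add: appt_Some)
next
  case (Lam \<kappa> t)
  then obtain \<eta> where e: "tyof (\<kappa> # \<Gamma>) t = Some \<eta>" "\<rho> = \<kappa> \<rightarrow> \<eta>" by auto
  have "tyof (\<kappa> # \<Gamma>') (ren (upr r) t) = Some \<eta>"
    by (rule Lam.IH[OF _ e(1)]) (auto simp: less_Suc_eq_0_disj Lam.prems)
  then show ?case using e by simp
qed (auto split: if_splits)

lemma tyof_shift_Some: "tyof \<Gamma> t = Some \<rho> \<Longrightarrow> tyof (\<kappa> # \<Gamma>) (shift t) = Some \<rho>"
  by (rule tyof_ren) auto

lemma tyof_sub:
  "(\<And>i. i < length \<Gamma> \<Longrightarrow> tyof \<Gamma>' (\<theta> i) = Some (\<Gamma> ! i)) \<Longrightarrow> tyof \<Gamma> t = Some \<rho>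
    \<Longrightarrow> tyof \<Gamma>' (sub \<theta> t) = Some \<rho>"
proof (induction t arbitrary: \<theta> \<Gamma> \<Gamma>' \<rho>)
  case (App t u)
  from App.prems(2) obtain \<kappa> where "tyof \<Gamma> t = Some (\<kappa> \<rightarrow> \<rho>)" "tyof \<Gamma> u = Some \<kappa>"
    by (auto simp: appt_Some)
  then show ?case using App.IH[OF App.prems(1)] by (simp add: appt_Some)
next
  case (Lam \<kappa> t)
  then obtain \<eta> where e: "tyof (\<kappa> # \<Gamma>) t = Some \<eta>" "\<rho> = \<kappa> \<rightarrow> \<eta>" by auto
  have "tyof (\<kappa> # \<Gamma>') (sub (up \<theta>) t) = Some \<eta>"
    by (rule Lam.IH[OF _ e(1)]) (auto simp: less_Suc_eq_0_disj Lam.prems tyof_shift_Some)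
  then show ?case using e by simp
qed (auto split: if_splits)

lemma wff_sub:
  "(\<And>i. i < length \<Gamma> \<Longrightarrow> tyof \<Gamma>' (\<theta> i) = Some (\<Gamma> ! i)) \<Longrightarrow> wff \<Gamma> A \<Longrightarrow> wff \<Gamma>' (fsub \<theta> A)"
proof (induction A arbitrary: \<theta> \<Gamma> \<Gamma>')
  case (All \<rho> A)
  then show ?case
    by (auto intro!: All.IH[of "\<rho> # \<Gamma>"] simp: less_Suc_eq_0_disj tyof_shift_Some)
next
  case (Ex \<rho> A)
  then show ?case
    by (auto intro!: Ex.IH[of "\<rho> # \<Gamma>"] simp: less_Suc_eq_0_disj tyof_shift_Some)
next
  case (Eq \<rho> t u)
  then show ?case using tyof_sub[OF Eq.prems(1)] by simp
next
  case (And A B)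
  then show ?case using And.IH(1)[OF And.prems(1)] And.IH(2)[OF And.prems(1)] by simp
next
  case (Or A B)
  then show ?case using Or.IH(1)[OF Or.prems(1)] Or.IH(2)[OF Or.prems(1)] by simp
next
  case (Imp A B)
  then show ?case using Imp.IH(1)[OF Imp.prems(1)] Imp.IH(2)[OF Imp.prems(1)] by simp
qed simp_all

lemma inst_ok: "tyof \<Gamma> t = Some \<rho> \<Longrightarrow> i < length (\<rho> # \<Gamma>) \<Longrightarrow> tyof \<Gamma> (inst t i) = Some ((\<rho> # \<Gamma>) ! i)"
  by (cases i) auto

lemma wff_inst: "wff (\<rho> # \<Gamma>) A \<Longrightarrow> tyof \<Gamma> t = Some \<rho> \<Longrightarrow> wff \<Gamma> (fsub (inst t) A)"
  by (rule wff_sub[OF inst_ok])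

lemma wff_ren:
  "wff \<Gamma> A \<Longrightarrow> (\<And>i. i < length \<Gamma> \<Longrightarrow> r i < length \<Gamma>' \<and> \<Gamma>' ! r i = \<Gamma> ! i) \<Longrightarrow> wff \<Gamma>' (fren r A)"
  unfolding fren_as_fsub by (erule wff_sub[rotated]) simp

lemma tyof_inst: "tyof (\<rho> # \<Gamma>) t = Some \<eta> \<Longrightarrow> tyof \<Gamma> u = Some \<rho> \<Longrightarrow> tyof \<Gamma> (sub (inst u) t) = Some \<eta>"
  by (rule tyof_sub[OF inst_ok])

text \<open>Only variables of the context occur in a typed term. Renamings that make sense on one
  context only, such as rotations, can thus be compared there.\<close>

lemma sub_cong: "tyof \<Gamma> t = Some \<rho> \<Longrightarrow> (\<And>i. i < length \<Gamma> \<Longrightarrow> \<theta> i = \<theta>' i) \<Longrightarrow> sub \<theta> t = sub \<theta>' t"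
proof (induction t arbitrary: \<theta> \<theta>' \<Gamma> \<rho>)
  case (App t u)
  from App.prems(1) obtain \<kappa> where "tyof \<Gamma> t = Some (\<kappa> \<rightarrow> \<rho>)" "tyof \<Gamma> u = Some \<kappa>"
    by (auto simp: appt_Some)
  then show ?case using App.IH(1)[OF _ App.prems(2)] App.IH(2)[OF _ App.prems(2)] by simp
next
  case (Lam \<kappa> t)
  then obtain \<eta> where e: "tyof (\<kappa> # \<Gamma>) t = Some \<eta>" by auto
  show ?case by (auto intro!: Lam.IH[OF e] simp: less_Suc_eq_0_disj Lam.prems)
qed (auto split: if_splits)

lemma fsub_cong: "wff \<Gamma> A \<Longrightarrow> (\<And>i. i < length \<Gamma> \<Longrightarrow> \<theta> i = \<theta>' i) \<Longrightarrow> fsub \<theta> A = fsub \<theta>' A"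
proof (induction A arbitrary: \<theta> \<theta>' \<Gamma>)
  case (All \<rho> A)
  show ?case using All.prems by (auto intro!: All.IH[of "\<rho> # \<Gamma>"] simp: less_Suc_eq_0_disj)
next
  case (Ex \<rho> A)
  show ?case using Ex.prems by (auto intro!: Ex.IH[of "\<rho> # \<Gamma>"] simp: less_Suc_eq_0_disj)
next
  case (Eq \<rho> t u)
  then show ?case using sub_cong[OF _ Eq.prems(2)] by auto
next
  case (And A B)
  then show ?case using And.IH[of \<Gamma> \<theta> \<theta>'] by simp
next
  case (Or A B)
  then show ?case using Or.IH[of \<Gamma> \<theta> \<theta>'] by simp
next
  case (Imp A B)
  then show ?case using Imp.IH[of \<Gamma> \<theta> \<theta>'] by simp
qed simp_all

lemma fren_inst: "fren r (fsub (inst t) A) = fsub (inst (ren r t)) (fren (upr r) A)"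
proof -
  have "(\<lambda>i. sub (\<lambda>i. Var (r i)) (inst t i)) = (\<lambda>i. sub (inst (sub (\<lambda>i. Var (r i)) t)) (Var (upr r i)))"
    by (auto simp: inst_def split: nat.splits)
  then show ?thesis by (simp add: fren_as_fsub fsub_fsub ren_as_sub)
qed

lemma ren_inst: "ren r (sub (inst t) u) = sub (inst (ren r t)) (ren (upr r) u)"
proof -
  have "(\<lambda>i. sub (\<lambda>i. Var (r i)) (inst t i)) = (\<lambda>i. sub (inst (sub (\<lambda>i. Var (r i)) t)) (Var (upr r i)))"
    by (auto simp: inst_def split: nat.splits)
  then show ?thesis by (simp add: ren_as_sub sub_sub)
qed

lemma fren_fren: "fren r (fren q A) = fren (\<lambda>i. r (q i)) A"
  by (simp add: fren_as_fsub fsub_fsub)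

lemma ren_shift: "ren (upr r) (shift t) = shift (ren r t)"
  by (simp add: ren_ren)

lemma fren_fshift: "fren (upr r) (fshift A) = fshift (fren r A)"
  by (simp add: fren_fren)

section \<open>Derivations under renaming\<close>

lemma HA_wff: "HA \<Gamma> \<Delta> A \<Longrightarrow> wff \<Gamma> A"
proof (induction rule: HA.induct)
  case (AllE \<Gamma> \<Delta> \<tau> A t) then show ?case by (simp add: wt_iff wff_inst)
next
  case (Subst \<tau> \<Gamma> A \<Delta> t u) then show ?case by (simp add: wff_inst)
next
  case (Beta \<rho> \<Gamma> t \<eta> u \<Delta>) then show ?case by (simp add: wt_iff tyof_inst)
qed (auto simp: wt_iff)

definition okr :: "ty list \<Rightarrow> ty list \<Rightarrow> (nat \<Rightarrow> nat) \<Rightarrow> bool" where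
  "okr \<Gamma> \<Gamma>' r \<longleftrightarrow> (\<forall>i < length \<Gamma>. r i < length \<Gamma>' \<and> \<Gamma>' ! r i = \<Gamma> ! i)"

lemma okr_wff: "okr \<Gamma> \<Gamma>' r \<Longrightarrow> wff \<Gamma> A \<Longrightarrow> wff \<Gamma>' (fren r A)"
  by (erule wff_ren) (simp_all add: okr_def)

lemma okr_ty: "okr \<Gamma> \<Gamma>' r \<Longrightarrow> tyof \<Gamma> t = Some \<rho> \<Longrightarrow> tyof \<Gamma>' (ren r t) = Some \<rho>"
  by (rule tyof_ren) (simp_all add: okr_def)

lemma okr_up: "okr \<Gamma> \<Gamma>' r \<Longrightarrow> okr (\<rho> # \<Gamma>) (\<rho> # \<Gamma>') (upr r)"
  by (auto simp: okr_def less_Suc_eq_0_disj)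

lemma fren_fshift_image: "fren r ` \<Delta> \<subseteq> \<Delta>' \<Longrightarrow> fren (upr r) ` fshift ` \<Delta> \<subseteq> fshift ` \<Delta>'"
  by (auto simp: fren_fshift)

text \<open>Weakening by variables, weakening by hypotheses and exchange of variables are proved
  together, because binders turn \<open>r\<close> into \<open>upr r\<close> and the induction needs
  arbitrary renamings in any case. Monotonicity of forcing rests on it, and so does the passage
  between a new variable at the end of a context and one at its head.\<close>

lemma HA_ren:
  "HA \<Gamma> \<Delta> A \<Longrightarrow> okr \<Gamma> \<Gamma>' r \<Longrightarrow> fren r ` \<Delta> \<subseteq> \<Delta>' \<Longrightarrow> HA \<Gamma>' \<Delta>' (fren r A)"
proof (induction arbitrary: r \<Gamma>' \<Delta>' rule: HA.induct)
  case (Asm A \<Delta> \<Gamma>)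
  then show ?case by (intro HA.Asm) (auto simp: okr_wff)
next
  case (FlsE \<Gamma> \<Delta> A)
  have "HA \<Gamma>' \<Delta>' Fls" using FlsE.IH[OF FlsE.prems] by simp
  then show ?case by (rule HA.FlsE) (rule okr_wff[OF FlsE.prems(1) FlsE.hyps(2)])
next
  case (AndI \<Gamma> \<Delta> A B) then show ?case by (auto intro: HA.AndI)
next
  case (AndE1 \<Gamma> \<Delta> A B)
  then have "HA \<Gamma>' \<Delta>' (And (fren r A) (fren r B))" by simp
  then show ?case by (rule HA.AndE1)
next
  case (AndE2 \<Gamma> \<Delta> A B)
  then have "HA \<Gamma>' \<Delta>' (And (fren r A) (fren r B))" by simp
  then show ?case by (rule HA.AndE2)
next
  case (OrI1 \<Gamma> \<Delta> A B) then show ?case by (auto intro: HA.OrI1 simp: okr_wff)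
next
  case (OrI2 \<Gamma> \<Delta> A B) then show ?case by (auto intro: HA.OrI2 simp: okr_wff)
next
  case (OrE \<Gamma> \<Delta> A B C)
  have "HA \<Gamma>' \<Delta>' (Or (fren r A) (fren r B))" using OrE.IH(1)[OF OrE.prems] by simp
  moreover have "HA \<Gamma>' (insert (fren r A) \<Delta>') (fren r C)"
    by (rule OrE.IH(2)[OF OrE.prems(1)]) (use OrE.prems in auto)
  moreover have "HA \<Gamma>' (insert (fren r B) \<Delta>') (fren r C)"
    by (rule OrE.IH(3)[OF OrE.prems(1)]) (use OrE.prems in auto)
  ultimately show ?case by (rule HA.OrE)
next
  case (ImpI \<Gamma> A \<Delta> B)
  have "HA \<Gamma>' (insert (fren r A) \<Delta>') (fren r B)"
    by (rule ImpI.IH[OF ImpI.prems(1)]) (use ImpI.prems in auto)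
  moreover have "wff \<Gamma>' (fren r A)" by (rule okr_wff[OF ImpI.prems(1) ImpI.hyps(1)])
  ultimately show ?case by (simp add: HA.ImpI)
next
  case (ImpE \<Gamma> \<Delta> A B)
  have "HA \<Gamma>' \<Delta>' (Imp (fren r A) (fren r B))" using ImpE.IH(1)[OF ImpE.prems] by simp
  moreover have "HA \<Gamma>' \<Delta>' (fren r A)" using ImpE by blast
  ultimately show ?case by (rule HA.ImpE)
next
  case (AllI \<tau> \<Gamma> \<Delta> A)
  have "HA (\<tau> # \<Gamma>') (fshift ` \<Delta>') (fren (upr r) A)"
    by (rule AllI.IH[OF okr_up fren_fshift_image]) (use AllI.prems in auto)
  then show ?case by (simp add: HA.AllI)
next
  case (AllE \<Gamma> \<Delta> \<tau> A t)
  have "HA \<Gamma>' \<Delta>' (All \<tau> (fren (upr r) A))" using AllE.IH[OF AllE.prems] by simp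
  moreover have "\<Gamma>' \<turnstile> ren r t : \<tau>" using AllE okr_ty by (simp add: wt_iff)
  ultimately show ?case unfolding fren_inst by (rule HA.AllE)
next
  case (ExI \<tau> \<Gamma> A t \<Delta>)
  have "HA \<Gamma>' \<Delta>' (fren r (fsub (inst t) A))" by (rule ExI.IH[OF ExI.prems])
  moreover have "\<Gamma>' \<turnstile> ren r t : \<tau>" using ExI okr_ty by (simp add: wt_iff)
  moreover have "wff (\<tau> # \<Gamma>') (fren (upr r) A)" by (rule okr_wff[OF okr_up[OF ExI.prems(1)] ExI.hyps(1)])
  ultimately show ?case by (simp add: fren_inst HA.ExI)
next
  case (ExE \<Gamma> \<Delta> \<tau> A C)
  have 1: "HA \<Gamma>' \<Delta>' (Ex \<tau> (fren (upr r) A))" using ExE.IH(1)[OF ExE.prems] by simp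
  have 2: "HA (\<tau> # \<Gamma>') (insert (fren (upr r) A) (fshift ` \<Delta>')) (fren (upr r) (fshift C))"
    by (rule ExE.IH(2)[OF okr_up]) (use ExE.prems fren_fshift_image[OF ExE.prems(2)] in auto)
  have 3: "wff \<Gamma>' (fren r C)" by (rule okr_wff[OF ExE.prems(1) ExE.hyps(3)])
  from 1 2 [unfolded fren_fshift] 3 show ?case by (rule HA.ExE)
next
  case (Subst \<tau> \<Gamma> A \<Delta> t u)
  have "HA \<Gamma>' \<Delta>' (fsub (inst (ren r t)) (fren (upr r) A))" using Subst.IH(2)[OF Subst.prems] by (simp add: fren_inst)
  moreover have "HA \<Gamma>' \<Delta>' (Eq \<tau> (ren r t) (ren r u))" using Subst.IH(1)[OF Subst.prems] by simp
  moreover have "wff (\<tau> # \<Gamma>') (fren (upr r) A)" by (rule okr_wff[OF okr_up[OF Subst.prems(1)] Subst.hyps(1)])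
  ultimately show ?case unfolding fren_inst by (metis HA.Subst)
next
  case (Ext \<Gamma> f \<rho> \<eta> g \<Delta>)
  have "HA \<Gamma>' \<Delta>' (fren r (All \<rho> (Eq \<eta> (shift f \<cdot> Var 0) (shift g \<cdot> Var 0))))" by (rule Ext.IH[OF Ext.prems])
  moreover have "\<Gamma>' \<turnstile> ren r f : \<rho> \<rightarrow> \<eta>" "\<Gamma>' \<turnstile> ren r g : \<rho> \<rightarrow> \<eta>"
    using Ext okr_ty by (simp_all add: wt_iff)
  ultimately show ?case by (simp only: fren.simps ren.simps ren_shift nat.case) (rule HA.Ext)
next
  case (Beta \<rho> \<Gamma> t \<eta> u \<Delta>)
  have "\<Gamma>' \<turnstile> ren r u : \<rho>" "\<rho> # \<Gamma>' \<turnstile> ren (upr r) t : \<eta>"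
    using okr_ty[OF okr_up[OF Beta.prems(1)]] okr_ty[OF Beta.prems(1)] Beta.hyps by (simp_all add: wt_iff)
  then show ?case by (simp add: ren_inst HA.Beta)
next
  case (Ind \<Gamma> A \<Delta>)
  have 1: "wff (N # \<Gamma>') (fren (upr r) A)" by (rule okr_wff[OF okr_up[OF Ind.prems(1)] Ind.hyps(1)])
  have "HA \<Gamma>' \<Delta>' (fren r (fsub (inst Zero) A))" by (rule Ind.IH(1)[OF Ind.prems])
  then have 2: "HA \<Gamma>' \<Delta>' (fsub (inst Zero) (fren (upr r) A))" by (simp add: fren_inst)
  have "HA (N # \<Gamma>') (insert (fren (upr r) A) (fshift ` \<Delta>')) (fren (upr r) (fsub (case_nat (Succ \<cdot> Var 0) (\<lambda>i. Var (i + 1))) A))"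
    by (rule Ind.IH(2)[OF okr_up]) (use Ind.prems fren_fshift_image[OF Ind.prems(2)] in auto)
  \<comment> \<open>The successor substitution changes only \<open>Var 0\<close>, which
    \<open>upr r\<close> fixes, so the two commute.\<close>
  moreover have "fren (upr r) (fsub (case_nat (Succ \<cdot> Var 0) (\<lambda>i. Var (i + 1))) A)
    = fsub (case_nat (Succ \<cdot> Var 0) (\<lambda>i. Var (i + 1))) (fren (upr r) A)"
    unfolding fren_as_fsub fsub_fsub by (rule arg_cong2[of _ _ _ _ fsub]) (auto split: nat.splits)
  ultimately have "HA \<Gamma>' \<Delta>' (All N (fren (upr r) A))" using 1 2 by (simp add: HA.Ind)
  then show ?case by simp
next
  case (Seq_Ind \<tau> \<Gamma> A \<Delta>)
  have 1: "wff (Seq \<tau> # \<Gamma>') (fren (upr r) A)" by (rule okr_wff[OF okr_up[OF Seq_Ind.prems(1)] Seq_Ind.hyps(1)])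
  have "HA \<Gamma>' \<Delta>' (fren r (fsub (inst (Emp \<tau>)) A))" by (rule Seq_Ind.IH(1)[OF Seq_Ind.prems])
  then have 2: "HA \<Gamma>' \<Delta>' (fsub (inst (Emp \<tau>)) (fren (upr r) A))" by (simp add: fren_inst)
  have "HA (\<tau> # Seq \<tau> # \<Gamma>') (insert (fshift (fren (upr r) A)) (fren (\<lambda>i. i + 2) ` \<Delta>'))
    (fren (upr (upr r)) (fsub (case_nat (Snoc \<tau> \<cdot> Var 1 \<cdot> Var 0) (\<lambda>i. Var (i + 2))) A))"
  proof (rule Seq_Ind.IH(2)[OF okr_up[OF okr_up[OF Seq_Ind.prems(1)]]])
    have "\<And>B. B \<in> \<Delta> \<Longrightarrow> fren (upr (upr r)) (fren (\<lambda>i. i + 2) B) = fren (\<lambda>i. i + 2) (fren r B)"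
      unfolding fren_fren by simp
    moreover have "fren (upr (upr r)) (fshift A) = fshift (fren (upr r) A)" by (rule fren_fshift)
    ultimately show "fren (upr (upr r)) ` insert (fshift A) (fren (\<lambda>i. i + 2) ` \<Delta>) \<subseteq> insert (fshift (fren (upr r) A)) (fren (\<lambda>i. i + 2) ` \<Delta>')"
      using Seq_Ind.prems(2) by auto
  qed
  moreover have "fren (upr (upr r)) (fsub (case_nat (Snoc \<tau> \<cdot> Var 1 \<cdot> Var 0) (\<lambda>i. Var (i + 2))) A)
    = fsub (case_nat (Snoc \<tau> \<cdot> Var 1 \<cdot> Var 0) (\<lambda>i. Var (i + 2))) (fren (upr r) A)"
    unfolding fren_as_fsub fsub_fsub by (rule arg_cong2[of _ _ _ _ fsub]) (auto split: nat.splits)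
  ultimately have "HA \<Gamma>' \<Delta>' (All (Seq \<tau>) (fren (upr r) A))" using 1 2 by (metis HA.Seq_Ind)
  then show ?case by simp
qed (auto intro!: HA.Refl HA.Rec_Zero HA.Rec_Succ HA.SRec_Emp HA.SRec_Snoc HA.Fst_Pair HA.Snd_Pair
    HA.Pair_Surj HA.Succ_not_Zero HA.Succ_inj simp: wt_iff okr_ty)

subsection \<open>Worlds\<close>

text \<open>Well-formed hypotheses mention no variable beyond the context. For them, moving a fresh
  last variable to the front is the same as a shift (\<open>fren_rot\<close>).\<close>

typedef world = "{p :: ty list \<times> fm set. \<forall>A\<in>snd p. wff (fst p) A}"
  by (rule exI[of _ "([], {})"]) simp

definition ctx :: "world \<Rightarrow> ty list" where "ctx w = fst (Rep_world w)"
definition hyp :: "world \<Rightarrow> fm set" where "hyp w = snd (Rep_world w)"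
definition mkw :: "ty list \<Rightarrow> fm set \<Rightarrow> world" where "mkw \<Gamma> \<Delta> = Abs_world (\<Gamma>, \<Delta>)"

lemma hyp_wff: "A \<in> hyp w \<Longrightarrow> wff (ctx w) A"
  using Rep_world[of w] by (auto simp: ctx_def hyp_def)

lemma mkw_simps:
  assumes "\<And>A. A \<in> \<Delta> \<Longrightarrow> wff \<Gamma> A"
  shows "ctx (mkw \<Gamma> \<Delta>) = \<Gamma>" "hyp (mkw \<Gamma> \<Delta>) = \<Delta>"
  using assms by (simp_all add: ctx_def hyp_def mkw_def Abs_world_inverse)

definition forces :: "world \<Rightarrow> fm \<Rightarrow> bool" (infix \<open>\<tturnstile>\<close> 50) where
  "w \<tturnstile> A \<longleftrightarrow> HA (ctx w) (hyp w) A"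

text \<open>
  Derivability is a Kripke model of itself. A larger world has new variables at the \<^emph>\<open>end\<close> of its
  context, so that terms and formulas of the smaller world are used there without shifting.
\<close>

definition wle :: "world \<Rightarrow> world \<Rightarrow> bool" (infix \<open>\<sqsubseteq>\<close> 50) where
  "w \<sqsubseteq> w' \<longleftrightarrow> (\<exists>\<Gamma>. ctx w' = ctx w @ \<Gamma>) \<and> hyp w \<subseteq> hyp w'"

abbreviation ty :: "world \<Rightarrow> trm \<Rightarrow> ty option" where "ty w \<equiv> tyof (ctx w)"

lemma wle_refl [simp]: "w \<sqsubseteq> w" by (auto simp: wle_def)

lemma wle_trans [trans]: "w \<sqsubseteq> w' \<Longrightarrow> w' \<sqsubseteq> w'' \<Longrightarrow> w \<sqsubseteq> w''" by (auto simp: wle_def)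

lemma okr_append: "okr \<Gamma> (\<Gamma> @ \<Gamma>') (\<lambda>i. i)"
  by (simp add: okr_def nth_append)

lemma ren_id: "ren (\<lambda>i. i) t = t"
  by (simp add: ren_as_sub sub_Var)

lemma tyof_append: "tyof \<Gamma> t = Some \<rho> \<Longrightarrow> tyof (\<Gamma> @ \<Gamma>') t = Some \<rho>"
  using okr_ty[OF okr_append] by (metis ren_id)

lemma wff_append: "wff \<Gamma> A \<Longrightarrow> wff (\<Gamma> @ \<Gamma>') A"
  using okr_wff[OF okr_append] by (metis fren_id)

lemma ty_mono: "w \<sqsubseteq> w' \<Longrightarrow> ty w t = Some \<rho> \<Longrightarrow> ty w' t = Some \<rho>"
  by (auto simp: wle_def tyof_append)

lemmas ty_up = ty_mono[rotated]

lemma wff_mono: "w \<sqsubseteq> w' \<Longrightarrow> wff (ctx w) A \<Longrightarrow> wff (ctx w') A"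
  by (auto simp: wle_def wff_append)

text \<open>This is \<open>HA_ren\<close> for the identity renaming.\<close>

lemma forces_mono: "w \<sqsubseteq> w' \<Longrightarrow> w \<tturnstile> A \<Longrightarrow> w' \<tturnstile> A"
proof -
  assume "w \<sqsubseteq> w'" "w \<tturnstile> A"
  then obtain \<Gamma> where "ctx w' = ctx w @ \<Gamma>" "hyp w \<subseteq> hyp w'" "HA (ctx w) (hyp w) A"
    by (auto simp: wle_def forces_def)
  then show "w' \<tturnstile> A"
    using HA_ren[OF _ okr_append, of "ctx w" "hyp w" A "hyp w'" \<Gamma>] by (simp add: fren_id forces_def)
qed

lemma forces_wff: "w \<tturnstile> A \<Longrightarrow> wff (ctx w) A"
  by (simp add: forces_def HA_wff)

lemma tyof_closed: "tyof [] t = Some \<rho> \<Longrightarrow> tyof \<Gamma> t = Some \<rho>"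
  using tyof_append[of "[]" t \<rho> \<Gamma>] by simp

lemma sub_closed: "tyof [] t = Some \<rho> \<Longrightarrow> sub \<theta> t = t"
  using sub_cong[of "[]" t \<rho> \<theta> Var] by (simp add: sub_Var)

lemma ren_closed: "tyof [] t = Some \<rho> \<Longrightarrow> ren r t = t"
  by (simp add: ren_as_sub sub_closed)

lemma fsub_inst_fshift [simp]: "fsub (inst u) (fshift A) = A"
  by (simp add: fren_as_fsub fsub_fsub fsub_Var)

subsection \<open>Connectives\<close>

text \<open>Larger worlds add a variable at the end of the context, the rules of \<open>HA\<close>
  add it at the head. This renaming mediates: the new variable has index \<open>n\<close> and goes
  to \<open>0\<close>, the old ones make room.\<close>

abbreviation rot :: "nat \<Rightarrow> nat \<Rightarrow> nat" where
  "rot n \<equiv> \<lambda>i. if i < n then Suc i else 0"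

lemma okr_rot: "okr (\<Gamma> @ [\<rho>]) (\<rho> # \<Gamma>) (rot (length \<Gamma>))"
  by (auto simp: okr_def nth_append)

lemma fren_rot: "wff \<Gamma> A \<Longrightarrow> fren (rot (length \<Gamma>)) A = fshift A"
  unfolding fren_as_fsub by (erule fsub_cong) simp

lemma fren_rot_image: "fren (rot (length (ctx w))) ` hyp w = fshift ` hyp w"
  by (intro image_cong refl fren_rot hyp_wff)

lemma fsub_rot_inst:
  assumes "wff (\<rho> # \<Gamma>) A" shows "fren (rot (length \<Gamma>)) (fsub (inst (Var (length \<Gamma>))) A) = A"
proof -
  have "fren (rot (length \<Gamma>)) (fsub (inst (Var (length \<Gamma>))) A) = fsub Var A"
    unfolding fren_as_fsub fsub_fsub by (rule fsub_cong[OF assms]) (auto simp: less_Suc_eq_0_disj)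
  then show ?thesis by (simp add: fsub_Var)
qed

lemma fresh_world:
  assumes "\<And>A. A \<in> \<Delta> \<Longrightarrow> wff (ctx w @ \<Gamma>) A"
  obtains w' where "w \<sqsubseteq> w'" "ctx w' = ctx w @ \<Gamma>" "hyp w' = \<Delta> \<union> hyp w"
proof
  let ?w = "mkw (ctx w @ \<Gamma>) (\<Delta> \<union> hyp w)"
  have "\<And>A. A \<in> \<Delta> \<union> hyp w \<Longrightarrow> wff (ctx w @ \<Gamma>) A"
    using assms hyp_wff wff_append by auto
  then have s: "ctx ?w = ctx w @ \<Gamma>" "hyp ?w = \<Delta> \<union> hyp w" by (intro mkw_simps; blast)+
  show "w \<sqsubseteq> ?w" by (simp add: wle_def s)
  show "ctx ?w = ctx w @ \<Gamma>" "hyp ?w = \<Delta> \<union> hyp w" by (simp_all add: s)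
qed

text \<open>One use of the premise suffices, at the world with one fresh variable and for that
  variable as \<open>a\<close>; rotating the resulting derivation gives the premise of
  \<open>HA.AllI\<close>. Implication, existential elimination and the inductions below use generic
  worlds in the same way.\<close>

lemma forces_AllI:
  assumes "wff (\<rho> # ctx w) A"
    and "\<And>w' a. w \<sqsubseteq> w' \<Longrightarrow> ty w' a = Some \<rho> \<Longrightarrow> w' \<tturnstile> fsub (inst a) A"
  shows "w \<tturnstile> All \<rho> A"
proof -
  obtain w' where w': "w \<sqsubseteq> w'" "ctx w' = ctx w @ [\<rho>]" "hyp w' = {} \<union> hyp w"
    using fresh_world[of "{}" w "[\<rho>]"] by auto
  have "w' \<tturnstile> fsub (inst (Var (length (ctx w)))) A"
    by (rule assms(2)) (simp_all add: w')
  then have "HA (\<rho> # ctx w) (fshift ` hyp w) (fren (rot (length (ctx w))) (fsub (inst (Var (length (ctx w)))) A))"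
    unfolding forces_def w' by (rule HA_ren) (simp_all add: okr_rot fren_rot_image)
  then show ?thesis
    unfolding forces_def by (simp add: fsub_rot_inst[OF assms(1)] HA.AllI)
qed

lemma forces_AllE: "w \<tturnstile> All \<rho> A \<Longrightarrow> ty w t = Some \<rho> \<Longrightarrow> w \<tturnstile> fsub (inst t) A"
  unfolding forces_def by (rule HA.AllE) (simp_all add: wt_iff)

lemma forces_ImpI:
  assumes "wff (ctx w) A" and "\<And>w'. w \<sqsubseteq> w' \<Longrightarrow> w' \<tturnstile> A \<Longrightarrow> w' \<tturnstile> B"
  shows "w \<tturnstile> Imp A B"
proof -
  obtain w' where w': "w \<sqsubseteq> w'" "ctx w' = ctx w @ []" "hyp w' = {A} \<union> hyp w"
    using fresh_world[of "{A}" w "[]"] assms(1) by auto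
  have "w' \<tturnstile> A" unfolding forces_def using w' assms(1) by (auto intro: HA.Asm)
  with assms(2) w' have "w' \<tturnstile> B" by blast
  then show ?thesis unfolding forces_def using w' assms(1) by (simp add: HA.ImpI)
qed

lemma forces_ImpE: "w \<tturnstile> Imp A B \<Longrightarrow> w \<tturnstile> A \<Longrightarrow> w \<tturnstile> B"
  unfolding forces_def by (rule HA.ImpE)

lemma forces_And: "w \<tturnstile> And A B \<longleftrightarrow> w \<tturnstile> A \<and> w \<tturnstile> B"
  unfolding forces_def by (blast intro: HA.AndI dest: HA.AndE1 HA.AndE2)

lemma forces_ExE:
  assumes "w \<tturnstile> Ex \<rho> A" and "wff (ctx w) C"
    and "\<And>w' a. w \<sqsubseteq> w' \<Longrightarrow> ty w' a = Some \<rho> \<Longrightarrow> w' \<tturnstile> fsub (inst a) A \<Longrightarrow> w' \<tturnstile> C"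
  shows "w \<tturnstile> C"
proof -
  let ?A = "fsub (inst (Var (length (ctx w)))) A"
  have wA: "wff (\<rho> # ctx w) A" using forces_wff[OF assms(1)] by simp
  have "wff (\<rho> # (ctx w @ [\<rho>])) A" using wff_append[OF wA, of "[\<rho>]"] by simp
  then have wA': "wff (ctx w @ [\<rho>]) ?A" by (rule wff_inst) simp
  obtain w' where w': "w \<sqsubseteq> w'" "ctx w' = ctx w @ [\<rho>]" "hyp w' = {?A} \<union> hyp w"
    using fresh_world[of "{?A}" w "[\<rho>]"] wA' by auto
  have "w' \<tturnstile> ?A" unfolding forces_def using w' wA' by (auto intro: HA.Asm)
  then have "w' \<tturnstile> C" by (intro assms(3)[OF w'(1), of "Var (length (ctx w))"]) (simp_all add: w')
  then have "HA (\<rho> # ctx w) (insert A (fshift ` hyp w)) (fren (rot (length (ctx w))) C)"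
    unfolding forces_def w'
    by (rule HA_ren) (simp_all add: okr_rot fren_rot_image fsub_rot_inst[OF wA] subset_insertI)
  then have "HA (\<rho> # ctx w) (insert A (fshift ` hyp w)) (fshift C)"
    by (simp add: fren_rot[OF assms(2)])
  then show ?thesis
    using HA.ExE[OF assms(1)[unfolded forces_def] _ assms(2)] by (simp add: forces_def)
qed

lemma forces_nat_induct:
  assumes "wff (N # ctx w) A" and "w \<tturnstile> fsub (inst Zero) A"
    and "\<And>w' m. w \<sqsubseteq> w' \<Longrightarrow> ty w' m = Some N \<Longrightarrow> w' \<tturnstile> fsub (inst m) A \<Longrightarrow> w' \<tturnstile> fsub (inst (Succ \<cdot> m)) A"
    and "ty w n = Some N"
  shows "w \<tturnstile> fsub (inst n) A"
proof -
  let ?v = "Var (length (ctx w))"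
  let ?A = "fsub (inst ?v) A"
  have "wff (N # (ctx w @ [N])) A" using wff_append[OF assms(1), of "[N]"] by simp
  then have wA': "wff (ctx w @ [N]) ?A" by (rule wff_inst) simp
  obtain w' where w': "w \<sqsubseteq> w'" "ctx w' = ctx w @ [N]" "hyp w' = {?A} \<union> hyp w"
    using fresh_world[of "{?A}" w "[N]"] wA' by auto
  have "w' \<tturnstile> ?A" unfolding forces_def using w' wA' by (auto intro: HA.Asm)
  then have "w' \<tturnstile> fsub (inst (Succ \<cdot> ?v)) A" by (intro assms(3)[OF w'(1)]) (simp_all add: w')
  then have "HA (N # ctx w) (insert A (fshift ` hyp w)) (fren (rot (length (ctx w))) (fsub (inst (Succ \<cdot> ?v)) A))"
    unfolding forces_def w'
    by (rule HA_ren) (simp_all add: okr_rot fren_rot_image fsub_rot_inst[OF assms(1)] subset_insertI)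
  moreover have "fren (rot (length (ctx w))) (fsub (inst (Succ \<cdot> ?v)) A) = fsub (case_nat (Succ \<cdot> Var 0) (\<lambda>i. Var (i + 1))) A"
    unfolding fren_as_fsub fsub_fsub by (rule fsub_cong[OF assms(1)]) (auto simp: less_Suc_eq_0_disj)
  ultimately have "w \<tturnstile> All N A"
    using assms(1,2) unfolding forces_def by (simp add: HA.Ind)
  then show ?thesis using assms(4) by (rule forces_AllE)
qed

lemma forces_seq_induct:
  assumes "wff (Seq \<tau> # ctx w) A" and "w \<tturnstile> fsub (inst (Emp \<tau>)) A"
    and "\<And>w' s x. w \<sqsubseteq> w' \<Longrightarrow> ty w' s = Some (Seq \<tau>) \<Longrightarrow> ty w' x = Some \<tau> \<Longrightarrow> w' \<tturnstile> fsub (inst s) A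
      \<Longrightarrow> w' \<tturnstile> fsub (inst (Snoc \<tau> \<cdot> s \<cdot> x)) A"
    and "ty w n = Some (Seq \<tau>)"
  shows "w \<tturnstile> fsub (inst n) A"
proof -
  let ?n = "length (ctx w)"
  let ?v = "Var ?n" and ?x = "Var (Suc ?n)"
  let ?A = "fsub (inst ?v) A"
  \<comment> \<open>In the generic world the sequence has index \<open>?n\<close> and the appended
    element \<open>?n + 1\<close>; the induction rule wants them at \<open>1\<close> and
    \<open>0\<close>, with everything else shifted by two.\<close>
  let ?r = "\<lambda>i. if i < ?n then i + 2 else if i = ?n then 1 else 0"
  have "wff (Seq \<tau> # (ctx w @ [Seq \<tau>, \<tau>])) A" using wff_append[OF assms(1), of "[Seq \<tau>, \<tau>]"] by simp
  then have wA': "wff (ctx w @ [Seq \<tau>, \<tau>]) ?A" by (rule wff_inst) (simp add: nth_append)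
  obtain w' where w': "w \<sqsubseteq> w'" "ctx w' = ctx w @ [Seq \<tau>, \<tau>]" "hyp w' = {?A} \<union> hyp w"
    using fresh_world[of "{?A}" w "[Seq \<tau>, \<tau>]"] wA' by auto
  have "w' \<tturnstile> ?A" unfolding forces_def using w' wA' by (auto intro: HA.Asm)
  then have "w' \<tturnstile> fsub (inst (Snoc \<tau> \<cdot> ?v \<cdot> ?x)) A"
    by (intro assms(3)[OF w'(1)]) (simp_all add: w' nth_append)
  then have "HA (\<tau> # Seq \<tau> # ctx w) (insert (fshift A) (fren (\<lambda>i. i + 2) ` hyp w)) (fren ?r (fsub (inst (Snoc \<tau> \<cdot> ?v \<cdot> ?x)) A))"
    unfolding forces_def w'
  proof (rule HA_ren)
    show "okr (ctx w @ [Seq \<tau>, \<tau>]) (\<tau> # Seq \<tau> # ctx w) ?r"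
      unfolding okr_def
    proof (intro allI impI)
      fix i assume "i < length (ctx w @ [Seq \<tau>, \<tau>])"
      then consider "i < ?n" | "i = ?n" | "i = Suc ?n" by (simp, linarith)
      then show "?r i < length (\<tau> # Seq \<tau> # ctx w) \<and> (\<tau> # Seq \<tau> # ctx w) ! ?r i = (ctx w @ [Seq \<tau>, \<tau>]) ! i"
        by cases (simp_all add: nth_append)
    qed
    have "fren ?r B = fren (\<lambda>i. i + 2) B" if "B \<in> hyp w" for B
      unfolding fren_as_fsub by (rule fsub_cong[OF hyp_wff[OF that]]) simp
    moreover have "fren ?r ?A = fshift A"
      unfolding fren_as_fsub fsub_fsub by (rule fsub_cong[OF assms(1)]) (auto simp: less_Suc_eq_0_disj)
    ultimately show "fren ?r ` ({?A} \<union> hyp w) \<subseteq> insert (fshift A) (fren (\<lambda>i. i + 2) ` hyp w)"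
      by auto
  qed
  moreover have "fren ?r (fsub (inst (Snoc \<tau> \<cdot> ?v \<cdot> ?x)) A) = fsub (case_nat (Snoc \<tau> \<cdot> Var 1 \<cdot> Var 0) (\<lambda>i. Var (i + 2))) A"
    unfolding fren_as_fsub fsub_fsub by (rule fsub_cong[OF assms(1)]) (auto simp: less_Suc_eq_0_disj)
  ultimately have "HA (ctx w) (hyp w) (All (Seq \<tau>) A)"
    using assms(1,2) unfolding forces_def by (intro HA.Seq_Ind) simp_all
  then have "w \<tturnstile> All (Seq \<tau>) A" by (simp add: forces_def)
  then show ?thesis using assms(4) by (rule forces_AllE)
qed

subsection \<open>Equality\<close>

lemma Eq_ty: "w \<tturnstile> Eq \<rho> t u \<Longrightarrow> ty w t = Some \<rho> \<and> ty w u = Some \<rho>"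
  using forces_wff by fastforce

lemma tyof_ren_eq:
  "(\<And>i. r i < length \<Gamma>' \<longleftrightarrow> i < length \<Gamma>) \<Longrightarrow> (\<And>i. i < length \<Gamma> \<Longrightarrow> \<Gamma>' ! r i = \<Gamma> ! i)
    \<Longrightarrow> tyof \<Gamma>' (ren r t) = tyof \<Gamma> t"
proof (induction t arbitrary: r \<Gamma> \<Gamma>')
  case (App t u)
  show ?case using App.IH(1)[OF App.prems] App.IH(2)[OF App.prems] by simp
next
  case (Lam \<kappa> t)
  have "tyof (\<kappa> # \<Gamma>') (ren (upr r) t) = tyof (\<kappa> # \<Gamma>) t"
    by (rule Lam.IH) (auto simp: less_Suc_eq_0_disj Lam.prems split: nat.splits)
  then show ?case by simp
qed simp_all

lemma tyof_shift [simp]: "tyof (\<rho> # \<Gamma>) (shift t) = tyof \<Gamma> t"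
  by (rule tyof_ren_eq) simp_all

lemma Eq_refl: "ty w t = Some \<rho> \<Longrightarrow> w \<tturnstile> Eq \<rho> t t"
  by (simp add: forces_def HA.Refl wt_iff)

lemma Eq_Subst: "w \<tturnstile> Eq \<rho> t u \<Longrightarrow> wff (\<rho> # ctx w) A \<Longrightarrow> w \<tturnstile> fsub (inst t) A \<Longrightarrow> w \<tturnstile> fsub (inst u) A"
  unfolding forces_def by (rule HA.Subst)

lemma Eq_sym: assumes "w \<tturnstile> Eq \<rho> t u" shows "w \<tturnstile> Eq \<rho> u t"
  using Eq_Subst[OF assms, of "Eq \<rho> (Var 0) (shift t)"] Eq_ty[OF assms] by (simp add: Eq_refl)

lemma Eq_trans: assumes "w \<tturnstile> Eq \<rho> t u" "w \<tturnstile> Eq \<rho>' u v" shows "w \<tturnstile> Eq \<rho> t v"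
proof -
  have "\<rho>' = \<rho>" using Eq_ty[OF assms(1)] Eq_ty[OF assms(2)] by simp
  then show ?thesis
    using Eq_Subst[OF assms(2), of "Eq \<rho> (shift t) (Var 0)"] Eq_ty[OF assms(1)] assms by simp
qed

lemma Eq_App: assumes "w \<tturnstile> Eq (\<rho> \<rightarrow> \<eta>) f g" "w \<tturnstile> Eq \<rho> t u" shows "w \<tturnstile> Eq \<eta> (f \<cdot> t) (g \<cdot> u)"
proof -
  have "w \<tturnstile> Eq \<eta> (f \<cdot> t) (f \<cdot> u)"
    using Eq_Subst[OF assms(2), of "Eq \<eta> (shift (f \<cdot> t)) (shift f \<cdot> Var 0)"] Eq_ty[OF assms(1)] Eq_ty[OF assms(2)]
    by (simp add: Eq_refl)
  moreover have "w \<tturnstile> Eq \<eta> (f \<cdot> u) (g \<cdot> u)"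
    using Eq_Subst[OF assms(1), of "Eq \<eta> (shift (f \<cdot> u)) (Var 0 \<cdot> shift u)"] Eq_ty[OF assms(1)] Eq_ty[OF assms(2)]
    by (simp add: Eq_refl)
  ultimately show ?thesis by (rule Eq_trans)
qed

text \<open>
  The value of a term in a world is its class modulo provable equality, so that Isabelle's
  simplifier can rewrite modulo provable equality. Ill-typed terms have the value \<open>{}\<close>.
\<close>

definition den :: "world \<Rightarrow> trm \<Rightarrow> trm set" where
  "den w t = {u. \<exists>\<rho>. w \<tturnstile> Eq \<rho> t u}"

text \<open>Ranging over all representatives avoids a choice; provably equal ones contribute the
  same terms.\<close>

definition app :: "world \<Rightarrow> trm set \<Rightarrow> trm set \<Rightarrow> trm set" where
  "app w X Y = {v. \<exists>f a \<rho>. X = den w f \<and> Y = den w a \<and> w \<tturnstile> Eq \<rho> (f \<cdot> a) v}"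

text \<open>The chosen representative does not matter: terms of equal value have the same type, or
  none at all (\<open>den_ty\<close>).\<close>

definition tyv :: "world \<Rightarrow> trm set \<Rightarrow> ty option" where
  "tyv w X = (if \<exists>t. X = den w t then ty w (SOME t. X = den w t) else None)"

lemma den_eqD: "den w t = den w u \<Longrightarrow> ty w t = Some \<rho> \<Longrightarrow> w \<tturnstile> Eq \<rho> t u"
proof -
  assume e: "den w t = den w u" and t: "ty w t = Some \<rho>"
  have "t \<in> den w t" unfolding den_def using Eq_refl[OF t] by blast
  with e have "t \<in> den w u" by simp
  then obtain \<eta> where *: "w \<tturnstile> Eq \<eta> u t" by (auto simp: den_def)
  then have "\<eta> = \<rho>" using Eq_ty[OF *] t by simp
  with * show ?thesis using Eq_sym by blast
qed

lemma den_eqI: "w \<tturnstile> Eq \<rho> t u \<Longrightarrow> den w t = den w u"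
  unfolding den_def using Eq_sym Eq_trans by blast

lemma den_empty: "den w t = {} \<longleftrightarrow> ty w t = None"
proof
  assume "den w t = {}"
  then show "ty w t = None" using Eq_refl[of w t] unfolding den_def by (metis Collect_empty_eq not_None_eq)
next
  assume "ty w t = None"
  then show "den w t = {}" using Eq_ty by (fastforce simp: den_def)
qed

lemma den_ty: "den w t = den w u \<Longrightarrow> ty w t = ty w u"
proof (cases "ty w t")
  case None
  assume "den w t = den w u"
  then show ?thesis using None den_empty by metis
next
  case (Some \<rho>)
  assume "den w t = den w u"
  then show ?thesis using den_eqD[OF _ Some] Eq_ty Some by fastforce
qed

lemma tyv_den [simp]: "tyv w (den w t) = ty w t"
proof -
  have "den w t = den w (SOME u. den w t = den w u)" by (rule someI[of _ t]) simp
  then show ?thesis using den_ty unfolding tyv_def by metis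
qed

text \<open>For an ill-typed application both sides are empty. So this is an unconditional rewrite
  rule, which pushes \<open>den\<close> down to the atoms of a term.\<close>

lemma den_App [simp]: "den w (t \<cdot> u) = app w (den w t) (den w u)"
proof (rule set_eqI, rule iffI)
  fix v assume "v \<in> den w (t \<cdot> u)" then show "v \<in> app w (den w t) (den w u)"
    by (auto simp: den_def app_def)
next
  fix v assume "v \<in> app w (den w t) (den w u)"
  then obtain f a \<rho> where e: "den w t = den w f" "den w u = den w a" "w \<tturnstile> Eq \<rho> (f \<cdot> a) v"
    by (auto simp: app_def)
  then obtain \<kappa> where k: "ty w f = Some (\<kappa> \<rightarrow> \<rho>)" "ty w a = Some \<kappa>"
    using Eq_ty[OF e(3)] by (auto simp: appt_Some)
  have "w \<tturnstile> Eq (\<kappa> \<rightarrow> \<rho>) t f" "w \<tturnstile> Eq \<kappa> u a"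
    using den_eqD[OF e(1)[symmetric] k(1)] den_eqD[OF e(2)[symmetric] k(2)] Eq_sym by blast+
  then have "w \<tturnstile> Eq \<rho> (t \<cdot> u) v" using Eq_App Eq_trans e(3) by blast
  then show "v \<in> den w (t \<cdot> u)" by (auto simp: den_def)
qed

lemma tyv_app [simp]: "tyv w (app w X Y) = appt (tyv w X) (tyv w Y)"
proof (cases "(\<exists>f. X = den w f) \<and> (\<exists>a. Y = den w a)")
  case True
  then obtain f a where "X = den w f" "Y = den w a" by blast
  then show ?thesis by (simp flip: den_App)
next
  case False
  then have "app w X Y = {}" "tyv w X = None \<or> tyv w Y = None" by (auto simp: app_def tyv_def)
  \<comment> \<open>An ill-typed term represents the empty set, so its type, \<open>None\<close>, is
    the type of the empty value.\<close>
  moreover have "den w (Zero \<cdot> Zero) = {}" by (simp add: den_empty del: den_App)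
  ultimately have "tyv w (app w X Y) = ty w (Zero \<cdot> Zero)" by (metis tyv_den)
  then show ?thesis using \<open>tyv w X = None \<or> tyv w Y = None\<close> by auto
qed

lemma tyvE:
  assumes "tyv w X = Some \<rho>" obtains a where "X = den w a" "ty w a = Some \<rho>"
proof -
  obtain t where "X = den w t" using assms by (auto simp: tyv_def split: if_splits)
  then show ?thesis using that assms by simp
qed

text \<open>The typing hypothesis matters: terms that are ill-typed at \<open>w\<close> share the
  value \<open>{}\<close>, but a longer context may give them types and different values.\<close>

lemma den_mono: "w \<sqsubseteq> w' \<Longrightarrow> den w t = den w u \<Longrightarrow> ty w t = Some \<rho> \<Longrightarrow> den w' t = den w' u"
  using den_eqD den_eqI forces_mono by blast

lemma den_ext:
  assumes "ty w f = Some (\<rho> \<rightarrow> \<eta>)" "ty w g = Some (\<rho> \<rightarrow> \<eta>)"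
    and "\<And>w' a. w \<sqsubseteq> w' \<Longrightarrow> ty w' a = Some \<rho> \<Longrightarrow> den w' (f \<cdot> a) = den w' (g \<cdot> a)"
  shows "den w f = den w g"
proof -
  have "w \<tturnstile> All \<rho> (Eq \<eta> (shift f \<cdot> Var 0) (shift g \<cdot> Var 0))"
  proof (rule forces_AllI)
    fix w' a assume a: "w \<sqsubseteq> w'" "ty w' a = Some \<rho>"
    then have "ty w' (f \<cdot> a) = Some \<eta>" using assms ty_mono by fastforce
    then have "w' \<tturnstile> Eq \<eta> (f \<cdot> a) (g \<cdot> a)" using den_eqD[OF assms(3)[OF a]] by blast
    then show "w' \<tturnstile> fsub (inst a) (Eq \<eta> (shift f \<cdot> Var 0) (shift g \<cdot> Var 0))" by simp
  qed (use assms in simp)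
  then have "w \<tturnstile> Eq (\<rho> \<rightarrow> \<eta>) f g"
    using assms unfolding forces_def by (intro HA.Ext) (simp_all add: wt_iff)
  then show ?thesis by (rule den_eqI)
qed

text \<open>Case distinction is extracted from induction on \<open>k\<close> for the formula
  \<open>n = k\<close> implies \<open>C\<close>; its instance at \<open>n\<close> itself is
  discharged by reflexivity.\<close>

lemma den_cases:
  assumes "ty w n = Some N" and "wff (ctx w) C"
    and "\<And>w'. w \<sqsubseteq> w' \<Longrightarrow> den w' n = den w' Zero \<Longrightarrow> w' \<tturnstile> C"
    and "\<And>w' m. w \<sqsubseteq> w' \<Longrightarrow> ty w' m = Some N \<Longrightarrow> den w' n = den w' (Succ \<cdot> m) \<Longrightarrow> w' \<tturnstile> C"
  shows "w \<tturnstile> C"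
proof -
  let ?A = "Imp (Eq N (shift n) (Var 0)) (fshift C)"
  have sh: "wff (\<rho> # \<Gamma>) (fshift C)" if "wff \<Gamma> C" for \<rho> \<Gamma>
    using that by (rule wff_ren) auto
  have "w \<tturnstile> fsub (inst n) ?A"
  proof (rule forces_nat_induct)
    show "w \<tturnstile> fsub (inst Zero) ?A"
      using assms by (auto intro!: forces_ImpI dest: den_eqI)
  next
    fix w' m assume m: "w \<sqsubseteq> w'" "ty w' m = Some N"
    note mm = ty_mono[OF m(1)] wff_mono[OF m(1)]
    show "w' \<tturnstile> fsub (inst (Succ \<cdot> m)) ?A"
    proof (simp, rule forces_ImpI)
      fix w'' assume w'': "w' \<sqsubseteq> w''" "w'' \<tturnstile> Eq N n (Succ \<cdot> m)"
      show "w'' \<tturnstile> C"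
        by (rule assms(4)[OF wle_trans[OF m(1) w''(1)] ty_mono[OF w''(1) m(2)] den_eqI[OF w''(2)]])
    qed (use mm assms m in simp)
  qed (use assms sh in auto)
  then have "w \<tturnstile> Imp (Eq N n n) C" by simp
  then show ?thesis using Eq_refl[OF assms(1)] by (rule forces_ImpE)
qed

lemma den_eq_cases:
  assumes "ty w n = Some N" and "ty w t = Some \<rho>" "ty w u = Some \<rho>"
    and "\<And>w'. w \<sqsubseteq> w' \<Longrightarrow> den w' n = den w' Zero \<Longrightarrow> den w' t = den w' u"
    and "\<And>w' m. w \<sqsubseteq> w' \<Longrightarrow> ty w' m = Some N \<Longrightarrow> den w' n = den w' (Succ \<cdot> m) \<Longrightarrow> den w' t = den w' u"
  shows "den w t = den w u"
proof (rule den_eqI)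
  show "w \<tturnstile> Eq \<rho> t u"
    by (rule den_cases[OF assms(1)]) (use assms(2,3) in \<open>simp; fail | metis assms(4,5) den_eqD ty_mono\<close>)+
qed

text \<open>Equations proved with this rule spell out both sides as \<open>sub (inst n) _\<close>,
  because the induction formula is a syntactic object whose \<open>Var 0\<close> is the induction
  variable.\<close>

lemma den_nat_induct:
  assumes "tyof (N # ctx w) t = Some \<rho>" "tyof (N # ctx w) u = Some \<rho>"
    and "den w (sub (inst Zero) t) = den w (sub (inst Zero) u)"
    and "\<And>w' m. w \<sqsubseteq> w' \<Longrightarrow> ty w' m = Some N \<Longrightarrow> den w' (sub (inst m) t) = den w' (sub (inst m) u)
      \<Longrightarrow> den w' (sub (inst (Succ \<cdot> m)) t) = den w' (sub (inst (Succ \<cdot> m)) u)"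
    and "ty w n = Some N"
  shows "den w (sub (inst n) t) = den w (sub (inst n) u)"
proof -
  have "w \<tturnstile> fsub (inst n) (Eq \<rho> t u)"
  proof (rule forces_nat_induct)
    show "w \<tturnstile> fsub (inst Zero) (Eq \<rho> t u)"
      using assms(1,3) by (simp add: den_eqD tyof_inst)
  next
    fix w' m assume *: "w \<sqsubseteq> w'" "ty w' m = Some N" "w' \<tturnstile> fsub (inst m) (Eq \<rho> t u)"
    obtain \<Gamma> where "ctx w' = ctx w @ \<Gamma>" using *(1) by (auto simp: wle_def)
    then have "tyof (N # ctx w') t = Some \<rho>" using tyof_append[OF assms(1)] by simp
    then have "ty w' (sub (inst (Succ \<cdot> m)) t) = Some \<rho>" using *(2) by (simp add: tyof_inst)
    moreover have "den w' (sub (inst m) t) = den w' (sub (inst m) u)"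
      by (rule den_eqI) (use *(3) in simp)
    ultimately show "w' \<tturnstile> fsub (inst (Succ \<cdot> m)) (Eq \<rho> t u)" using assms(4)[OF *(1,2)] by (simp add: den_eqD)
  qed (use assms in simp_all)
  then show ?thesis by (simp add: den_eqI)
qed

lemma den_seq_induct:
  assumes "tyof (Seq \<kappa> # ctx w) t = Some \<rho>" "tyof (Seq \<kappa> # ctx w) u = Some \<rho>"
    and "den w (sub (inst (Emp \<kappa>)) t) = den w (sub (inst (Emp \<kappa>)) u)"
    and "\<And>w' s x. w \<sqsubseteq> w' \<Longrightarrow> ty w' s = Some (Seq \<kappa>) \<Longrightarrow> ty w' x = Some \<kappa> \<Longrightarrow> den w' (sub (inst s) t) = den w' (sub (inst s) u)
      \<Longrightarrow> den w' (sub (inst (Snoc \<kappa> \<cdot> s \<cdot> x)) t) = den w' (sub (inst (Snoc \<kappa> \<cdot> s \<cdot> x)) u)"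
    and "ty w n = Some (Seq \<kappa>)"
  shows "den w (sub (inst n) t) = den w (sub (inst n) u)"
proof -
  have "w \<tturnstile> fsub (inst n) (Eq \<rho> t u)"
  proof (rule forces_seq_induct)
    show "w \<tturnstile> fsub (inst (Emp \<kappa>)) (Eq \<rho> t u)"
      using assms(1,3) by (simp add: den_eqD tyof_inst)
  next
    fix w' s x assume *: "w \<sqsubseteq> w'" "ty w' s = Some (Seq \<kappa>)" "ty w' x = Some \<kappa>" "w' \<tturnstile> fsub (inst s) (Eq \<rho> t u)"
    obtain \<Gamma> where "ctx w' = ctx w @ \<Gamma>" using *(1) by (auto simp: wle_def)
    then have "tyof (Seq \<kappa> # ctx w') t = Some \<rho>" using tyof_append[OF assms(1)] by simp
    then have "ty w' (sub (inst (Snoc \<kappa> \<cdot> s \<cdot> x)) t) = Some \<rho>" using *(2,3) by (simp add: tyof_inst)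
    moreover have "den w' (sub (inst s) t) = den w' (sub (inst s) u)"
      by (rule den_eqI) (use *(4) in simp)
    ultimately show "w' \<tturnstile> fsub (inst (Snoc \<kappa> \<cdot> s \<cdot> x)) (Eq \<rho> t u)" using assms(4)[OF *(1-3)] by (simp add: den_eqD)
  qed (use assms in simp_all)
  then show ?thesis by (simp add: den_eqI)
qed

subsection \<open>Computation rules\<close>

lemma den_Beta: "tyof (\<rho> # ctx w) t = Some \<eta> \<Longrightarrow> ty w u = Some \<rho> \<Longrightarrow> den w (Lam \<rho> t \<cdot> u) = den w (sub (inst u) t)"
  by (rule den_eqI[of _ \<eta>]) (simp add: forces_def HA.Beta wt_iff)

text \<open>Stated for arbitrary values of the right types, not for terms: once
  \<open>den_App\<close> has been applied, the arguments are no longer syntactic.\<close>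

lemma app_Rec_Zero [simp]:
  "tyv w a = Some \<rho> \<Longrightarrow> tyv w f = Some (N \<rightarrow> \<rho> \<rightarrow> \<rho>) \<Longrightarrow> app w (app w (app w (den w (Rec \<rho>)) a) f) (den w Zero) = a"
  by (erule tyvE, erule tyvE, simp flip: den_App, rule den_eqI[where \<rho> = \<rho>]) (simp add: forces_def HA.Rec_Zero wt_iff)

lemma app_Rec_Succ [simp]:
  "tyv w a = Some \<rho> \<Longrightarrow> tyv w f = Some (N \<rightarrow> \<rho> \<rightarrow> \<rho>) \<Longrightarrow> tyv w m = Some N \<Longrightarrow>
    app w (app w (app w (den w (Rec \<rho>)) a) f) (app w (den w Succ) m)
      = app w (app w f m) (app w (app w (app w (den w (Rec \<rho>)) a) f) m)"
  by (erule tyvE, erule tyvE, erule tyvE, simp flip: den_App, rule den_eqI[where \<rho> = \<rho>])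
    (simp add: forces_def HA.Rec_Succ wt_iff)

lemma app_SRec_Emp [simp]:
  "tyv w a = Some \<rho> \<Longrightarrow> tyv w f = Some (Seq \<tau> \<rightarrow> \<tau> \<rightarrow> \<rho> \<rightarrow> \<rho>) \<Longrightarrow>
    app w (app w (app w (den w (SRec \<tau> \<rho>)) a) f) (den w (Emp \<tau>)) = a"
  by (erule tyvE, erule tyvE, simp flip: den_App, rule den_eqI[where \<rho> = \<rho>]) (simp add: forces_def HA.SRec_Emp wt_iff)

lemma app_SRec_Snoc [simp]:
  "tyv w a = Some \<rho> \<Longrightarrow> tyv w f = Some (Seq \<tau> \<rightarrow> \<tau> \<rightarrow> \<rho> \<rightarrow> \<rho>) \<Longrightarrow> tyv w s = Some (Seq \<tau>) \<Longrightarrow> tyv w x = Some \<tau> \<Longrightarrow>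
    app w (app w (app w (den w (SRec \<tau> \<rho>)) a) f) (app w (app w (den w (Snoc \<tau>)) s) x)
      = app w (app w (app w f s) x) (app w (app w (app w (den w (SRec \<tau> \<rho>)) a) f) s)"
  by (erule tyvE, erule tyvE, erule tyvE, erule tyvE, simp flip: den_App, rule den_eqI[where \<rho> = \<rho>])
    (simp add: forces_def HA.SRec_Snoc wt_iff)

lemma app_Fst_Pair [simp]:
  "tyv w x = Some \<rho> \<Longrightarrow> tyv w y = Some \<eta> \<Longrightarrow> app w (den w (Fst \<rho> \<eta>)) (app w (app w (den w (Pair \<rho> \<eta>)) x) y) = x"
  by (erule tyvE, erule tyvE, simp flip: den_App, rule den_eqI[where \<rho> = \<rho>]) (simp add: forces_def HA.Fst_Pair wt_iff)

lemma app_Snd_Pair [simp]: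
  "tyv w x = Some \<rho> \<Longrightarrow> tyv w y = Some \<eta> \<Longrightarrow> app w (den w (Snd \<rho> \<eta>)) (app w (app w (den w (Pair \<rho> \<eta>)) x) y) = y"
  by (erule tyvE, erule tyvE, simp flip: den_App, rule den_eqI[where \<rho> = \<eta>]) (simp add: forces_def HA.Snd_Pair wt_iff)

lemma app_Pair_Fst_Snd [simp]:
  "tyv w p = Some (\<rho> \<otimes> \<eta>) \<Longrightarrow>
    app w (app w (den w (Pair \<rho> \<eta>)) (app w (den w (Fst \<rho> \<eta>)) p)) (app w (den w (Snd \<rho> \<eta>)) p) = p"
  by (erule tyvE, simp flip: den_App, rule den_eqI[where \<rho> = "\<rho> \<otimes> \<eta>"]) (simp add: forces_def HA.Pair_Surj wt_iff)

text \<open>The value of the body of an abstraction when the bound variables have the values in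
  \<open>e\<close>. Substitution needs terms, hence the chosen representatives;
  \<open>ev_Var\<close> removes the choice again.\<close>

definition ev :: "world \<Rightarrow> trm set list \<Rightarrow> trm \<Rightarrow> trm set" where
  "ev w e t = den w (sub (\<lambda>i. if i < length e then SOME a. e ! i = den w a else Var i) t)"

lemma ev_Var [simp]: "i < length e \<Longrightarrow> tyv w (e ! i) \<noteq> None \<Longrightarrow> ev w e (Var i) = e ! i"
proof -
  assume i: "i < length e" "tyv w (e ! i) \<noteq> None"
  then obtain a where "e ! i = den w a" by (metis not_None_eq tyvE)
  then have "e ! i = den w (SOME a. e ! i = den w a)" by (rule someI[of _ a])
  then show ?thesis using i by (simp add: ev_def)
qed

lemma ev_App [simp]: "ev w e (t \<cdot> u) = app w (ev w e t) (ev w e u)"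
  by (simp add: ev_def)

lemma ev_const [simp]:
  "ev w e Zero = den w Zero" "ev w e Succ = den w Succ" "ev w e (Rec \<rho>) = den w (Rec \<rho>)"
  "ev w e (Emp \<tau>) = den w (Emp \<tau>)" "ev w e (Snoc \<tau>) = den w (Snoc \<tau>)" "ev w e (SRec \<tau> \<rho>) = den w (SRec \<tau> \<rho>)"
  "ev w e (Pair \<tau> \<rho>) = den w (Pair \<tau> \<rho>)" "ev w e (Fst \<tau> \<rho>) = den w (Fst \<tau> \<rho>)" "ev w e (Snd \<tau> \<rho>) = den w (Snd \<tau> \<rho>)"
  by (simp_all add: ev_def)

lemma ev_closed: "tyof [] c = Some \<rho> \<Longrightarrow> ev w e c = den w c"
  by (simp add: ev_def sub_closed)

text \<open>Instantiated with the type of a closed constant, these give its type in every context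
  and let substitutions, renamings and environments pass it by.\<close>

lemmas closed = tyof_closed sub_closed ren_closed ev_closed

lemma den_foldl: "den w t = den w u \<Longrightarrow> den w (foldl App t as) = den w (foldl App u as)"
  by (induction as arbitrary: t u) simp_all

text \<open>Several beta steps at once. The statement carries a substitution \<theta> for the outer
  variables, to which the induction adds one argument after the other.\<close>

lemma den_lams_aux:
  "tyof (rev \<rho>s @ \<Gamma>) b = Some \<eta> \<Longrightarrow> (\<And>i. i < length \<Gamma> \<Longrightarrow> ty w (\<theta> i) = Some (\<Gamma> ! i))
    \<Longrightarrow> list_all2 (\<lambda>a \<rho>. ty w a = Some \<rho>) as \<rho>s
    \<Longrightarrow> den w (foldl App (sub \<theta> (foldr Lam \<rho>s b)) as)
      = den w (sub (\<lambda>i. if i < length as then rev as ! i else \<theta> (i - length as)) b)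
     \<and> tyof \<Gamma> (foldr Lam \<rho>s b) = Some (foldr Fun \<rho>s \<eta>)"
proof (induction \<rho>s arbitrary: \<Gamma> \<theta> as)
  case Nil
  then show ?case by simp
next
  case (Cons \<rho> \<rho>s)
  then obtain a as' where as: "as = a # as'" "ty w a = Some \<rho>" "list_all2 (\<lambda>a \<rho>. ty w a = Some \<rho>) as' \<rho>s"
    by (auto simp: list_all2_Cons2)
  let ?b = "foldr Lam \<rho>s b"
  let ?\<theta> = "case_nat a \<theta>"
  have ok: "\<And>i. i < length (\<rho> # \<Gamma>) \<Longrightarrow> ty w (?\<theta> i) = Some ((\<rho> # \<Gamma>) ! i)"
    using Cons.prems(2) as(2) by (auto simp: less_Suc_eq_0_disj)
  have IH: "den w (foldl App (sub ?\<theta> ?b) as')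
      = den w (sub (\<lambda>i. if i < length as' then rev as' ! i else ?\<theta> (i - length as')) b)
     \<and> tyof (\<rho> # \<Gamma>) ?b = Some (foldr Fun \<rho>s \<eta>)"
    by (rule Cons.IH[OF _ ok as(3)]) (use Cons.prems in simp)
  have up: "\<And>i. i < length (\<rho> # \<Gamma>) \<Longrightarrow> tyof (\<rho> # ctx w) (up \<theta> i) = Some ((\<rho> # \<Gamma>) ! i)"
    using Cons.prems(2) by (auto simp: less_Suc_eq_0_disj)
  have "den w (Lam \<rho> (sub (up \<theta>) ?b) \<cdot> a) = den w (sub (inst a) (sub (up \<theta>) ?b))"
    by (rule den_Beta[OF tyof_sub[OF up] as(2)]) (use IH in blast)+
  also have "sub (inst a) (sub (up \<theta>) ?b) = sub ?\<theta> ?b"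
    unfolding sub_sub by (rule arg_cong2[of _ _ _ _ sub]) (auto simp: up_def split: nat.splits)
  finally have "den w (Lam \<rho> (sub (up \<theta>) ?b) \<cdot> a) = den w (sub ?\<theta> ?b)" .
  then have "den w (foldl App (Lam \<rho> (sub (up \<theta>) ?b) \<cdot> a) as') = den w (foldl App (sub ?\<theta> ?b) as')"
    by (rule den_foldl)
  then have "den w (foldl App (sub \<theta> (foldr Lam (\<rho> # \<rho>s) b)) as) = den w (foldl App (sub ?\<theta> ?b) as')"
    using as(1) by (simp del: den_App)
  moreover have "(\<lambda>i. if i < length as' then rev as' ! i else ?\<theta> (i - length as'))
    = (\<lambda>i. if i < length as then rev as ! i else \<theta> (i - length as))"
  proof
    fix i
    consider "i < length as'" | "i = length as'" | j where "i = Suc (length as' + j)"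
      by (metis less_iff_Suc_add nat_neq_iff)
    then show "(if i < length as' then rev as' ! i else ?\<theta> (i - length as'))
      = (if i < length as then rev as ! i else \<theta> (i - length as))"
      by cases (simp_all add: as(1) nth_append)
  qed
  ultimately show ?case using IH by simp
qed

text \<open>The environment is \<open>rev xs\<close> because the last argument is bound innermost,
  as \<open>Var 0\<close>.\<close>

lemma app_lams:
  assumes "tyof (rev \<rho>s) b \<noteq> None" "list_all2 (\<lambda>x \<rho>. tyv w x = Some \<rho>) xs \<rho>s"
  shows "foldl (app w) (den w (foldr Lam \<rho>s b)) xs = ev w (rev xs) b"
proof -
  from assms(1) obtain \<eta> where \<eta>: "tyof (rev \<rho>s @ []) b = Some \<eta>" by auto
  let ?f = "\<lambda>x. SOME a. x = den w a"
  let ?as = "map ?f xs"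
  have f: "x = den w (?f x) \<and> ty w (?f x) = Some \<rho>" if xty: "tyv w x = Some \<rho>" for x \<rho>
  proof -
    obtain a where "x = den w a" using tyvE[OF xty] by blast
    then have "x = den w (?f x)" by (rule someI)
    then show ?thesis using xty tyv_den by metis
  qed
  have as: "list_all2 (\<lambda>a \<rho>. ty w a = Some \<rho>) ?as \<rho>s"
    unfolding list_all2_map1 by (rule list_all2_mono[OF assms(2)]) (use f in blast)
  have "foldl (app w) (den w t) xs = den w (foldl App t ?as)" for t
    using assms(2)
  proof (induction xs arbitrary: t \<rho>s)
    case (Cons x xs)
    then obtain \<rho> \<rho>s' where "tyv w x = Some \<rho>" and l: "list_all2 (\<lambda>x \<rho>. tyv w x = Some \<rho>) xs \<rho>s'"
      by (auto simp: list_all2_Cons1)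
    then have "app w (den w t) x = den w (t \<cdot> ?f x)" unfolding den_App using f by metis
    then show ?case using Cons.IH[OF l, of "t \<cdot> ?f x"] by (simp del: den_App)
  qed simp
  then have "foldl (app w) (den w (foldr Lam \<rho>s b)) xs = den w (foldl App (sub Var (foldr Lam \<rho>s b)) ?as)"
    by (simp add: sub_Var)
  also have "\<dots> = den w (sub (\<lambda>i. if i < length ?as then rev ?as ! i else Var (i - length ?as)) b)"
    using den_lams_aux[OF \<eta> _ as, of Var] by simp
  also have "sub (\<lambda>i. if i < length ?as then rev ?as ! i else Var (i - length ?as)) b
    = sub (\<lambda>i. if i < length (rev xs) then ?f (rev xs ! i) else Var i) b"
    using list_all2_lengthD[OF assms(2)] by (intro sub_cong[OF \<eta>]) (auto simp: rev_map)
  finally show ?thesis by (simp add: ev_def)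
qed

text \<open>The definition is a premise, so that \<open>app_lam1[OF c_def]\<close> rewrites
  applications of the folded constant \<open>c\<close>.\<close>

lemma app_lam1:
  "c = Lam \<rho>1 b \<Longrightarrow> tyof [\<rho>1] b \<noteq> None \<Longrightarrow> tyv w x1 = Some \<rho>1 \<Longrightarrow> app w (den w c) x1 = ev w [x1] b"
  using app_lams[of "[\<rho>1]" b w "[x1]"] by simp

lemma app_lam2:
  "c = Lam \<rho>1 (Lam \<rho>2 b) \<Longrightarrow> tyof [\<rho>2, \<rho>1] b \<noteq> None \<Longrightarrow> tyv w x1 = Some \<rho>1 \<Longrightarrow> tyv w x2 = Some \<rho>2 \<Longrightarrow>
    app w (app w (den w c) x1) x2 = ev w [x2, x1] b"
  using app_lams[of "[\<rho>1, \<rho>2]" b w "[x1, x2]"] by simp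

lemma app_lam3:
  "c = Lam \<rho>1 (Lam \<rho>2 (Lam \<rho>3 b)) \<Longrightarrow> tyof [\<rho>3, \<rho>2, \<rho>1] b \<noteq> None \<Longrightarrow> tyv w x1 = Some \<rho>1 \<Longrightarrow> tyv w x2 = Some \<rho>2 \<Longrightarrow> tyv w x3 = Some \<rho>3 \<Longrightarrow>
    app w (app w (app w (den w c) x1) x2) x3 = ev w [x3, x2, x1] b"
  using app_lams[of "[\<rho>1, \<rho>2, \<rho>3]" b w "[x1, x2, x3]"] by simp

lemma app_lam4:
  "c = Lam \<rho>1 (Lam \<rho>2 (Lam \<rho>3 (Lam \<rho>4 b))) \<Longrightarrow> tyof [\<rho>4, \<rho>3, \<rho>2, \<rho>1] b \<noteq> None \<Longrightarrow> tyv w x1 = Some \<rho>1 \<Longrightarrow> tyv w x2 = Some \<rho>2 \<Longrightarrow> tyv w x3 = Some \<rho>3 \<Longrightarrow>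
    tyv w x4 = Some \<rho>4 \<Longrightarrow>
    app w (app w (app w (app w (den w c) x1) x2) x3) x4 = ev w [x4, x3, x2, x1] b"
  using app_lams[of "[\<rho>1, \<rho>2, \<rho>3, \<rho>4]" b w "[x1, x2, x3, x4]"] by simp

lemma app_lam5:
  "c = Lam \<rho>1 (Lam \<rho>2 (Lam \<rho>3 (Lam \<rho>4 (Lam \<rho>5 b)))) \<Longrightarrow> tyof [\<rho>5, \<rho>4, \<rho>3, \<rho>2, \<rho>1] b \<noteq> None \<Longrightarrow> tyv w x1 = Some \<rho>1 \<Longrightarrow> tyv w x2 = Some \<rho>2 \<Longrightarrow> tyv w x3 = Some \<rho>3 \<Longrightarrow>
    tyv w x4 = Some \<rho>4 \<Longrightarrow> tyv w x5 = Some \<rho>5 \<Longrightarrow>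
    app w (app w (app w (app w (app w (den w c) x1) x2) x3) x4) x5
      = ev w [x5, x4, x3, x2, x1] b"
  using app_lams[of "[\<rho>1, \<rho>2, \<rho>3, \<rho>4, \<rho>5]" b w "[x1, x2, x3, x4, x5]"] by simp

lemma den_ext2:
  assumes "ty w f = Some (\<rho>1 \<rightarrow> \<rho>2 \<rightarrow> \<eta>)" "ty w g = Some (\<rho>1 \<rightarrow> \<rho>2 \<rightarrow> \<eta>)"
    and "\<And>w' a b. w \<sqsubseteq> w' \<Longrightarrow> ty w' a = Some \<rho>1 \<Longrightarrow> ty w' b = Some \<rho>2 \<Longrightarrow> den w' (f \<cdot> a \<cdot> b) = den w' (g \<cdot> a \<cdot> b)"
  shows "den w f = den w g"
proof (rule den_ext[OF assms(1,2)])
  fix w' a assume a: "w \<sqsubseteq> w'" "ty w' a = Some \<rho>1"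
  show "den w' (f \<cdot> a) = den w' (g \<cdot> a)"
  proof (rule den_ext)
    fix w'' b assume b: "w' \<sqsubseteq> w''" "ty w'' b = Some \<rho>2"
    show "den w'' (f \<cdot> a \<cdot> b) = den w'' (g \<cdot> a \<cdot> b)"
      by (rule assms(3)[OF wle_trans[OF a(1) b(1)] ty_mono[OF b(1) a(2)] b(2)])
  qed (use ty_mono[OF a(1)] assms a in simp_all)
qed

lemma den_ext3:
  assumes "ty w f = Some (\<rho>1 \<rightarrow> \<rho>2 \<rightarrow> \<rho>3 \<rightarrow> \<eta>)" "ty w g = Some (\<rho>1 \<rightarrow> \<rho>2 \<rightarrow> \<rho>3 \<rightarrow> \<eta>)"
    and "\<And>w' a b c. w \<sqsubseteq> w' \<Longrightarrow> ty w' a = Some \<rho>1 \<Longrightarrow> ty w' b = Some \<rho>2 \<Longrightarrow> ty w' c = Some \<rho>3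
      \<Longrightarrow> den w' (f \<cdot> a \<cdot> b \<cdot> c) = den w' (g \<cdot> a \<cdot> b \<cdot> c)"
  shows "den w f = den w g"
proof (rule den_ext2[OF assms(1,2)])
  fix w' a b assume a: "w \<sqsubseteq> w'" "ty w' a = Some \<rho>1" "ty w' b = Some \<rho>2"
  show "den w' (f \<cdot> a \<cdot> b) = den w' (g \<cdot> a \<cdot> b)"
  proof (rule den_ext)
    fix w'' c assume b: "w' \<sqsubseteq> w''" "ty w'' c = Some \<rho>3"
    show "den w'' (f \<cdot> a \<cdot> b \<cdot> c) = den w'' (g \<cdot> a \<cdot> b \<cdot> c)"
      by (rule assms(3)[OF wle_trans[OF a(1) b(1)] ty_mono[OF b(1) a(2)] ty_mono[OF b(1) a(3)] b(2)])
  qed (use ty_mono[OF a(1)] assms a in simp_all)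
qed

lemma den_Succ_inj:
  assumes "den w (Succ \<cdot> m) = den w (Succ \<cdot> n)" "ty w m = Some N" "ty w n = Some N"
  shows "den w m = den w n"
proof -
  have "w \<tturnstile> Eq N (Succ \<cdot> m) (Succ \<cdot> n)" using assms by (intro den_eqD) simp_all
  moreover have "w \<tturnstile> Imp (Eq N (Succ \<cdot> m) (Succ \<cdot> n)) (Eq N m n)"
    using assms by (simp add: forces_def HA.Succ_inj wt_iff)
  ultimately show ?thesis using den_eqI forces_ImpE by metis
qed

lemma den_Zero_Succ:
  assumes "den w Zero = den w (Succ \<cdot> m)" "ty w m = Some N" "wff (ctx w) A"
  shows "w \<tturnstile> A"
proof -
  have "w \<tturnstile> Eq N (Succ \<cdot> m) Zero" using assms by (intro den_eqD[OF assms(1)[symmetric]]) simp_all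
  moreover have "w \<tturnstile> Imp (Eq N (Succ \<cdot> m) Zero) Fls"
    using assms by (simp add: forces_def HA.Succ_not_Zero wt_iff)
  ultimately have "w \<tturnstile> Fls" by (rule forces_ImpE[rotated])
  then show ?thesis using assms(3) by (simp add: forces_def HA.FlsE)
qed

text \<open>Closes the contradictory branches of the case distinctions below.\<close>

lemma den_absurd:
  assumes "den w Zero = den w (Succ \<cdot> m)" "ty w m = Some N" "ty w t = Some \<rho>" "ty w u = Some \<rho>"
  shows "den w t = den w u"
  using den_Zero_Succ[OF assms(1,2), of "Eq \<rho> t u"] assms den_eqI by simp

subsection \<open>Combinators\<close>

text \<open>
  All auxiliary functionals are lambda lifted to closed terms without inner binders. Substitution
  leaves them alone, and one application rule for each of them makes their computation first-order rewriting.
\<close>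

definition Kc :: "ty \<Rightarrow> ty \<Rightarrow> trm" where
  "Kc \<rho> \<delta> = Lam \<rho> (Lam \<delta> (Var 1))"

lemma Kc_ty: "tyof [] (Kc \<rho> \<delta>) = Some (\<rho> \<rightarrow> \<delta> \<rightarrow> \<rho>)"
  by (simp add: Kc_def)

lemmas Kc_simps [simp] = closed[OF Kc_ty]
lemmas Kc_app [simp] = app_lam2[OF Kc_def, simplified]

definition Sc :: "ty \<Rightarrow> ty \<Rightarrow> ty \<Rightarrow> trm" where
  "Sc \<delta> \<rho> \<eta> = Lam (\<delta> \<rightarrow> \<rho> \<rightarrow> \<eta>) (Lam (\<delta> \<rightarrow> \<rho>) (Lam \<delta> (
     Var 2 \<cdot> Var 0 \<cdot> (Var 1 \<cdot> Var 0))))"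

lemma Sc_ty: "tyof [] (Sc \<delta> \<rho> \<eta>) = Some ((\<delta> \<rightarrow> \<rho> \<rightarrow> \<eta>) \<rightarrow> (\<delta> \<rightarrow> \<rho>) \<rightarrow> \<delta> \<rightarrow> \<eta>)"
  by (simp add: Sc_def)

lemmas Sc_simps [simp] = closed[OF Sc_ty]
lemmas Sc_app [simp] = app_lam3[OF Sc_def, simplified]

definition Ic :: "ty \<Rightarrow> trm" where
  "Ic \<rho> = Lam \<rho> (Var 0)"

lemma Ic_ty: "tyof [] (Ic \<rho>) = Some (\<rho> \<rightarrow> \<rho>)"
  by (simp add: Ic_def)

lemmas Ic_simps [simp] = closed[OF Ic_ty]
lemmas Ic_app [simp] = app_lam1[OF Ic_def, simplified]

definition Cmp :: "ty \<Rightarrow> ty \<Rightarrow> ty \<Rightarrow> trm" where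
  "Cmp \<rho> \<eta> \<kappa> = Lam (\<eta> \<rightarrow> \<kappa>) (Lam (\<rho> \<rightarrow> \<eta>) (Lam \<rho> (
     Var 2 \<cdot> (Var 1 \<cdot> Var 0))))"

lemma Cmp_ty: "tyof [] (Cmp \<rho> \<eta> \<kappa>) = Some ((\<eta> \<rightarrow> \<kappa>) \<rightarrow> (\<rho> \<rightarrow> \<eta>) \<rightarrow> \<rho> \<rightarrow> \<kappa>)"
  by (simp add: Cmp_def)

lemmas Cmp_simps [simp] = closed[OF Cmp_ty]
lemmas Cmp_app [simp] = app_lam3[OF Cmp_def, simplified]

definition Flp :: "ty \<Rightarrow> ty \<Rightarrow> ty \<Rightarrow> trm" where
  "Flp \<rho> \<eta> \<kappa> = Lam (\<rho> \<rightarrow> \<eta> \<rightarrow> \<kappa>) (Lam \<eta> (Lam \<rho> (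
     Var 2 \<cdot> Var 0 \<cdot> Var 1)))"

lemma Flp_ty: "tyof [] (Flp \<rho> \<eta> \<kappa>) = Some ((\<rho> \<rightarrow> \<eta> \<rightarrow> \<kappa>) \<rightarrow> \<eta> \<rightarrow> \<rho> \<rightarrow> \<kappa>)"
  by (simp add: Flp_def)

lemmas Flp_simps [simp] = closed[OF Flp_ty]
lemmas Flp_app [simp] = app_lam3[OF Flp_def, simplified]

definition ncf :: "ty \<Rightarrow> trm" where
  "ncf \<rho> = Lam (N \<rightarrow> \<rho>) (Lam N (Lam \<rho> (Var 2 \<cdot> Var 1)))"

lemma ncf_ty: "tyof [] (ncf \<rho>) = Some ((N \<rightarrow> \<rho>) \<rightarrow> N \<rightarrow> \<rho> \<rightarrow> \<rho>)"
  by (simp add: ncf_def)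

lemmas ncf_simps [simp] = closed[OF ncf_ty]
lemmas ncf_app [simp] = app_lam3[OF ncf_def, simplified]

definition ncase :: "ty \<Rightarrow> trm" where
  "ncase \<rho> = Lam \<rho> (Lam (N \<rightarrow> \<rho>) (Lam N (
     Rec \<rho> \<cdot> Var 2 \<cdot> (ncf \<rho> \<cdot> Var 1) \<cdot> Var 0)))"

lemma ncase_ty: "tyof [] (ncase \<rho>) = Some (\<rho> \<rightarrow> (N \<rightarrow> \<rho>) \<rightarrow> N \<rightarrow> \<rho>)"
  by (simp add: ncase_def)

lemmas ncase_simps [simp] = closed[OF ncase_ty]
lemmas ncase_app = app_lam3[OF ncase_def, simplified]

lemma ncase_Zero [simp]:
  "tyv w a = Some \<rho> \<Longrightarrow> tyv w f = Some (N \<rightarrow> \<rho>) \<Longrightarrow> app w (app w (app w (den w (ncase \<rho>)) a) f) (den w Zero) = a"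
  by (simp add: ncase_app)

lemma ncase_Succ [simp]:
  "tyv w a = Some \<rho> \<Longrightarrow> tyv w f = Some (N \<rightarrow> \<rho>) \<Longrightarrow> tyv w m = Some N \<Longrightarrow>
    app w (app w (app w (den w (ncase \<rho>)) a) f) (app w (den w Succ) m) = app w f m"
  by (simp add: ncase_app)

text \<open>Test for zero; the first argument is the result at \<open>0\<close>, the second the
  result at successors.\<close>

definition cnd :: "ty \<Rightarrow> trm" where
  "cnd \<rho> = Lam \<rho> (Lam \<rho> (Lam N (
     ncase \<rho> \<cdot> Var 2 \<cdot> (Kc \<rho> N \<cdot> Var 1) \<cdot> Var 0)))"

lemma cnd_ty: "tyof [] (cnd \<rho>) = Some (\<rho> \<rightarrow> \<rho> \<rightarrow> N \<rightarrow> \<rho>)"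
  by (simp add: cnd_def)

lemmas cnd_simps [simp] = closed[OF cnd_ty]
lemmas cnd_app = app_lam3[OF cnd_def, simplified]

lemma cnd_Zero [simp]:
  "tyv w a = Some \<rho> \<Longrightarrow> tyv w b = Some \<rho> \<Longrightarrow> app w (app w (app w (den w (cnd \<rho>)) a) b) (den w Zero) = a"
  by (simp add: cnd_app)

lemma cnd_Succ [simp]:
  "tyv w a = Some \<rho> \<Longrightarrow> tyv w b = Some \<rho> \<Longrightarrow> tyv w m = Some N \<Longrightarrow>
    app w (app w (app w (den w (cnd \<rho>)) a) b) (app w (den w Succ) m) = b"
  by (simp add: cnd_app)

subsection \<open>Sequences\<close>

lemma zero_ty: "tyof [] (zero \<rho>) = Some \<rho>"
proof -
  have "tyof \<Gamma> (zero \<rho>) = Some \<rho>" for \<Gamma> by (induction \<rho> arbitrary: \<Gamma>) simp_all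
  then show ?thesis .
qed

lemmas zero_simps [simp] = closed[OF zero_ty]

lemma scons_ty: "tyof [] (scons \<tau>) = Some (\<tau> \<rightarrow> (N \<rightarrow> \<tau>) \<rightarrow> N \<rightarrow> \<tau>)"
  by (simp add: scons_def)

lemmas scons_simps [simp] = closed[OF scons_ty]

lemma prepend_ty: "tyof [] (prepend \<tau>) = Some (Seq \<tau> \<rightarrow> (N \<rightarrow> \<tau>) \<rightarrow> N \<rightarrow> \<tau>)"
  by (simp add: prepend_def)

lemmas prepend_simps [simp] = closed[OF prepend_ty]

lemma hat_ty: "tyof [] (hat \<tau>) = Some (Seq \<tau> \<rightarrow> N \<rightarrow> \<tau>)"
  by (simp add: hat_def del: zero.simps)

lemmas hat_simps [simp] = closed[OF hat_ty]

lemma len_ty: "tyof [] (len \<tau>) = Some (Seq \<tau> \<rightarrow> N)"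
  by (simp add: len_def)

lemmas len_simps [simp] = closed[OF len_ty]

text \<open>\<open>scons\<close> has an inner abstraction that captures the tail, so the rules for
  lambda lifted terms do not evaluate it. Instead the beta steps are carried out on
  representatives.\<close>

lemma scons_app:
  assumes "tyv w x = Some \<tau>" "tyv w b = Some (N \<rightarrow> \<tau>)"
  shows "app w (app w (app w (den w (scons \<tau>)) x) b) (den w Zero) = x"
    and "tyv w m = Some N \<Longrightarrow> app w (app w (app w (den w (scons \<tau>)) x) b) (app w (den w Succ) m) = app w b m"
proof -
  obtain x' b' where xb: "x = den w x'" "ty w x' = Some \<tau>" "b = den w b'" "ty w b' = Some (N \<rightarrow> \<tau>)"
    using assms tyvE by metis
  let ?l = "Lam N (Lam \<tau> (shift (shift b') \<cdot> Var 1))"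
  have "den w (Lam (N \<rightarrow> \<tau>) (Rec \<tau> \<cdot> shift x' \<cdot> Lam N (Lam \<tau> (Var 2 \<cdot> Var 1))) \<cdot> b') = den w (Rec \<tau> \<cdot> x' \<cdot> ?l)"
    using xb by (subst den_Beta[where \<eta> = "N \<rightarrow> \<tau>"]) (simp_all add: numeral_2_eq_2 del: den_App)
  moreover have "den w (scons \<tau> \<cdot> x') = den w (Lam (N \<rightarrow> \<tau>) (Rec \<tau> \<cdot> shift x' \<cdot> Lam N (Lam \<tau> (Var 2 \<cdot> Var 1))))"
    unfolding scons_def using xb
    by (subst den_Beta[where \<eta> = "(N \<rightarrow> \<tau>) \<rightarrow> N \<rightarrow> \<tau>"]) (simp_all add: numeral_2_eq_2 del: den_App)
  ultimately have e: "app w (app w (den w (scons \<tau>)) x) b = den w (Rec \<tau> \<cdot> x' \<cdot> ?l)"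
    using xb by simp
  have l: "ty w ?l = Some (N \<rightarrow> \<tau> \<rightarrow> \<tau>)" using xb by simp
  show "app w (app w (app w (den w (scons \<tau>)) x) b) (den w Zero) = x"
    unfolding e using xb l by simp
  assume "tyv w m = Some N"
  then obtain m' where m: "m = den w m'" "ty w m' = Some N" by (rule tyvE)
  have *: "den w (?l \<cdot> m' \<cdot> u) = den w (b' \<cdot> m')" if "ty w u = Some \<tau>" for u
  proof -
    have "den w (?l \<cdot> m') = den w (Lam \<tau> (shift b' \<cdot> shift m'))"
      using xb m by (subst den_Beta[where \<eta> = "\<tau> \<rightarrow> \<tau>"]) (simp_all del: den_App)
    moreover have "den w (Lam \<tau> (shift b' \<cdot> shift m') \<cdot> u) = den w (b' \<cdot> m')"
      using xb m that by (subst den_Beta[where \<eta> = "\<tau>"]) (simp_all del: den_App)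
    ultimately show ?thesis by simp
  qed
  show "app w (app w (app w (den w (scons \<tau>)) x) b) (app w (den w Succ) m) = app w b m"
    unfolding e using xb l m *[of "Rec \<tau> \<cdot> x' \<cdot> ?l \<cdot> m'"] by simp
qed

declare scons_app [simp]

lemma prepend_Emp [simp]: "tyv w b = Some (N \<rightarrow> \<tau>) \<Longrightarrow> app w (app w (den w (prepend \<tau>)) (den w (Emp \<tau>))) b = b"
  unfolding prepend_def by (simp add: app_lam1[OF refl])

lemma prepend_Snoc [simp]:
  "tyv w s = Some (Seq \<tau>) \<Longrightarrow> tyv w x = Some \<tau> \<Longrightarrow> tyv w b = Some (N \<rightarrow> \<tau>) \<Longrightarrow>
   app w (app w (den w (prepend \<tau>)) (app w (app w (den w (Snoc \<tau>)) s) x)) b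
    = app w (app w (den w (prepend \<tau>)) s) (app w (app w (den w (scons \<tau>)) x) b)"
  unfolding prepend_def by (simp add: app_lam4[OF refl])

lemma hat_app [simp]: "tyv w s = Some (Seq \<tau>) \<Longrightarrow> app w (den w (hat \<tau>)) s = app w (app w (den w (prepend \<tau>)) s) (den w (zero (N \<rightarrow> \<tau>)))"
  unfolding hat_def by (simp add: app_lam1[OF refl] del: zero.simps)

lemma len_Emp [simp]: "app w (den w (len \<tau>)) (den w (Emp \<tau>)) = den w Zero"
  unfolding len_def by (simp add: app_lam3[OF refl])

lemma len_Snoc [simp]: "tyv w s = Some (Seq \<tau>) \<Longrightarrow> tyv w x = Some \<tau> \<Longrightarrow>
  app w (den w (len \<tau>)) (app w (app w (den w (Snoc \<tau>)) s) x) = app w (den w Succ) (app w (den w (len \<tau>)) s)"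
  unfolding len_def by (simp add: app_lam3[OF refl])

subsection \<open>Translation\<close>

locale bar_types = fixes \<tau> \<sigma> :: ty
begin

abbreviation "B \<equiv> N \<rightarrow> \<tau>"
abbreviation "GT \<equiv> Seq \<tau> \<rightarrow> \<sigma>"
abbreviation "HT \<equiv> Seq \<tau> \<rightarrow> (\<tau> \<rightarrow> \<sigma>) \<rightarrow> \<sigma>"
abbreviation "WT \<equiv> Seq \<tau> \<rightarrow> N"
abbreviation "BT \<equiv> GT \<rightarrow> HT \<rightarrow> Seq \<tau> \<rightarrow> \<sigma>"
abbreviation "N0 \<equiv> WT \<otimes> BT"
abbreviation "fW \<equiv> Fst WT BT"
abbreviation "fB \<equiv> Snd WT BT"

text \<open>
  For \<open>m = (W, \<B>)\<close> the formula \<open>RN m y\<close> consists of the equations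
    \<^item> \<open>W s = (if W s = 0 then 0 else y (s @ \<beta>) + 1)\<close>,
    \<^item> \<open>W s = (if W s = 0 then 0 else W (s * x))\<close>,
    \<^item> \<open>\<B> G H s = (if W s = 0 then H s (\<lambda>x. \<B> G H (s * x)) else G s)\<close>.

  Stated between functionals, by extensionality, they need neither quantifiers nor implications.
\<close>

definition nxt :: "trm" where
  "nxt = Lam GT (Lam (Seq \<tau>) (Lam \<tau> (
     Var 2 \<cdot> (Snoc \<tau> \<cdot> Var 1 \<cdot> Var 0))))"

lemma nxt_ty: "tyof [] nxt = Some (GT \<rightarrow> (Seq \<tau>) \<rightarrow> \<tau> \<rightarrow> \<sigma>)"
  by (simp add: nxt_def)

lemmas nxt_simps [simp] = closed[OF nxt_ty]
lemmas nxt_app [simp] = app_lam3[OF nxt_def, simplified]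

text \<open>\<open>e1l\<close> and \<open>e1r\<close> are the two sides of the first equation, and
  likewise below for the others. \<open>e1l\<close> and \<open>e2l\<close> ignore their last
  argument, which only brings \<open>W s\<close> to the type of the right-hand side.\<close>

definition e1l :: "trm" where
  "e1l = Lam N0 (Lam (Seq \<tau>) (Lam B (fW \<cdot> Var 2 \<cdot> Var 1)))"

lemma e1l_ty: "tyof [] e1l = Some (N0 \<rightarrow> (Seq \<tau>) \<rightarrow> B \<rightarrow> N)"
  by (simp add: e1l_def)

lemmas e1l_simps [simp] = closed[OF e1l_ty]
lemmas e1l_app [simp] = app_lam3[OF e1l_def, simplified]

definition e1r :: "trm" where
  "e1r = Lam N0 (Lam (B \<rightarrow> N) (Lam (Seq \<tau>) (Lam B (
     cnd N \<cdot> Zero \<cdot> (Succ \<cdot> (Var 2 \<cdot> (prepend \<tau>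
      \<cdot> Var 1 \<cdot> Var 0))) \<cdot> (fW \<cdot> Var 3 \<cdot> Var 1)))))"

lemma e1r_ty: "tyof [] e1r = Some (N0 \<rightarrow> (B \<rightarrow> N) \<rightarrow> (Seq \<tau>) \<rightarrow> B \<rightarrow> N)"
  by (simp add: e1r_def)

lemmas e1r_simps [simp] = closed[OF e1r_ty]
lemmas e1r_app [simp] = app_lam4[OF e1r_def, simplified]

definition e2l :: "trm" where
  "e2l = Lam N0 (Lam (Seq \<tau>) (Lam \<tau> (fW \<cdot> Var 2 \<cdot> Var 1)))"

lemma e2l_ty: "tyof [] e2l = Some (N0 \<rightarrow> (Seq \<tau>) \<rightarrow> \<tau> \<rightarrow> N)"
  by (simp add: e2l_def)

lemmas e2l_simps [simp] = closed[OF e2l_ty]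
lemmas e2l_app [simp] = app_lam3[OF e2l_def, simplified]

definition e2r :: "trm" where
  "e2r = Lam N0 (Lam (Seq \<tau>) (Lam \<tau> (
     cnd N \<cdot> Zero \<cdot> (fW \<cdot> Var 2 \<cdot> (Snoc \<tau> \<cdot> Var 1
      \<cdot> Var 0)) \<cdot> (fW \<cdot> Var 2 \<cdot> Var 1))))"

lemma e2r_ty: "tyof [] e2r = Some (N0 \<rightarrow> (Seq \<tau>) \<rightarrow> \<tau> \<rightarrow> N)"
  by (simp add: e2r_def)

lemmas e2r_simps [simp] = closed[OF e2r_ty]
lemmas e2r_app [simp] = app_lam3[OF e2r_def, simplified]

definition e3r :: "trm" where
  "e3r = Lam N0 (Lam GT (Lam HT (Lam (Seq \<tau>) (
     cnd \<sigma> \<cdot> (Var 1 \<cdot> Var 0 \<cdot> (nxt \<cdot> (fB \<cdot> Var 3 \<cdot> Var 2 \<cdot> Var 1)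
      \<cdot> Var 0)) \<cdot> (Var 2 \<cdot> Var 0) \<cdot> (fW \<cdot> Var 3 \<cdot> Var 0)))))"

lemma e3r_ty: "tyof [] e3r = Some (N0 \<rightarrow> GT \<rightarrow> HT \<rightarrow> (Seq \<tau>) \<rightarrow> \<sigma>)"
  by (simp add: e3r_def)

lemmas e3r_simps [simp] = closed[OF e3r_ty]
lemmas e3r_app [simp] = app_lam4[OF e3r_def, simplified]

definition RN :: "trm \<Rightarrow> trm \<Rightarrow> fm" where
  "RN m y = And (Eq (Seq \<tau> \<rightarrow> B \<rightarrow> N) (e1l \<cdot> m) (e1r \<cdot> m \<cdot> y))
    (And (Eq (Seq \<tau> \<rightarrow> \<tau> \<rightarrow> N) (e2l \<cdot> m) (e2r \<cdot> m)) (Eq BT (fB \<cdot> m) (e3r \<cdot> m)))"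

lemma RN_sub [simp]: "fsub \<theta> (RN m y) = RN (sub \<theta> m) (sub \<theta> y)"
  by (simp add: RN_def)

lemma RN_wff [simp]: "tyof \<Gamma> m = Some N0 \<Longrightarrow> tyof \<Gamma> y = Some (B \<rightarrow> N) \<Longrightarrow> wff \<Gamma> (RN m y)"
  by (simp add: RN_def)

lemma RN_den:
  assumes "w \<tturnstile> RN m y"
  shows "den w (e1l \<cdot> m) = den w (e1r \<cdot> m \<cdot> y)" "den w (e2l \<cdot> m) = den w (e2r \<cdot> m)" "den w (fB \<cdot> m) = den w (e3r \<cdot> m)"
  using assms den_eqI unfolding RN_def forces_And by blast+

lemma RN_Zero:
  assumes "w \<tturnstile> RN m y" "ty w m = Some N0" "ty w s = Some (Seq \<tau>)" "ty w g = Some GT" "ty w h = Some HT"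
    and "den w (fW \<cdot> m \<cdot> s) = den w Zero"
  shows "den w (fB \<cdot> m \<cdot> g \<cdot> h \<cdot> s) = den w (h \<cdot> s \<cdot> (nxt \<cdot> (fB \<cdot> m \<cdot> g \<cdot> h) \<cdot> s))"
proof -
  have "den w (fB \<cdot> m \<cdot> g \<cdot> h \<cdot> s) = den w (e3r \<cdot> m \<cdot> g \<cdot> h \<cdot> s)"
    using RN_den(3)[OF assms(1)] by simp
  then show ?thesis using assms(2-) by simp
qed

lemma RN_Succ:
  assumes "w \<tturnstile> RN m y" "ty w m = Some N0" "ty w y = Some (B \<rightarrow> N)" "ty w s = Some (Seq \<tau>)" "ty w k = Some N"
    and "den w (fW \<cdot> m \<cdot> s) = den w (Succ \<cdot> k)"
  shows "ty w b = Some B \<Longrightarrow> den w (y \<cdot> (prepend \<tau> \<cdot> s \<cdot> b)) = den w k"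
    and "ty w x = Some \<tau> \<Longrightarrow> den w (fW \<cdot> m \<cdot> (Snoc \<tau> \<cdot> s \<cdot> x)) = den w (Succ \<cdot> k)"
    and "ty w g = Some GT \<Longrightarrow> ty w h = Some HT \<Longrightarrow> den w (fB \<cdot> m \<cdot> g \<cdot> h \<cdot> s) = den w (g \<cdot> s)"
proof -
  assume b: "ty w b = Some B"
  have "den w (e1l \<cdot> m \<cdot> s \<cdot> b) = den w (e1r \<cdot> m \<cdot> y \<cdot> s \<cdot> b)"
    using RN_den(1)[OF assms(1)] by simp
  then have "den w (Succ \<cdot> k) = den w (Succ \<cdot> (y \<cdot> (prepend \<tau> \<cdot> s \<cdot> b)))"
    using assms(2-) b by simp
  then show "den w (y \<cdot> (prepend \<tau> \<cdot> s \<cdot> b)) = den w k"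
    using den_Succ_inj[of w k "y \<cdot> (prepend \<tau> \<cdot> s \<cdot> b)"] assms(2-) b by simp
next
  assume b: "ty w x = Some \<tau>"
  have "den w (e2l \<cdot> m \<cdot> s \<cdot> x) = den w (e2r \<cdot> m \<cdot> s \<cdot> x)"
    using RN_den(2)[OF assms(1)] by simp
  then show "den w (fW \<cdot> m \<cdot> (Snoc \<tau> \<cdot> s \<cdot> x)) = den w (Succ \<cdot> k)"
    using assms(2-) b by simp
next
  assume b: "ty w g = Some GT" "ty w h = Some HT"
  have "den w (fB \<cdot> m \<cdot> g \<cdot> h \<cdot> s) = den w (e3r \<cdot> m \<cdot> g \<cdot> h \<cdot> s)"
    using RN_den(3)[OF assms(1)] by simp
  then show "den w (fB \<cdot> m \<cdot> g \<cdot> h \<cdot> s) = den w (g \<cdot> s)" using assms(2-) b by simp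
qed

text \<open>Converse to \<open>RN_Zero\<close> and \<open>RN_Succ\<close>. The equations carry no
  conditions, so they are checked by extensionality and a case distinction on whether
  \<open>s\<close> secures a value.\<close>

lemma RN_I:
  assumes m: "ty w m = Some N0" and y: "ty w y = Some (B \<rightarrow> N)"
    and z: "\<And>w' s g h. w \<sqsubseteq> w' \<Longrightarrow> ty w' s = Some (Seq \<tau>) \<Longrightarrow> ty w' g = Some GT \<Longrightarrow> ty w' h = Some HT
      \<Longrightarrow> den w' (fW \<cdot> m \<cdot> s) = den w' Zero
      \<Longrightarrow> den w' (fB \<cdot> m \<cdot> g \<cdot> h \<cdot> s) = den w' (h \<cdot> s \<cdot> (nxt \<cdot> (fB \<cdot> m \<cdot> g \<cdot> h) \<cdot> s))"
    and s1: "\<And>w' s k b. w \<sqsubseteq> w' \<Longrightarrow> ty w' s = Some (Seq \<tau>) \<Longrightarrow> ty w' k = Some N \<Longrightarrow> den w' (fW \<cdot> m \<cdot> s) = den w' (Succ \<cdot> k)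
      \<Longrightarrow> ty w' b = Some B \<Longrightarrow> den w' (y \<cdot> (prepend \<tau> \<cdot> s \<cdot> b)) = den w' k"
    and s2: "\<And>w' s k x. w \<sqsubseteq> w' \<Longrightarrow> ty w' s = Some (Seq \<tau>) \<Longrightarrow> ty w' k = Some N \<Longrightarrow> den w' (fW \<cdot> m \<cdot> s) = den w' (Succ \<cdot> k)
      \<Longrightarrow> ty w' x = Some \<tau> \<Longrightarrow> den w' (fW \<cdot> m \<cdot> (Snoc \<tau> \<cdot> s \<cdot> x)) = den w' (Succ \<cdot> k)"
    and s3: "\<And>w' s k g h. w \<sqsubseteq> w' \<Longrightarrow> ty w' s = Some (Seq \<tau>) \<Longrightarrow> ty w' k = Some N \<Longrightarrow> den w' (fW \<cdot> m \<cdot> s) = den w' (Succ \<cdot> k)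
      \<Longrightarrow> ty w' g = Some GT \<Longrightarrow> ty w' h = Some HT \<Longrightarrow> den w' (fB \<cdot> m \<cdot> g \<cdot> h \<cdot> s) = den w' (g \<cdot> s)"
  shows "w \<tturnstile> RN m y"
proof -
  have 1: "den w (e1l \<cdot> m) = den w (e1r \<cdot> m \<cdot> y)"
  proof (rule den_ext2[where \<eta> = N])
    fix w' s b assume a: "w \<sqsubseteq> w'" "ty w' s = Some (Seq \<tau>)" "ty w' b = Some B"
    note t = a(2,3) ty_mono[OF a(1) m] ty_mono[OF a(1) y]
    show "den w' (e1l \<cdot> m \<cdot> s \<cdot> b) = den w' (e1r \<cdot> m \<cdot> y \<cdot> s \<cdot> b)"
    proof (rule den_eq_cases[of _ "fW \<cdot> m \<cdot> s" _ N])
      fix w'' assume c: "w' \<sqsubseteq> w''" "den w'' (fW \<cdot> m \<cdot> s) = den w'' Zero"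
      then show "den w'' (e1l \<cdot> m \<cdot> s \<cdot> b) = den w'' (e1r \<cdot> m \<cdot> y \<cdot> s \<cdot> b)"
        using t[THEN ty_mono[OF c(1)]] by simp
    next
      fix w'' k assume c: "w' \<sqsubseteq> w''" "ty w'' k = Some N" "den w'' (fW \<cdot> m \<cdot> s) = den w'' (Succ \<cdot> k)"
      note t' = t[THEN ty_mono[OF c(1)]]
      show "den w'' (e1l \<cdot> m \<cdot> s \<cdot> b) = den w'' (e1r \<cdot> m \<cdot> y \<cdot> s \<cdot> b)"
        using s1[OF wle_trans[OF a(1) c(1)] t'(1) c(2,3) t'(2)] c t' by simp
    qed (use t in simp_all)
  qed (use m y in simp_all)
  have 2: "den w (e2l \<cdot> m) = den w (e2r \<cdot> m)"
  proof (rule den_ext2[where \<eta> = N])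
    fix w' s x assume a: "w \<sqsubseteq> w'" "ty w' s = Some (Seq \<tau>)" "ty w' x = Some \<tau>"
    note t = a(2,3) ty_mono[OF a(1) m] ty_mono[OF a(1) y]
    show "den w' (e2l \<cdot> m \<cdot> s \<cdot> x) = den w' (e2r \<cdot> m \<cdot> s \<cdot> x)"
    proof (rule den_eq_cases[of _ "fW \<cdot> m \<cdot> s" _ N])
      fix w'' assume c: "w' \<sqsubseteq> w''" "den w'' (fW \<cdot> m \<cdot> s) = den w'' Zero"
      then show "den w'' (e2l \<cdot> m \<cdot> s \<cdot> x) = den w'' (e2r \<cdot> m \<cdot> s \<cdot> x)"
        using t[THEN ty_mono[OF c(1)]] by simp
    next
      fix w'' k assume c: "w' \<sqsubseteq> w''" "ty w'' k = Some N" "den w'' (fW \<cdot> m \<cdot> s) = den w'' (Succ \<cdot> k)"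
      note t' = t[THEN ty_mono[OF c(1)]]
      show "den w'' (e2l \<cdot> m \<cdot> s \<cdot> x) = den w'' (e2r \<cdot> m \<cdot> s \<cdot> x)"
        using s2[OF wle_trans[OF a(1) c(1)] t'(1) c(2,3) t'(2)] c t' by simp
    qed (use t in simp_all)
  qed (use m y in simp_all)
  have 3: "den w (fB \<cdot> m) = den w (e3r \<cdot> m)"
  proof (rule den_ext3[where \<eta> = \<sigma>])
    fix w' g h s assume a: "w \<sqsubseteq> w'" "ty w' g = Some GT" "ty w' h = Some HT" "ty w' s = Some (Seq \<tau>)"
    note t = a(2-4) ty_mono[OF a(1) m] ty_mono[OF a(1) y]
    show "den w' (fB \<cdot> m \<cdot> g \<cdot> h \<cdot> s) = den w' (e3r \<cdot> m \<cdot> g \<cdot> h \<cdot> s)"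
    proof (rule den_eq_cases[of _ "fW \<cdot> m \<cdot> s" _ \<sigma>])
      fix w'' assume c: "w' \<sqsubseteq> w''" "den w'' (fW \<cdot> m \<cdot> s) = den w'' Zero"
      note t' = t[THEN ty_mono[OF c(1)]]
      show "den w'' (fB \<cdot> m \<cdot> g \<cdot> h \<cdot> s) = den w'' (e3r \<cdot> m \<cdot> g \<cdot> h \<cdot> s)"
        using z[OF wle_trans[OF a(1) c(1)] t'(3,1,2) c(2)] c t' by simp
    next
      fix w'' k assume c: "w' \<sqsubseteq> w''" "ty w'' k = Some N" "den w'' (fW \<cdot> m \<cdot> s) = den w'' (Succ \<cdot> k)"
      note t' = t[THEN ty_mono[OF c(1)]]
      show "den w'' (fB \<cdot> m \<cdot> g \<cdot> h \<cdot> s) = den w'' (e3r \<cdot> m \<cdot> g \<cdot> h \<cdot> s)"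
        using s3[OF wle_trans[OF a(1) c(1)] t'(3) c(2,3) t'(1,2)] c t' by simp
    qed (use t in simp_all)
  qed (use m y in simp_all)
  show ?thesis
    unfolding RN_def forces_And using 1 2 3 m y by (intro conjI den_eqD) (simp_all del: den_App)
qed

end

section \<open>Codes of finite sequences\<close>

definition rfs :: "ty \<Rightarrow> trm" where
  "rfs \<rho> = Lam (Seq \<rho>) (Lam \<rho> (Lam (N \<rightarrow> \<rho>) (
     scons \<rho> \<cdot> Var 1 \<cdot> Var 0)))"

lemma rfs_ty: "tyof [] (rfs \<rho>) = Some ((Seq \<rho>) \<rightarrow> \<rho> \<rightarrow> (N \<rightarrow> \<rho>) \<rightarrow> (N \<rightarrow> \<rho>))"
  by (simp add: rfs_def)

lemmas rfs_simps [simp] = closed[OF rfs_ty]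
lemmas rfs_app [simp] = app_lam3[OF rfs_def, simplified]

text \<open>Counting from the end makes appending an element a \<open>scons\<close>, so the code of
  \<open>s * x\<close> arises from the code of \<open>s\<close> without moving entries. Entries
  beyond the length are zero.\<close>

definition rf :: "ty \<Rightarrow> trm" where
  "rf \<rho> = Lam (Seq \<rho>) (
     SRec \<rho> (N \<rightarrow> \<rho>) \<cdot> (Kc \<rho> N
      \<cdot> zero \<rho>) \<cdot> rfs \<rho> \<cdot> Var 0)"

lemma rf_ty: "tyof [] (rf \<rho>) = Some ((Seq \<rho>) \<rightarrow> (N \<rightarrow> \<rho>))"
  by (simp add: rf_def)

lemmas rf_simps [simp] = closed[OF rf_ty]
lemmas rf_app = app_lam1[OF rf_def, simplified]

lemma rf_Emp [simp]: "app w (den w (rf \<rho>)) (den w (Emp \<rho>)) = app w (den w (Kc \<rho> N)) (den w (zero \<rho>))"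
  by (simp add: rf_app)

lemma rf_Snoc [simp]: "tyv w s = Some (Seq \<rho>) \<Longrightarrow> tyv w x = Some \<rho> \<Longrightarrow>
  app w (den w (rf \<rho>)) (app w (app w (den w (Snoc \<rho>)) s) x) = app w (app w (den w (scons \<rho>)) x) (app w (den w (rf \<rho>)) s)"
  by (simp add: rf_app)

definition code :: "ty \<Rightarrow> trm" where
  "code \<rho> = Lam (Seq \<rho>) (
     Pair N (N \<rightarrow> \<rho>) \<cdot> (len \<rho>
      \<cdot> Var 0) \<cdot> (rf \<rho> \<cdot> Var 0))"

lemma code_ty: "tyof [] (code \<rho>) = Some ((Seq \<rho>) \<rightarrow> (N \<otimes> (N \<rightarrow> \<rho>)))"
  by (simp add: code_def)

lemmas code_simps [simp] = closed[OF code_ty]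
lemmas code_app [simp] = app_lam1[OF code_def, simplified]


context bar_types
begin

text \<open>The length of a sequence that depends on \<alpha> may itself depend on \<alpha>, so a
  finite sequence of translated entries would not do. Sequences get the translation of their codes,
  a number and a function.\<close>

primrec st :: "ty \<Rightarrow> ty" where
  "st N = N0"
| "st (\<rho> \<rightarrow> \<eta>) = st \<rho> \<rightarrow> st \<eta>"
| "st (\<rho> \<otimes> \<eta>) = st \<rho> \<otimes> st \<eta>"
| "st (Seq \<rho>) = N0 \<otimes> (N0 \<rightarrow> st \<rho>)"

text \<open>Objects depending on an infinite sequence are families over \<open>B\<close>:
  \<open>pw\<close> applies a family of functions to a family of arguments, \<open>kk\<close> is a
  constant family, \<open>pk\<close> applies a fixed function to a family.\<close>

abbreviation pw :: "ty \<Rightarrow> ty \<Rightarrow> trm \<Rightarrow> trm \<Rightarrow> trm" where "pw \<rho> \<eta> f x \<equiv> Sc B \<rho> \<eta> \<cdot> f \<cdot> x"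
abbreviation kk :: "ty \<Rightarrow> trm \<Rightarrow> trm" where "kk \<rho> c \<equiv> Kc \<rho> B \<cdot> c"
abbreviation pk :: "ty \<Rightarrow> ty \<Rightarrow> trm \<Rightarrow> trm \<Rightarrow> trm" where "pk \<rho> \<eta> c x \<equiv> pw \<rho> \<eta> (kk (\<rho> \<rightarrow> \<eta>) c) x"

definition Rarr :: "ty \<Rightarrow> ty \<Rightarrow> ty \<Rightarrow> (trm \<Rightarrow> trm \<Rightarrow> fm) \<Rightarrow> (trm \<Rightarrow> trm \<Rightarrow> fm) \<Rightarrow> trm \<Rightarrow> trm \<Rightarrow> fm" where
  "Rarr \<rho>0 \<rho> \<eta> P Q a b = All \<rho>0 (All (B \<rightarrow> \<rho>) (Imp (P (Var 1) (Var 0))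
    (Q (shift (shift a) \<cdot> Var 1) (pw \<rho> \<eta> (shift (shift b)) (Var 0)))))"

definition Rprd :: "ty \<Rightarrow> ty \<Rightarrow> ty \<Rightarrow> ty \<Rightarrow> (trm \<Rightarrow> trm \<Rightarrow> fm) \<Rightarrow> (trm \<Rightarrow> trm \<Rightarrow> fm) \<Rightarrow> trm \<Rightarrow> trm \<Rightarrow> fm" where
  "Rprd \<rho>0 \<eta>0 \<rho> \<eta> P Q a b = And (P (Fst \<rho>0 \<eta>0 \<cdot> a) (pk (\<rho> \<otimes> \<eta>) \<rho> (Fst \<rho> \<eta>) b))
    (Q (Snd \<rho>0 \<eta>0 \<cdot> a) (pk (\<rho> \<otimes> \<eta>) \<eta> (Snd \<rho> \<eta>) b))"

text \<open>The clause for sequences is the one for the code type written out, because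
  \<open>N \<otimes> (N \<rightarrow> \<rho>)\<close> is not a part of \<open>Seq \<rho>\<close> and
  primitive recursion cannot refer to it; \<open>R_Seq\<close> folds it back. \<open>Rarr\<close>
  and \<open>Rprd\<close> take the relations of the component types as parameters for this
  purpose.\<close>

primrec R :: "ty \<Rightarrow> trm \<Rightarrow> trm \<Rightarrow> fm" where
  "R N = RN"
| "R (\<rho> \<rightarrow> \<eta>) = Rarr (st \<rho>) \<rho> \<eta> (R \<rho>) (R \<eta>)"
| "R (\<rho> \<otimes> \<eta>) = Rprd (st \<rho>) (st \<eta>) \<rho> \<eta> (R \<rho>) (R \<eta>)"
| "R (Seq \<rho>) = (\<lambda>a b. Rprd N0 (N0 \<rightarrow> st \<rho>) N (N \<rightarrow> \<rho>) RN (Rarr N0 N \<rho> RN (R \<rho>)) a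
    (pk (Seq \<rho>) (N \<otimes> (N \<rightarrow> \<rho>)) (code \<rho>) b))"

lemma R_Seq: "R (Seq \<rho>) a b = R (N \<otimes> (N \<rightarrow> \<rho>)) a (pk (Seq \<rho>) (N \<otimes> (N \<rightarrow> \<rho>)) (code \<rho>) b)"
  by simp

lemma R_sub [simp]: "fsub \<theta> (R \<rho> a b) = R \<rho> (sub \<theta> a) (sub \<theta> b)"
  by (induction \<rho> arbitrary: \<theta> a b) (simp_all add: Rarr_def Rprd_def)

lemma R_wff [simp]: "tyof \<Gamma> a = Some (st \<rho>) \<Longrightarrow> tyof \<Gamma> b = Some (B \<rightarrow> \<rho>) \<Longrightarrow> wff \<Gamma> (R \<rho> a b)"
  by (induction \<rho> arbitrary: \<Gamma> a b) (simp_all add: Rarr_def Rprd_def)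

definition RR :: "world \<Rightarrow> ty \<Rightarrow> trm \<Rightarrow> trm \<Rightarrow> bool" where
  "RR w \<rho> a b \<longleftrightarrow> ty w a = Some (st \<rho>) \<and> ty w b = Some (B \<rightarrow> \<rho>) \<and> w \<tturnstile> R \<rho> a b"

lemma RR_ty: "RR w \<rho> a b \<Longrightarrow> ty w a = Some (st \<rho>)" "RR w \<rho> a b \<Longrightarrow> ty w b = Some (B \<rightarrow> \<rho>)"
  by (simp_all add: RR_def)

lemma RR_mono: "w \<sqsubseteq> w' \<Longrightarrow> RR w \<rho> a b \<Longrightarrow> RR w' \<rho> a b"
  by (auto simp: RR_def intro: ty_mono forces_mono)

lemma RR_cong:
  assumes "RR w \<rho> a b" "den w a = den w a'" "den w b = den w b'"
  shows "RR w \<rho> a' b'"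
proof -
  have t: "ty w a = Some (st \<rho>)" "ty w b = Some (B \<rightarrow> \<rho>)" "ty w a' = Some (st \<rho>)" "ty w b' = Some (B \<rightarrow> \<rho>)"
    using assms RR_ty den_ty by metis+
  have "w \<tturnstile> R \<rho> a' b"
    using Eq_Subst[OF den_eqD[OF assms(2) t(1)], of "R \<rho> (Var 0) (shift b)"] t assms(1) by (simp add: RR_def)
  then have "w \<tturnstile> R \<rho> a' b'"
    using Eq_Subst[OF den_eqD[OF assms(3) t(2)], of "R \<rho> (shift a') (Var 0)"] t by simp
  with t show ?thesis by (simp add: RR_def)
qed

text \<open>The premise is the Kripke reading of the quantified implication \<open>Rarr\<close>: all
  larger worlds, and in each of them all related pairs.\<close>

lemma RR_funI:
  assumes "ty w a = Some (st \<rho> \<rightarrow> st \<eta>)" "ty w b = Some (B \<rightarrow> \<rho> \<rightarrow> \<eta>)"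
    and "\<And>w' x y. w \<sqsubseteq> w' \<Longrightarrow> RR w' \<rho> x y \<Longrightarrow> RR w' \<eta> (a \<cdot> x) (pw \<rho> \<eta> b y)"
  shows "RR w (\<rho> \<rightarrow> \<eta>) a b"
proof -
  have "w \<tturnstile> Rarr (st \<rho>) \<rho> \<eta> (R \<rho>) (R \<eta>) a b"
    unfolding Rarr_def
  proof (rule forces_AllI)
    fix w1 x assume x: "w \<sqsubseteq> w1" "ty w1 x = Some (st \<rho>)"
    note t1 = assms(1,2)[THEN ty_mono[OF x(1)]]
    have "w1 \<tturnstile> All (B \<rightarrow> \<rho>) (Imp (R \<rho> (shift x) (Var 0)) (R \<eta> (shift a \<cdot> shift x) (pw \<rho> \<eta> (shift b) (Var 0))))"
    proof (rule forces_AllI)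
      fix w2 y assume y: "w1 \<sqsubseteq> w2" "ty w2 y = Some (B \<rightarrow> \<rho>)"
      note x2 = ty_mono[OF y(1) x(2)]
      have "w2 \<tturnstile> Imp (R \<rho> x y) (R \<eta> (a \<cdot> x) (pw \<rho> \<eta> b y))"
      proof (rule forces_ImpI)
        fix w3 assume w3: "w2 \<sqsubseteq> w3" "w3 \<tturnstile> R \<rho> x y"
        have "RR w3 \<rho> x y" unfolding RR_def using w3 ty_mono[OF w3(1) x2] ty_mono[OF w3(1) y(2)] by simp
        then have "RR w3 \<eta> (a \<cdot> x) (pw \<rho> \<eta> b y)"
          using assms(3) wle_trans[OF x(1) wle_trans[OF y(1) w3(1)]] by blast
        then show "w3 \<tturnstile> R \<eta> (a \<cdot> x) (pw \<rho> \<eta> b y)" by (simp add: RR_def)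
      qed (use x2 y in simp)
      then show "w2 \<tturnstile> fsub (inst y) (Imp (R \<rho> (shift x) (Var 0)) (R \<eta> (shift a \<cdot> shift x) (pw \<rho> \<eta> (shift b) (Var 0))))"
        by simp
    qed (use x t1 in simp)
    then show "w1 \<tturnstile> fsub (inst x) (All (B \<rightarrow> \<rho>) (Imp (R \<rho> (Var 1) (Var 0))
        (R \<eta> (shift (shift a) \<cdot> Var 1) (pw \<rho> \<eta> (shift (shift b)) (Var 0)))))"
      by simp
  qed (use assms in simp)
  then show ?thesis using assms by (simp add: RR_def)
qed

lemma RR_funE:
  assumes "RR w (\<rho> \<rightarrow> \<eta>) a b" "RR w \<rho> x y"
  shows "RR w \<eta> (a \<cdot> x) (pw \<rho> \<eta> b y)"
proof -
  note t = RR_ty[OF assms(1)] RR_ty[OF assms(2)]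
  have "w \<tturnstile> fsub (inst x) (All (B \<rightarrow> \<rho>) (Imp (R \<rho> (Var 1) (Var 0))
      (R \<eta> (shift (shift a) \<cdot> Var 1) (pw \<rho> \<eta> (shift (shift b)) (Var 0)))))"
    by (rule forces_AllE) (use assms t in \<open>simp_all add: RR_def Rarr_def\<close>)
  then have "w \<tturnstile> All (B \<rightarrow> \<rho>) (Imp (R \<rho> (shift x) (Var 0)) (R \<eta> (shift a \<cdot> shift x) (pw \<rho> \<eta> (shift b) (Var 0))))"
    by simp
  then have "w \<tturnstile> fsub (inst y) (Imp (R \<rho> (shift x) (Var 0)) (R \<eta> (shift a \<cdot> shift x) (pw \<rho> \<eta> (shift b) (Var 0))))"
    by (rule forces_AllE) (use t in simp)
  then have "w \<tturnstile> Imp (R \<rho> x y) (R \<eta> (a \<cdot> x) (pw \<rho> \<eta> b y))" by simp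
  moreover have "w \<tturnstile> R \<rho> x y" using assms by (simp add: RR_def)
  ultimately have "w \<tturnstile> R \<eta> (a \<cdot> x) (pw \<rho> \<eta> b y)" by (rule forces_ImpE)
  then show ?thesis using t by (simp add: RR_def)
qed

lemma RR_prod:
  assumes "ty w a = Some (st \<rho> \<otimes> st \<eta>)" "ty w b = Some (B \<rightarrow> \<rho> \<otimes> \<eta>)"
  shows "RR w (\<rho> \<otimes> \<eta>) a b \<longleftrightarrow> RR w \<rho> (Fst (st \<rho>) (st \<eta>) \<cdot> a) (pk (\<rho> \<otimes> \<eta>) \<rho> (Fst \<rho> \<eta>) b)
    \<and> RR w \<eta> (Snd (st \<rho>) (st \<eta>) \<cdot> a) (pk (\<rho> \<otimes> \<eta>) \<eta> (Snd \<rho> \<eta>) b)"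
  using assms by (simp add: RR_def Rprd_def forces_And)

lemma RR_Seq:
  assumes "ty w b = Some (B \<rightarrow> Seq \<rho>)"
  shows "RR w (Seq \<rho>) a b \<longleftrightarrow> RR w (N \<otimes> (N \<rightarrow> \<rho>)) a (pk (Seq \<rho>) (N \<otimes> (N \<rightarrow> \<rho>)) (code \<rho>) b)"
  unfolding RR_def R_Seq using assms by simp

subsection \<open>Extension of functions on numbers\<close>

text \<open>
  \<open>extN F n\<close> secures \<open>n = k\<close> first and then the value of \<open>F k\<close>: the recursor of \<open>n\<close> calls that of \<open>F k\<close>
  where it would stop.
\<close>

definition en1a :: "trm" where
  "en1a = Lam (N \<rightarrow> N0) (Lam (Seq \<tau>) (Lam N (
     fW \<cdot> (Var 2 \<cdot> Var 0) \<cdot> Var 1)))"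

lemma en1a_ty: "tyof [] en1a = Some ((N \<rightarrow> N0) \<rightarrow> (Seq \<tau>) \<rightarrow> N \<rightarrow> N)"
  by (simp add: en1a_def)

lemmas en1a_simps [simp] = closed[OF en1a_ty]
lemmas en1a_app [simp] = app_lam3[OF en1a_def, simplified]

definition en1 :: "trm" where
  "en1 = Lam (N \<rightarrow> N0) (Lam N0 (Lam (Seq \<tau>) (
     ncase N \<cdot> Zero \<cdot> (en1a \<cdot> Var 2 \<cdot> Var 0)
      \<cdot> (fW \<cdot> Var 1 \<cdot> Var 0))))"

lemma en1_ty: "tyof [] en1 = Some ((N \<rightarrow> N0) \<rightarrow> N0 \<rightarrow> (Seq \<tau>) \<rightarrow> N)"
  by (simp add: en1_def)

lemmas en1_simps [simp] = closed[OF en1_ty]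
lemmas en1_app [simp] = app_lam3[OF en1_def, simplified]

definition en2a :: "trm" where
  "en2a = Lam (N \<rightarrow> N0) (Lam GT (Lam HT (Lam (Seq \<tau>) (Lam N (
     fB \<cdot> (Var 4 \<cdot> Var 0) \<cdot> Var 3 \<cdot> Var 2 \<cdot> Var 1)))))"

lemma en2a_ty: "tyof [] en2a = Some ((N \<rightarrow> N0) \<rightarrow> GT \<rightarrow> HT \<rightarrow> (Seq \<tau>) \<rightarrow> N \<rightarrow> \<sigma>)"
  by (simp add: en2a_def)

lemmas en2a_simps [simp] = closed[OF en2a_ty]
lemmas en2a_app [simp] = app_lam5[OF en2a_def, simplified]

text \<open>This is passed to the recursor of \<open>n\<close> in place of \<open>G\<close>. Its
  zero branch \<open>G s\<close> is a default: that recursor consults its \<open>G\<close> only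
  where its own \<open>W\<close> is positive.\<close>

definition en2g :: "trm" where
  "en2g = Lam (N \<rightarrow> N0) (Lam N0 (Lam GT (Lam HT (Lam (Seq \<tau>) (
     ncase \<sigma> \<cdot> (Var 2 \<cdot> Var 0) \<cdot> (en2a \<cdot> Var 4 \<cdot> Var 2
      \<cdot> Var 1 \<cdot> Var 0) \<cdot> (fW \<cdot> Var 3 \<cdot> Var 0))))))"

lemma en2g_ty: "tyof [] en2g = Some ((N \<rightarrow> N0) \<rightarrow> N0 \<rightarrow> GT \<rightarrow> HT \<rightarrow> (Seq \<tau>) \<rightarrow> \<sigma>)"
  by (simp add: en2g_def)

lemmas en2g_simps [simp] = closed[OF en2g_ty]
lemmas en2g_app [simp] = app_lam5[OF en2g_def, simplified]

definition en2 :: "trm" where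
  "en2 = Lam (N \<rightarrow> N0) (Lam N0 (Lam GT (Lam HT (
     fB \<cdot> Var 2 \<cdot> (en2g \<cdot> Var 3 \<cdot> Var 2
      \<cdot> Var 1 \<cdot> Var 0) \<cdot> Var 0))))"

lemma en2_ty: "tyof [] en2 = Some ((N \<rightarrow> N0) \<rightarrow> N0 \<rightarrow> GT \<rightarrow> HT \<rightarrow> GT)"
  by (simp add: en2_def)

lemmas en2_simps [simp] = closed[OF en2_ty]
lemmas en2_app [simp] = app_lam4[OF en2_def, simplified]

definition extN :: "trm" where
  "extN = Lam (N \<rightarrow> N0) (Lam N0 (
     Pair WT BT \<cdot> (en1 \<cdot> Var 1 \<cdot> Var 0) \<cdot> (en2 \<cdot> Var 1 \<cdot> Var 0)))"

lemma extN_ty: "tyof [] extN = Some ((N \<rightarrow> N0) \<rightarrow> N0 \<rightarrow> N0)"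
  by (simp add: extN_def)

lemmas extN_simps [simp] = closed[OF extN_ty]
lemmas extN_app [simp] = app_lam2[OF extN_def, simplified]


text \<open>Recursors that agree on the one-element extensions of \<open>s\<close> pass the same
  function to \<open>H\<close>.\<close>

lemma nxt_Snoc_cong:
  assumes "ty w f = Some GT" "ty w g = Some GT" "ty w s = Some (Seq \<tau>)"
    and "\<And>w' x. w \<sqsubseteq> w' \<Longrightarrow> ty w' x = Some \<tau> \<Longrightarrow> den w' (f \<cdot> (Snoc \<tau> \<cdot> s \<cdot> x)) = den w' (g \<cdot> (Snoc \<tau> \<cdot> s \<cdot> x))"
  shows "den w (nxt \<cdot> f \<cdot> s) = den w (nxt \<cdot> g \<cdot> s)"
proof (rule den_ext[where \<rho> = \<tau> and \<eta> = \<sigma>])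
  fix w' x assume x: "w \<sqsubseteq> w'" "ty w' x = Some \<tau>"
  show "den w' (nxt \<cdot> f \<cdot> s \<cdot> x) = den w' (nxt \<cdot> g \<cdot> s \<cdot> x)"
    using assms(4)[OF x] x assms(1-3)[THEN ty_mono[OF x(1)]] by simp
qed (use assms in simp_all)

text \<open>The critical case is that \<open>s\<close> secures \<open>n = k\<close> but not yet the
  value of \<open>F k\<close>. There control has already passed to the recursor of
  \<open>F k\<close>, and unfolding it must agree with unfolding the composite. Persistence of
  security, the second equation of \<open>RN\<close>, is what makes this hold.\<close>

lemma extN:
  assumes F: "ty w F = Some (N \<rightarrow> N0)" and f: "ty w f = Some (B \<rightarrow> N \<rightarrow> N)" and n: "RR w N n y"
    and Ff: "\<And>w' k. w \<sqsubseteq> w' \<Longrightarrow> ty w' k = Some N \<Longrightarrow> RR w' N (F \<cdot> k) (pw N N f (kk N k))"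
  shows "RR w N (extN \<cdot> F \<cdot> n) (pw N N f y)"
proof -
  note t = F f RR_ty(1)[OF n, simplified] RR_ty(2)[OF n]
  have nR: "w \<tturnstile> RN n y" using n by (simp add: RR_def)
  have FR: "\<And>w' k. w \<sqsubseteq> w' \<Longrightarrow> ty w' k = Some N \<Longrightarrow> w' \<tturnstile> RN (F \<cdot> k) (pw N N f (kk N k))"
    using Ff by (simp add: RR_def)
  have "w \<tturnstile> RN (extN \<cdot> F \<cdot> n) (pw N N f y)"
  proof (rule RN_I)
    fix w' s g h
    assume w': "w \<sqsubseteq> w'" and ts: "ty w' s = Some (Seq \<tau>)" "ty w' g = Some GT" "ty w' h = Some HT"
      and z: "den w' (fW \<cdot> (extN \<cdot> F \<cdot> n) \<cdot> s) = den w' Zero"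
    note t' = ts t[THEN ty_mono[OF w']]
    show "den w' (fB \<cdot> (extN \<cdot> F \<cdot> n) \<cdot> g \<cdot> h \<cdot> s) = den w' (h \<cdot> s \<cdot> (nxt \<cdot> (fB \<cdot> (extN \<cdot> F \<cdot> n) \<cdot> g \<cdot> h) \<cdot> s))"
    proof (rule den_eq_cases[of _ "fW \<cdot> n \<cdot> s" _ \<sigma>])
      fix v assume v: "w' \<sqsubseteq> v" and c: "den v (fW \<cdot> n \<cdot> s) = den v Zero"
      note tv = t'[THEN ty_mono[OF v]] and nv = forces_mono[OF wle_trans[OF w' v] nR]
      show "den v (fB \<cdot> (extN \<cdot> F \<cdot> n) \<cdot> g \<cdot> h \<cdot> s) = den v (h \<cdot> s \<cdot> (nxt \<cdot> (fB \<cdot> (extN \<cdot> F \<cdot> n) \<cdot> g \<cdot> h) \<cdot> s))"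
        using RN_Zero[OF nv _ _ _ _ c, of "en2g \<cdot> F \<cdot> n \<cdot> g \<cdot> h" h] tv by simp
    next
      fix v k assume v: "w' \<sqsubseteq> v" and k: "ty v k = Some N" and c: "den v (fW \<cdot> n \<cdot> s) = den v (Succ \<cdot> k)"
      note tv = k t'[THEN ty_mono[OF v]] and nv = forces_mono[OF wle_trans[OF w' v] nR]
      note Fv = FR[OF wle_trans[OF w' v] k]
      have zv: "den v (fW \<cdot> (F \<cdot> k) \<cdot> s) = den v Zero"
        using den_mono[OF v z] t' c tv by simp
      \<comment> \<open>At \<open>s * x\<close> the number \<open>n\<close> is still secured with
        the same \<open>k\<close>, so the composite again hands over to the recursor of
        \<open>F k\<close>.\<close>
      have nx: "den v (nxt \<cdot> (fB \<cdot> (F \<cdot> k) \<cdot> g \<cdot> h) \<cdot> s) = den v (nxt \<cdot> (fB \<cdot> (extN \<cdot> F \<cdot> n) \<cdot> g \<cdot> h) \<cdot> s)"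
      proof (rule nxt_Snoc_cong)
        fix u x assume u: "v \<sqsubseteq> u" and x: "ty u x = Some \<tau>"
        note tu = x tv[THEN ty_mono[OF u]] and nu = forces_mono[OF u nv]
        have cu: "den u (fW \<cdot> n \<cdot> s) = den u (Succ \<cdot> k)" by (rule den_mono[OF u c]) (use tv in simp)
        have c': "den u (fW \<cdot> n \<cdot> (Snoc \<tau> \<cdot> s \<cdot> x)) = den u (Succ \<cdot> k)"
          by (rule RN_Succ(2)[OF nu _ _ _ _ cu]) (use tu in simp_all)
        have "den u (fB \<cdot> n \<cdot> (en2g \<cdot> F \<cdot> n \<cdot> g \<cdot> h) \<cdot> h \<cdot> (Snoc \<tau> \<cdot> s \<cdot> x)) = den u (en2g \<cdot> F \<cdot> n \<cdot> g \<cdot> h \<cdot> (Snoc \<tau> \<cdot> s \<cdot> x))"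
          by (rule RN_Succ(3)[OF nu _ _ _ _ c']) (use tu in simp_all)
        then show "den u (fB \<cdot> (F \<cdot> k) \<cdot> g \<cdot> h \<cdot> (Snoc \<tau> \<cdot> s \<cdot> x)) = den u (fB \<cdot> (extN \<cdot> F \<cdot> n) \<cdot> g \<cdot> h \<cdot> (Snoc \<tau> \<cdot> s \<cdot> x))"
          using c' tu by simp
      qed (use tv in simp_all)
      have "den v (fB \<cdot> n \<cdot> (en2g \<cdot> F \<cdot> n \<cdot> g \<cdot> h) \<cdot> h \<cdot> s) = den v (en2g \<cdot> F \<cdot> n \<cdot> g \<cdot> h \<cdot> s)"
        by (rule RN_Succ(3)[OF nv _ _ _ _ c]) (use tv in simp_all)
      moreover have "den v (fB \<cdot> (F \<cdot> k) \<cdot> g \<cdot> h \<cdot> s) = den v (h \<cdot> s \<cdot> (nxt \<cdot> (fB \<cdot> (F \<cdot> k) \<cdot> g \<cdot> h) \<cdot> s))"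
        by (rule RN_Zero[OF Fv _ _ _ _ zv]) (use tv in simp_all)
      ultimately show "den v (fB \<cdot> (extN \<cdot> F \<cdot> n) \<cdot> g \<cdot> h \<cdot> s) = den v (h \<cdot> s \<cdot> (nxt \<cdot> (fB \<cdot> (extN \<cdot> F \<cdot> n) \<cdot> g \<cdot> h) \<cdot> s))"
        using c tv nx by simp
    qed (use t' in simp_all)
  next
    fix w' s j b
    assume w': "w \<sqsubseteq> w'" and ts: "ty w' s = Some (Seq \<tau>)" "ty w' j = Some N"
      and z: "den w' (fW \<cdot> (extN \<cdot> F \<cdot> n) \<cdot> s) = den w' (Succ \<cdot> j)" and tb: "ty w' b = Some B"
    note t' = ts tb t[THEN ty_mono[OF w']]
    show "den w' (pw N N f y \<cdot> (prepend \<tau> \<cdot> s \<cdot> b)) = den w' j"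
    proof (rule den_eq_cases[of _ "fW \<cdot> n \<cdot> s" _ N])
      fix v assume v: "w' \<sqsubseteq> v" and c: "den v (fW \<cdot> n \<cdot> s) = den v Zero"
      note tv = t'[THEN ty_mono[OF v]]
      \<comment> \<open>Impossible: as long as \<open>n\<close> is not secured the \<open>W\<close>
        of the composite is \<open>0\<close>, which contradicts \<open>z\<close>.\<close>
      show "den v (pw N N f y \<cdot> (prepend \<tau> \<cdot> s \<cdot> b)) = den v j"
        by (rule den_absurd[of v j _ N]) (use den_mono[OF v z] c tv t' in simp_all)
    next
      fix v k assume v: "w' \<sqsubseteq> v" and k: "ty v k = Some N" and c: "den v (fW \<cdot> n \<cdot> s) = den v (Succ \<cdot> k)"
      note tv = k t'[THEN ty_mono[OF v]] and nv = forces_mono[OF wle_trans[OF w' v] nR]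
      note Fv = FR[OF wle_trans[OF w' v] k]
      have zv: "den v (fW \<cdot> (F \<cdot> k) \<cdot> s) = den v (Succ \<cdot> j)"
        using den_mono[OF v z] t' c tv by simp
      \<comment> \<open>On extensions of \<open>s\<close> the index is the constant
        \<open>k\<close>, so the composite family coincides there with the one that
        \<open>F k\<close> realizes.\<close>
      have "den v (y \<cdot> (prepend \<tau> \<cdot> s \<cdot> b)) = den v k"
        by (rule RN_Succ(1)[OF nv _ _ _ _ c]) (use tv in simp_all)
      moreover have "den v (pw N N f (kk N k) \<cdot> (prepend \<tau> \<cdot> s \<cdot> b)) = den v j"
        by (rule RN_Succ(1)[OF Fv _ _ _ _ zv]) (use tv in simp_all)
      ultimately show "den v (pw N N f y \<cdot> (prepend \<tau> \<cdot> s \<cdot> b)) = den v j"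
        using tv by simp
    qed (use t' in simp_all)
  next
    fix w' s j x
    assume w': "w \<sqsubseteq> w'" and ts: "ty w' s = Some (Seq \<tau>)" "ty w' j = Some N"
      and z: "den w' (fW \<cdot> (extN \<cdot> F \<cdot> n) \<cdot> s) = den w' (Succ \<cdot> j)" and tb: "ty w' x = Some \<tau>"
    note t' = ts tb t[THEN ty_mono[OF w']]
    show "den w' (fW \<cdot> (extN \<cdot> F \<cdot> n) \<cdot> (Snoc \<tau> \<cdot> s \<cdot> x)) = den w' (Succ \<cdot> j)"
    proof (rule den_eq_cases[of _ "fW \<cdot> n \<cdot> s" _ N])
      fix v assume v: "w' \<sqsubseteq> v" and c: "den v (fW \<cdot> n \<cdot> s) = den v Zero"
      note tv = t'[THEN ty_mono[OF v]]
      show "den v (fW \<cdot> (extN \<cdot> F \<cdot> n) \<cdot> (Snoc \<tau> \<cdot> s \<cdot> x)) = den v (Succ \<cdot> j)"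
        by (rule den_absurd[of v j _ N]) (use den_mono[OF v z] c tv t' in simp_all)
    next
      fix v k assume v: "w' \<sqsubseteq> v" and k: "ty v k = Some N" and c: "den v (fW \<cdot> n \<cdot> s) = den v (Succ \<cdot> k)"
      note tv = k t'[THEN ty_mono[OF v]] and nv = forces_mono[OF wle_trans[OF w' v] nR]
      note Fv = FR[OF wle_trans[OF w' v] k]
      have zv: "den v (fW \<cdot> (F \<cdot> k) \<cdot> s) = den v (Succ \<cdot> j)"
        using den_mono[OF v z] t' c tv by simp
      have "den v (fW \<cdot> n \<cdot> (Snoc \<tau> \<cdot> s \<cdot> x)) = den v (Succ \<cdot> k)"
        by (rule RN_Succ(2)[OF nv _ _ _ _ c]) (use tv in simp_all)
      moreover have "den v (fW \<cdot> (F \<cdot> k) \<cdot> (Snoc \<tau> \<cdot> s \<cdot> x)) = den v (Succ \<cdot> j)"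
        by (rule RN_Succ(2)[OF Fv _ _ _ _ zv]) (use tv in simp_all)
      ultimately show "den v (fW \<cdot> (extN \<cdot> F \<cdot> n) \<cdot> (Snoc \<tau> \<cdot> s \<cdot> x)) = den v (Succ \<cdot> j)"
        using tv by simp
    qed (use t' in simp_all)
  next
    fix w' s j g h
    assume w': "w \<sqsubseteq> w'" and ts: "ty w' s = Some (Seq \<tau>)" "ty w' j = Some N"
      and z: "den w' (fW \<cdot> (extN \<cdot> F \<cdot> n) \<cdot> s) = den w' (Succ \<cdot> j)" and tb: "ty w' g = Some GT" "ty w' h = Some HT"
    note t' = ts tb t[THEN ty_mono[OF w']]
    show "den w' (fB \<cdot> (extN \<cdot> F \<cdot> n) \<cdot> g \<cdot> h \<cdot> s) = den w' (g \<cdot> s)"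
    proof (rule den_eq_cases[of _ "fW \<cdot> n \<cdot> s" _ \<sigma>])
      fix v assume v: "w' \<sqsubseteq> v" and c: "den v (fW \<cdot> n \<cdot> s) = den v Zero"
      note tv = t'[THEN ty_mono[OF v]]
      show "den v (fB \<cdot> (extN \<cdot> F \<cdot> n) \<cdot> g \<cdot> h \<cdot> s) = den v (g \<cdot> s)"
        by (rule den_absurd[of v j _ \<sigma>]) (use den_mono[OF v z] c tv t' in simp_all)
    next
      fix v k assume v: "w' \<sqsubseteq> v" and k: "ty v k = Some N" and c: "den v (fW \<cdot> n \<cdot> s) = den v (Succ \<cdot> k)"
      note tv = k t'[THEN ty_mono[OF v]] and nv = forces_mono[OF wle_trans[OF w' v] nR]
      note Fv = FR[OF wle_trans[OF w' v] k]
      have zv: "den v (fW \<cdot> (F \<cdot> k) \<cdot> s) = den v (Succ \<cdot> j)"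
        using den_mono[OF v z] t' c tv by simp
      have "den v (fB \<cdot> n \<cdot> (en2g \<cdot> F \<cdot> n \<cdot> g \<cdot> h) \<cdot> h \<cdot> s) = den v (en2g \<cdot> F \<cdot> n \<cdot> g \<cdot> h \<cdot> s)"
        by (rule RN_Succ(3)[OF nv _ _ _ _ c]) (use tv in simp_all)
      moreover have "den v (fB \<cdot> (F \<cdot> k) \<cdot> g \<cdot> h \<cdot> s) = den v (g \<cdot> s)"
        by (rule RN_Succ(3)[OF Fv _ _ _ _ zv]) (use tv in simp_all)
      ultimately show "den v (fB \<cdot> (extN \<cdot> F \<cdot> n) \<cdot> g \<cdot> h \<cdot> s) = den v (g \<cdot> s)"
        using c tv by simp
    qed (use t' in simp_all)
  qed (use t in simp_all)
  then show ?thesis using t by (simp add: RR_def)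
qed

text \<open>\<open>F\<close> is related to \<open>f\<close> only at numbers, which \<open>E\<close> extends to all elements of \<open>st N\<close> that are related to some \<open>y\<close>.\<close>

definition ext_ok :: "ty \<Rightarrow> trm \<Rightarrow> bool" where
  "ext_ok \<rho> E \<longleftrightarrow> tyof [] E = Some ((N \<rightarrow> st \<rho>) \<rightarrow> N0 \<rightarrow> st \<rho>) \<and>
    (\<forall>w F f n y. ty w F = Some (N \<rightarrow> st \<rho>) \<longrightarrow> ty w f = Some (B \<rightarrow> N \<rightarrow> \<rho>) \<longrightarrow> RR w N n y \<longrightarrow>
      (\<forall>w' k. w \<sqsubseteq> w' \<longrightarrow> ty w' k = Some N \<longrightarrow> RR w' \<rho> (F \<cdot> k) (pw N \<rho> f (kk N k))) \<longrightarrow>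
      RR w \<rho> (E \<cdot> F \<cdot> n) (pw N \<rho> f y))"

lemma ext_okD:
  assumes "ext_ok \<rho> E" "ty w F = Some (N \<rightarrow> st \<rho>)" "ty w f = Some (B \<rightarrow> N \<rightarrow> \<rho>)" "RR w N n y"
    and "\<And>w' k. w \<sqsubseteq> w' \<Longrightarrow> ty w' k = Some N \<Longrightarrow> RR w' \<rho> (F \<cdot> k) (pw N \<rho> f (kk N k))"
  shows "RR w \<rho> (E \<cdot> F \<cdot> n) (pw N \<rho> f y)"
  using assms by (simp add: ext_ok_def)

definition extF :: "ty \<Rightarrow> ty \<Rightarrow> trm" where
  "extF \<rho> \<eta> = Lam ((N \<rightarrow> \<eta>) \<rightarrow> N0 \<rightarrow> \<eta>) (Lam (N \<rightarrow> \<rho> \<rightarrow> \<eta>) (Lam N0 (Lam \<rho> (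
     Var 3 \<cdot> (Flp N \<rho> \<eta> \<cdot> Var 2 \<cdot> Var 0) \<cdot> Var 1))))"

lemma extF_ty: "tyof [] (extF \<rho> \<eta>) = Some (((N \<rightarrow> \<eta>) \<rightarrow> N0 \<rightarrow> \<eta>) \<rightarrow> (N \<rightarrow> \<rho> \<rightarrow> \<eta>) \<rightarrow> N0 \<rightarrow> \<rho> \<rightarrow> \<eta>)"
  by (simp add: extF_def)

lemmas extF_simps [simp] = closed[OF extF_ty]
lemmas extF_app [simp] = app_lam4[OF extF_def, simplified]

definition extP :: "ty \<Rightarrow> ty \<Rightarrow> trm" where
  "extP \<rho> \<eta> = Lam ((N \<rightarrow> \<rho>) \<rightarrow> N0 \<rightarrow> \<rho>) (Lam ((N \<rightarrow> \<eta>) \<rightarrow> N0 \<rightarrow> \<eta>) (Lam (N \<rightarrow> \<rho> \<otimes> \<eta>) (Lam N0 (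
     Pair \<rho> \<eta> \<cdot> (Var 3 \<cdot> (Cmp N (\<rho> \<otimes> \<eta>) \<rho> \<cdot> Fst \<rho> \<eta> \<cdot> Var 1) \<cdot> Var 0)
      \<cdot> (Var 2 \<cdot> (Cmp N (\<rho> \<otimes> \<eta>) \<eta> \<cdot> Snd \<rho> \<eta> \<cdot> Var 1) \<cdot> Var 0)))))"

lemma extP_ty: "tyof [] (extP \<rho> \<eta>) = Some (((N \<rightarrow> \<rho>) \<rightarrow> N0 \<rightarrow> \<rho>) \<rightarrow> ((N \<rightarrow> \<eta>) \<rightarrow> N0 \<rightarrow> \<eta>) \<rightarrow> (N \<rightarrow> \<rho> \<otimes> \<eta>) \<rightarrow> N0 \<rightarrow> (\<rho> \<otimes> \<eta>))"
  by (simp add: extP_def)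

lemmas extP_simps [simp] = closed[OF extP_ty]
lemmas extP_app [simp] = app_lam4[OF extP_def, simplified]

definition pst :: "ty \<Rightarrow> ty \<Rightarrow> trm" where
  "pst \<rho> \<kappa> = Lam (\<rho> \<rightarrow> \<kappa>) (Lam (B \<rightarrow> N \<rightarrow> \<rho>) (Lam B (Lam N (
     Var 3 \<cdot> (Var 2 \<cdot> Var 1 \<cdot> Var 0)))))"

lemma pst_ty: "tyof [] (pst \<rho> \<kappa>) = Some ((\<rho> \<rightarrow> \<kappa>) \<rightarrow> (B \<rightarrow> N \<rightarrow> \<rho>) \<rightarrow> B \<rightarrow> N \<rightarrow> \<kappa>)"
  by (simp add: pst_def)

lemmas pst_simps [simp] = closed[OF pst_ty]
lemmas pst_app [simp] = app_lam4[OF pst_def, simplified]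

text \<open>The family with parameter \<open>k\<close> that remains of a family of functions once
  the argument, itself a family, has been supplied at the same infinite sequence.\<close>

definition pap :: "ty \<Rightarrow> ty \<Rightarrow> trm" where
  "pap \<rho> \<eta> = Lam (B \<rightarrow> N \<rightarrow> \<rho> \<rightarrow> \<eta>) (Lam (B \<rightarrow> \<rho>) (Lam B (Lam N (
     Var 3 \<cdot> Var 1 \<cdot> Var 0 \<cdot> (Var 2 \<cdot> Var 1)))))"

lemma pap_ty: "tyof [] (pap \<rho> \<eta>) = Some ((B \<rightarrow> N \<rightarrow> \<rho> \<rightarrow> \<eta>) \<rightarrow> (B \<rightarrow> \<rho>) \<rightarrow> B \<rightarrow> N \<rightarrow> \<eta>)"
  by (simp add: pap_def)

lemmas pap_simps [simp] = closed[OF pap_ty]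
lemmas pap_app [simp] = app_lam4[OF pap_def, simplified]


lemma ext_ok_N: "ext_ok N extN"
  unfolding ext_ok_def using extN by (simp add: extN_ty)

text \<open>For a fixed argument \<open>x\<close> the map from \<open>k\<close> to
  \<open>F k x\<close> takes values in the smaller type, so the extension at function types is
  pointwise.\<close>

lemma ext_ok_fun:
  assumes "ext_ok \<eta> E" shows "ext_ok (\<rho> \<rightarrow> \<eta>) (extF (st \<rho>) (st \<eta>) \<cdot> E)"
  unfolding ext_ok_def
proof (intro conjI allI impI)
  have E: "tyof [] E = Some ((N \<rightarrow> st \<eta>) \<rightarrow> N0 \<rightarrow> st \<eta>)" using assms by (simp add: ext_ok_def)
  note [simp] = closed[OF E]
  show "tyof [] (extF (st \<rho>) (st \<eta>) \<cdot> E) = Some ((N \<rightarrow> st (\<rho> \<rightarrow> \<eta>)) \<rightarrow> N0 \<rightarrow> st (\<rho> \<rightarrow> \<eta>))" by simp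
  fix w F f n y
  assume t: "ty w F = Some (N \<rightarrow> st (\<rho> \<rightarrow> \<eta>))" "ty w f = Some (B \<rightarrow> N \<rightarrow> \<rho> \<rightarrow> \<eta>)" and n: "RR w N n y"
    and Ff: "\<forall>w' k. w \<sqsubseteq> w' \<longrightarrow> ty w' k = Some N \<longrightarrow> RR w' (\<rho> \<rightarrow> \<eta>) (F \<cdot> k) (pw N (\<rho> \<rightarrow> \<eta>) f (kk N k))"
  note t = t[simplified] RR_ty[OF n, simplified]
  show "RR w (\<rho> \<rightarrow> \<eta>) (extF (st \<rho>) (st \<eta>) \<cdot> E \<cdot> F \<cdot> n) (pw N (\<rho> \<rightarrow> \<eta>) f y)"
  proof (rule RR_funI)
    fix w' x x' assume w': "w \<sqsubseteq> w'" and x: "RR w' \<rho> x x'"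
    note t' = t[THEN ty_mono[OF w']] RR_ty[OF x]
    have "RR w' \<eta> (E \<cdot> (Flp N (st \<rho>) (st \<eta>) \<cdot> F \<cdot> x) \<cdot> n) (pw N \<eta> (pap \<rho> \<eta> \<cdot> f \<cdot> x') y)"
    proof (rule ext_okD[OF assms])
      fix v k assume v: "w' \<sqsubseteq> v" and k: "ty v k = Some N"
      note tv = k t'[THEN ty_mono[OF v]]
      have "RR v \<eta> (F \<cdot> k \<cdot> x) (pw \<rho> \<eta> (pw N (\<rho> \<rightarrow> \<eta>) f (kk N k)) x')"
        using Ff wle_trans[OF w' v] k RR_mono[OF v x] by (blast intro: RR_funE)
      then show "RR v \<eta> (Flp N (st \<rho>) (st \<eta>) \<cdot> F \<cdot> x \<cdot> k) (pw N \<eta> (pap \<rho> \<eta> \<cdot> f \<cdot> x') (kk N k))"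
      proof (rule RR_cong)
        show "den v (F \<cdot> k \<cdot> x) = den v (Flp N (st \<rho>) (st \<eta>) \<cdot> F \<cdot> x \<cdot> k)" using tv by simp
        show "den v (pw \<rho> \<eta> (pw N (\<rho> \<rightarrow> \<eta>) f (kk N k)) x') = den v (pw N \<eta> (pap \<rho> \<eta> \<cdot> f \<cdot> x') (kk N k))"
          by (rule den_ext[where \<rho> = B and \<eta> = \<eta>]) (use tv tv[THEN ty_up] in simp_all)
      qed
    next
      show "RR w' N n y" by (rule RR_mono[OF w' n])
    qed (use t' in simp_all)
    then show "RR w' \<eta> (extF (st \<rho>) (st \<eta>) \<cdot> E \<cdot> F \<cdot> n \<cdot> x) (pw \<rho> \<eta> (pw N (\<rho> \<rightarrow> \<eta>) f y) x')"
    proof (rule RR_cong)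
      show "den w' (E \<cdot> (Flp N (st \<rho>) (st \<eta>) \<cdot> F \<cdot> x) \<cdot> n) = den w' (extF (st \<rho>) (st \<eta>) \<cdot> E \<cdot> F \<cdot> n \<cdot> x)"
        using t' by simp
      show "den w' (pw N \<eta> (pap \<rho> \<eta> \<cdot> f \<cdot> x') y) = den w' (pw \<rho> \<eta> (pw N (\<rho> \<rightarrow> \<eta>) f y) x')"
        by (rule den_ext[where \<rho> = B and \<eta> = \<eta>]) (use t' t'[THEN ty_up] in simp_all)
    qed
  qed (use t in simp_all)
qed

text \<open>Lets the family be post-composed with a closed function \<open>c\<close>. It serves the
  two projections of a product and the passage from a sequence to its code.\<close>

lemma ext_ok_post:
  assumes "ext_ok \<kappa> E" "tyof [] c = Some (\<rho> \<rightarrow> \<kappa>)"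
    and t: "ty w F = Some (N \<rightarrow> st \<kappa>)" "ty w f = Some (B \<rightarrow> N \<rightarrow> \<rho>)" and n: "RR w N n y"
    and Ff: "\<And>w' k. w \<sqsubseteq> w' \<Longrightarrow> ty w' k = Some N \<Longrightarrow> RR w' \<kappa> (F \<cdot> k) (pk \<rho> \<kappa> c (pw N \<rho> f (kk N k)))"
  shows "RR w \<kappa> (E \<cdot> F \<cdot> n) (pk \<rho> \<kappa> c (pw N \<rho> f y))"
proof -
  note [simp] = closed[OF assms(2)]
  note t = t RR_ty[OF n]
  have "RR w \<kappa> (E \<cdot> F \<cdot> n) (pw N \<kappa> (pst \<rho> \<kappa> \<cdot> c \<cdot> f) y)"
  proof (rule ext_okD[OF assms(1)])
    fix v k assume v: "w \<sqsubseteq> v" and k: "ty v k = Some N"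
    note tv = k t[THEN ty_mono[OF v]]
    show "RR v \<kappa> (F \<cdot> k) (pw N \<kappa> (pst \<rho> \<kappa> \<cdot> c \<cdot> f) (kk N k))"
      by (rule RR_cong[OF Ff[OF v k] refl], rule den_ext[where \<rho> = B and \<eta> = \<kappa>])
        (use tv tv[THEN ty_up] in simp_all)
  qed (use t n in simp_all)
  then show ?thesis
  proof (rule RR_cong[OF _ refl])
    show "den w (pw N \<kappa> (pst \<rho> \<kappa> \<cdot> c \<cdot> f) y) = den w (pk \<rho> \<kappa> c (pw N \<rho> f y))"
      by (rule den_ext[where \<rho> = B and \<eta> = \<kappa>]) (use t t[THEN ty_up] in simp_all)
  qed
qed

lemma ext_ok_prod:
  assumes "ext_ok \<rho> D" "ext_ok \<eta> E" shows "ext_ok (\<rho> \<otimes> \<eta>) (extP (st \<rho>) (st \<eta>) \<cdot> D \<cdot> E)"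
  unfolding ext_ok_def
proof (intro conjI allI impI)
  have D: "tyof [] D = Some ((N \<rightarrow> st \<rho>) \<rightarrow> N0 \<rightarrow> st \<rho>)" and E: "tyof [] E = Some ((N \<rightarrow> st \<eta>) \<rightarrow> N0 \<rightarrow> st \<eta>)"
    using assms by (simp_all add: ext_ok_def)
  note [simp] = closed[OF E] closed[OF D]
  show "tyof [] (extP (st \<rho>) (st \<eta>) \<cdot> D \<cdot> E) = Some ((N \<rightarrow> st (\<rho> \<otimes> \<eta>)) \<rightarrow> N0 \<rightarrow> st (\<rho> \<otimes> \<eta>))" by simp
  fix w F f n y
  assume t: "ty w F = Some (N \<rightarrow> st (\<rho> \<otimes> \<eta>))" "ty w f = Some (B \<rightarrow> N \<rightarrow> \<rho> \<otimes> \<eta>)" and n: "RR w N n y"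
    and Ff: "\<forall>w' k. w \<sqsubseteq> w' \<longrightarrow> ty w' k = Some N \<longrightarrow> RR w' (\<rho> \<otimes> \<eta>) (F \<cdot> k) (pw N (\<rho> \<otimes> \<eta>) f (kk N k))"
  note t = t[simplified] RR_ty[OF n, simplified]
  have Ff': "RR v \<rho> (Fst (st \<rho>) (st \<eta>) \<cdot> (F \<cdot> k)) (pk (\<rho> \<otimes> \<eta>) \<rho> (Fst \<rho> \<eta>) (pw N (\<rho> \<otimes> \<eta>) f (kk N k)))"
     "RR v \<eta> (Snd (st \<rho>) (st \<eta>) \<cdot> (F \<cdot> k)) (pk (\<rho> \<otimes> \<eta>) \<eta> (Snd \<rho> \<eta>) (pw N (\<rho> \<otimes> \<eta>) f (kk N k)))"
    if v: "w \<sqsubseteq> v" and k: "ty v k = Some N" for v k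
  proof -
    have "RR v (\<rho> \<otimes> \<eta>) (F \<cdot> k) (pw N (\<rho> \<otimes> \<eta>) f (kk N k))" using Ff v k by blast
    then show "RR v \<rho> (Fst (st \<rho>) (st \<eta>) \<cdot> (F \<cdot> k)) (pk (\<rho> \<otimes> \<eta>) \<rho> (Fst \<rho> \<eta>) (pw N (\<rho> \<otimes> \<eta>) f (kk N k)))"
      "RR v \<eta> (Snd (st \<rho>) (st \<eta>) \<cdot> (F \<cdot> k)) (pk (\<rho> \<otimes> \<eta>) \<eta> (Snd \<rho> \<eta>) (pw N (\<rho> \<otimes> \<eta>) f (kk N k)))"
      using t[THEN ty_mono[OF v]] k by (subst (asm) RR_prod; simp)+
  qed
  let ?F = "Cmp N (st \<rho> \<otimes> st \<eta>) (st \<rho>) \<cdot> Fst (st \<rho>) (st \<eta>) \<cdot> F"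
  have 1: "RR w \<rho> (D \<cdot> ?F \<cdot> n) (pk (\<rho> \<otimes> \<eta>) \<rho> (Fst \<rho> \<eta>) (pw N (\<rho> \<otimes> \<eta>) f y))"
  proof (rule ext_ok_post[OF assms(1)])
    fix v k assume v: "w \<sqsubseteq> v" and k: "ty v k = Some N"
    show "RR v \<rho> (?F \<cdot> k) (pk (\<rho> \<otimes> \<eta>) \<rho> (Fst \<rho> \<eta>) (pw N (\<rho> \<otimes> \<eta>) f (kk N k)))"
      by (rule RR_cong[OF Ff'(1)[OF v k]]) (insert k t[THEN ty_mono[OF v]], simp_all)
  qed (use t n in simp_all)
  let ?G = "Cmp N (st \<rho> \<otimes> st \<eta>) (st \<eta>) \<cdot> Snd (st \<rho>) (st \<eta>) \<cdot> F"
  have 2: "RR w \<eta> (E \<cdot> ?G \<cdot> n) (pk (\<rho> \<otimes> \<eta>) \<eta> (Snd \<rho> \<eta>) (pw N (\<rho> \<otimes> \<eta>) f y))"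
  proof (rule ext_ok_post[OF assms(2)])
    fix v k assume v: "w \<sqsubseteq> v" and k: "ty v k = Some N"
    show "RR v \<eta> (?G \<cdot> k) (pk (\<rho> \<otimes> \<eta>) \<eta> (Snd \<rho> \<eta>) (pw N (\<rho> \<otimes> \<eta>) f (kk N k)))"
      by (rule RR_cong[OF Ff'(2)[OF v k]]) (use k t[THEN ty_mono[OF v]] in simp_all)
  qed (use t n in simp_all)
  have "RR w \<rho> (Fst (st \<rho>) (st \<eta>) \<cdot> (extP (st \<rho>) (st \<eta>) \<cdot> D \<cdot> E \<cdot> F \<cdot> n)) (pk (\<rho> \<otimes> \<eta>) \<rho> (Fst \<rho> \<eta>) (pw N (\<rho> \<otimes> \<eta>) f y))"
    by (rule RR_cong[OF 1]) (use t in simp_all)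
  moreover have "RR w \<eta> (Snd (st \<rho>) (st \<eta>) \<cdot> (extP (st \<rho>) (st \<eta>) \<cdot> D \<cdot> E \<cdot> F \<cdot> n)) (pk (\<rho> \<otimes> \<eta>) \<eta> (Snd \<rho> \<eta>) (pw N (\<rho> \<otimes> \<eta>) f y))"
    by (rule RR_cong[OF 2]) (use t in simp_all)
  ultimately show "RR w (\<rho> \<otimes> \<eta>) (extP (st \<rho>) (st \<eta>) \<cdot> D \<cdot> E \<cdot> F \<cdot> n) (pw N (\<rho> \<otimes> \<eta>) f y)"
    using t by (subst RR_prod) simp_all
qed

text \<open>Translated sequences are translated codes, so the extension functional of the code type
  is reused as it stands.\<close>

lemma ext_ok_Seq:
  assumes "ext_ok (N \<otimes> (N \<rightarrow> \<rho>)) E" shows "ext_ok (Seq \<rho>) E"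
  unfolding ext_ok_def
proof (intro conjI allI impI)
  show "tyof [] E = Some ((N \<rightarrow> st (Seq \<rho>)) \<rightarrow> N0 \<rightarrow> st (Seq \<rho>))" using assms by (simp add: ext_ok_def)
  fix w F f n y
  assume t: "ty w F = Some (N \<rightarrow> st (Seq \<rho>))" "ty w f = Some (B \<rightarrow> N \<rightarrow> Seq \<rho>)" and n: "RR w N n y"
    and Ff: "\<forall>w' k. w \<sqsubseteq> w' \<longrightarrow> ty w' k = Some N \<longrightarrow> RR w' (Seq \<rho>) (F \<cdot> k) (pw N (Seq \<rho>) f (kk N k))"
  have "RR w (N \<otimes> (N \<rightarrow> \<rho>)) (E \<cdot> F \<cdot> n) (pk (Seq \<rho>) (N \<otimes> (N \<rightarrow> \<rho>)) (code \<rho>) (pw N (Seq \<rho>) f y))"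
  proof (rule ext_ok_post[OF assms])
    fix v k assume v: "w \<sqsubseteq> v" and k: "ty v k = Some N"
    show "RR v (N \<otimes> (N \<rightarrow> \<rho>)) (F \<cdot> k) (pk (Seq \<rho>) (N \<otimes> (N \<rightarrow> \<rho>)) (code \<rho>) (pw N (Seq \<rho>) f (kk N k)))"
      using Ff v k t[THEN ty_mono[OF v]] by (subst RR_Seq[symmetric]) simp_all
  qed (use t n in simp_all)
  then show "RR w (Seq \<rho>) (E \<cdot> F \<cdot> n) (pw N (Seq \<rho>) f y)"
    using t RR_ty[OF n] by (subst RR_Seq) simp_all
qed

lemma ext_ex: "\<exists>E. ext_ok \<rho> E"
  by (induction \<rho>) (blast intro: ext_ok_N ext_ok_fun ext_ok_prod ext_ok_Seq)+

end

section \<open>Rebuilding sequences from their codes\<close>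

definition tlc :: "ty \<Rightarrow> trm" where
  "tlc \<kappa> = Lam (N \<rightarrow> \<kappa>) (Lam N (Var 1 \<cdot> (Succ \<cdot> Var 0)))"

lemma tlc_ty: "tyof [] (tlc \<kappa>) = Some ((N \<rightarrow> \<kappa>) \<rightarrow> N \<rightarrow> \<kappa>)"
  by (simp add: tlc_def)

lemmas tlc_simps [simp] = closed[OF tlc_ty]
lemmas tlc_app [simp] = app_lam2[OF tlc_def, simplified]

lemma tlc_scons [simp]:
  assumes "tyv w x = Some \<kappa>" "tyv w h = Some (N \<rightarrow> \<kappa>)"
  shows "app w (den w (tlc \<kappa>)) (app w (app w (den w (scons \<kappa>)) x) h) = h"
proof -
  obtain x' h' where t: "x = den w x'" "ty w x' = Some \<kappa>" "h = den w h'" "ty w h' = Some (N \<rightarrow> \<kappa>)"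
    using assms tyvE by metis
  have "den w (tlc \<kappa> \<cdot> (scons \<kappa> \<cdot> x' \<cdot> h')) = den w h'"
    by (rule den_ext[where \<rho> = N and \<eta> = \<kappa>]) (use t(2,4) t(2,4)[THEN ty_up] in simp_all)
  then show ?thesis using t by simp
qed

text \<open>\<open>mkr k h\<close> is the sequence \<open>h (k - 1), \<dots>, h 0\<close>; thus \<open>mkr\<close> inverts \<open>code\<close>.\<close>

definition mkrs :: "ty \<Rightarrow> trm" where
  "mkrs \<kappa> = Lam N (Lam ((N \<rightarrow> \<kappa>) \<rightarrow> Seq \<kappa>) (Lam (N \<rightarrow> \<kappa>) (
     Snoc \<kappa> \<cdot> (Var 1 \<cdot> (tlc \<kappa> \<cdot> Var 0)) \<cdot> (Var 0 \<cdot> Zero))))"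

lemma mkrs_ty: "tyof [] (mkrs \<kappa>) = Some (N \<rightarrow> ((N \<rightarrow> \<kappa>) \<rightarrow> Seq \<kappa>) \<rightarrow> (N \<rightarrow> \<kappa>) \<rightarrow> (Seq \<kappa>))"
  by (simp add: mkrs_def)

lemmas mkrs_simps [simp] = closed[OF mkrs_ty]
lemmas mkrs_app [simp] = app_lam3[OF mkrs_def, simplified]

definition mkr :: "ty \<Rightarrow> trm" where
  "mkr \<kappa> = Lam N (Lam (N \<rightarrow> \<kappa>) (
     Rec ((N \<rightarrow> \<kappa>) \<rightarrow> Seq \<kappa>) \<cdot> (Kc (Seq \<kappa>) (N \<rightarrow> \<kappa>)
      \<cdot> Emp \<kappa>) \<cdot> mkrs \<kappa> \<cdot> Var 1 \<cdot> Var 0))"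

lemma mkr_ty: "tyof [] (mkr \<kappa>) = Some (N \<rightarrow> (N \<rightarrow> \<kappa>) \<rightarrow> (Seq \<kappa>))"
  by (simp add: mkr_def)

lemmas mkr_simps [simp] = closed[OF mkr_ty]
lemmas mkr_app [simp] = app_lam2[OF mkr_def, simplified]

text \<open>The step of sequence recursion on codes, a recursion on the length with the entry
  function as parameter: the last element is \<open>h 0\<close>, and the initial part has length
  \<open>k\<close> and the tail of \<open>h\<close> as its entries. The step function also wants
  this initial part as a sequence, which \<open>mkr\<close> supplies.\<close>

definition srs :: "ty \<Rightarrow> ty \<Rightarrow> trm" where
  "srs \<kappa> \<rho> = Lam (Seq \<kappa> \<rightarrow> \<kappa> \<rightarrow> \<rho> \<rightarrow> \<rho>) (Lam N (Lam ((N \<rightarrow> \<kappa>) \<rightarrow> \<rho>) (Lam (N \<rightarrow> \<kappa>) (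
     Var 3 \<cdot> (mkr \<kappa> \<cdot> Var 2 \<cdot> (tlc \<kappa> \<cdot> Var 0)) \<cdot> (Var 0
      \<cdot> Zero) \<cdot> (Var 1 \<cdot> (tlc \<kappa> \<cdot> Var 0))))))"

lemma srs_ty: "tyof [] (srs \<kappa> \<rho>) = Some ((Seq \<kappa> \<rightarrow> \<kappa> \<rightarrow> \<rho> \<rightarrow> \<rho>) \<rightarrow> N \<rightarrow> ((N \<rightarrow> \<kappa>) \<rightarrow> \<rho>) \<rightarrow> (N \<rightarrow> \<kappa>) \<rightarrow> \<rho>)"
  by (simp add: srs_def)

lemmas srs_simps [simp] = closed[OF srs_ty]
lemmas srs_app [simp] = app_lam4[OF srs_def, simplified]

definition srk :: "ty \<Rightarrow> ty \<Rightarrow> trm" where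
  "srk \<kappa> \<rho> = Lam \<rho> (Lam (Seq \<kappa> \<rightarrow> \<kappa> \<rightarrow> \<rho> \<rightarrow> \<rho>) (Lam (N \<otimes> (N \<rightarrow> \<kappa>)) (
     Rec ((N \<rightarrow> \<kappa>) \<rightarrow> \<rho>) \<cdot> (Kc \<rho> (N \<rightarrow> \<kappa>) \<cdot> Var 2) \<cdot> (srs \<kappa> \<rho>
      \<cdot> Var 1) \<cdot> (Fst N (N \<rightarrow> \<kappa>) \<cdot> Var 0) \<cdot> (Snd N (N \<rightarrow> \<kappa>) \<cdot> Var 0))))"

lemma srk_ty: "tyof [] (srk \<kappa> \<rho>) = Some (\<rho> \<rightarrow> (Seq \<kappa> \<rightarrow> \<kappa> \<rightarrow> \<rho> \<rightarrow> \<rho>) \<rightarrow> (N \<otimes> (N \<rightarrow> \<kappa>)) \<rightarrow> \<rho>)"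
  by (simp add: srk_def)

lemmas srk_simps [simp] = closed[OF srk_ty]
lemmas srk_app [simp] = app_lam3[OF srk_def, simplified]

definition snc :: "ty \<Rightarrow> trm" where
  "snc \<rho> = Lam (N \<otimes> (N \<rightarrow> \<rho>)) (Lam \<rho> (
     Pair N (N \<rightarrow> \<rho>) \<cdot> (Succ \<cdot> (Fst N (N \<rightarrow> \<rho>) \<cdot> Var 1))
      \<cdot> (scons \<rho> \<cdot> Var 0 \<cdot> (Snd N (N \<rightarrow> \<rho>) \<cdot> Var 1))))"

lemma snc_ty: "tyof [] (snc \<rho>) = Some ((N \<otimes> (N \<rightarrow> \<rho>)) \<rightarrow> \<rho> \<rightarrow> (N \<otimes> (N \<rightarrow> \<rho>)))"
  by (simp add: snc_def)

lemmas snc_simps [simp] = closed[OF snc_ty]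
lemmas snc_app [simp] = app_lam2[OF snc_def, simplified]


lemma mkr_len_rf:
  assumes "ty w s = Some (Seq \<kappa>)" shows "den w (mkr \<kappa> \<cdot> (len \<kappa> \<cdot> s) \<cdot> (rf \<kappa> \<cdot> s)) = den w s"
proof -
  have "den w (sub (inst s) (mkr \<kappa> \<cdot> (len \<kappa> \<cdot> Var 0) \<cdot> (rf \<kappa> \<cdot> Var 0))) = den w (sub (inst s) (Var 0))"
    by (rule den_seq_induct[where \<rho> = "Seq \<kappa>"]) (use assms in simp_all)
  then show ?thesis by simp
qed

lemma srk_code:
  assumes "ty w s = Some (Seq \<kappa>)" "ty w a = Some \<rho>" "ty w f = Some (Seq \<kappa> \<rightarrow> \<kappa> \<rightarrow> \<rho> \<rightarrow> \<rho>)"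
  shows "den w (srk \<kappa> \<rho> \<cdot> a \<cdot> f \<cdot> (code \<kappa> \<cdot> s)) = den w (SRec \<kappa> \<rho> \<cdot> a \<cdot> f \<cdot> s)"
proof -
  have "den w (sub (inst s) (srk \<kappa> \<rho> \<cdot> shift a \<cdot> shift f \<cdot> (code \<kappa> \<cdot> Var 0)))
    = den w (sub (inst s) (SRec \<kappa> \<rho> \<cdot> shift a \<cdot> shift f \<cdot> Var 0))"
    by (rule den_seq_induct[where \<rho> = \<rho>])
      (use assms assms[THEN ty_up] mkr_len_rf in \<open>simp_all del: mkr_app\<close>)
  then show ?thesis by simp
qed

text \<open>A derivation in the empty world uses no variables and no hypotheses, so it can be
  weakened to any world.\<close>

lemma closed_den_eq:
  assumes "den (mkw [] {}) t = den (mkw [] {}) u" "tyof [] t = Some \<rho>" "tyof [] u = Some \<rho>"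
  shows "den w t = den w u"
proof (rule den_eqI)
  have s: "ctx (mkw [] {}) = []" "hyp (mkw [] {}) = {}" by (rule mkw_simps; simp)+
  have "mkw [] {} \<tturnstile> Eq \<rho> t u" by (rule den_eqD[OF assms(1)]) (simp add: s assms)
  then have "HA [] {} (Eq \<rho> t u)" by (simp add: forces_def s)
  then have "HA (ctx w) (hyp w) (fren id (Eq \<rho> t u))" by (rule HA_ren) (simp_all add: okr_def)
  then show "w \<tturnstile> Eq \<rho> t u" by (simp add: forces_def ren_closed[OF assms(2)] ren_closed[OF assms(3)])
qed

context bar_types
begin

text \<open>Families need to agree only at each infinite sequence, by extensionality. There the
  simplifier evaluates \<open>pw\<close>, \<open>kk\<close> and \<open>pk\<close>.\<close>

lemma RR_cong':
  assumes "RR w \<rho> a b" "den w a = den w a'" "ty w b' = Some (B \<rightarrow> \<rho>)"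
    and "\<And>w' x. w \<sqsubseteq> w' \<Longrightarrow> ty w' x = Some B \<Longrightarrow> den w' (b \<cdot> x) = den w' (b' \<cdot> x)"
  shows "RR w \<rho> a' b'"
proof (rule RR_cong[OF assms(1,2)])
  show "den w b = den w b'"
    by (rule den_ext[where \<rho> = B and \<eta> = \<rho>]) (use assms RR_ty[OF assms(1)] in auto)
qed

lemma RR_funI2:
  assumes "ty w a = Some (st \<rho> \<rightarrow> st \<rho>' \<rightarrow> st \<eta>)" "ty w b = Some (B \<rightarrow> \<rho> \<rightarrow> \<rho>' \<rightarrow> \<eta>)"
    and "\<And>w' x x' y y'. w \<sqsubseteq> w' \<Longrightarrow> RR w' \<rho> x x' \<Longrightarrow> RR w' \<rho>' y y' \<Longrightarrow> RR w' \<eta> (a \<cdot> x \<cdot> y) (pw \<rho>' \<eta> (pw \<rho> (\<rho>' \<rightarrow> \<eta>) b x') y')"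
  shows "RR w (\<rho> \<rightarrow> \<rho>' \<rightarrow> \<eta>) a b"
proof (rule RR_funI)
  fix w' x x' assume w': "w \<sqsubseteq> w'" and x: "RR w' \<rho> x x'"
  show "RR w' (\<rho>' \<rightarrow> \<eta>) (a \<cdot> x) (pw \<rho> (\<rho>' \<rightarrow> \<eta>) b x')"
  proof (rule RR_funI)
    fix v y y' assume v: "w' \<sqsubseteq> v" and y: "RR v \<rho>' y y'"
    show "RR v \<eta> (a \<cdot> x \<cdot> y) (pw \<rho>' \<eta> (pw \<rho> (\<rho>' \<rightarrow> \<eta>) b x') y')"
      by (rule assms(3)[OF wle_trans[OF w' v] RR_mono[OF v x] y])
  qed (use assms(1,2)[THEN ty_mono[OF w']] RR_ty[OF x] in simp_all)
qed (use assms in simp_all)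

lemma RR_funI3:
  assumes "ty w a = Some (st \<rho> \<rightarrow> st \<rho>' \<rightarrow> st \<rho>'' \<rightarrow> st \<eta>)" "ty w b = Some (B \<rightarrow> \<rho> \<rightarrow> \<rho>' \<rightarrow> \<rho>'' \<rightarrow> \<eta>)"
    and "\<And>w' x x' y y' z z'. w \<sqsubseteq> w' \<Longrightarrow> RR w' \<rho> x x' \<Longrightarrow> RR w' \<rho>' y y' \<Longrightarrow> RR w' \<rho>'' z z' \<Longrightarrow>
      RR w' \<eta> (a \<cdot> x \<cdot> y \<cdot> z) (pw \<rho>'' \<eta> (pw \<rho>' (\<rho>'' \<rightarrow> \<eta>) (pw \<rho> (\<rho>' \<rightarrow> \<rho>'' \<rightarrow> \<eta>) b x') y') z')"
  shows "RR w (\<rho> \<rightarrow> \<rho>' \<rightarrow> \<rho>'' \<rightarrow> \<eta>) a b"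
proof (rule RR_funI2)
  fix w' x x' y y' assume w': "w \<sqsubseteq> w'" and x: "RR w' \<rho> x x'" "RR w' \<rho>' y y'"
  show "RR w' (\<rho>'' \<rightarrow> \<eta>) (a \<cdot> x \<cdot> y) (pw \<rho>' (\<rho>'' \<rightarrow> \<eta>) (pw \<rho> (\<rho>' \<rightarrow> \<rho>'' \<rightarrow> \<eta>) b x') y')"
  proof (rule RR_funI)
    fix v z z' assume v: "w' \<sqsubseteq> v" and z: "RR v \<rho>'' z z'"
    show "RR v \<eta> (a \<cdot> x \<cdot> y \<cdot> z) (pw \<rho>'' \<eta> (pw \<rho>' (\<rho>'' \<rightarrow> \<eta>) (pw \<rho> (\<rho>' \<rightarrow> \<rho>'' \<rightarrow> \<eta>) b x') y') z')"
      by (rule assms(3)[OF wle_trans[OF w' v] RR_mono[OF v x(1)] RR_mono[OF v x(2)] z])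
  qed (use assms(1,2)[THEN ty_mono[OF w']] RR_ty[OF x(1)] RR_ty[OF x(2)] in simp_all)
qed (use assms in simp_all)

subsection \<open>Realizable closed terms\<close>

text \<open>A closed term is compared with the constant family it defines, and a single closed
  realizer has to work in all worlds.\<close>

definition Rz :: "ty \<Rightarrow> trm \<Rightarrow> bool" where
  "Rz \<rho> u \<longleftrightarrow> tyof [] u = Some \<rho> \<and> (\<exists>u0. tyof [] u0 = Some (st \<rho>) \<and> (\<forall>w. RR w \<rho> u0 (kk \<rho> u)))"

lemma Rz_ty: "Rz \<rho> u \<Longrightarrow> tyof [] u = Some \<rho>"
  by (simp add: Rz_def)

lemma Rz_eq:
  assumes "Rz \<rho> u" "tyof [] u' = Some \<rho>" "\<And>w. den w u = den w u'" shows "Rz \<rho> u'"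
proof -
  obtain u0 where u0: "tyof [] u0 = Some (st \<rho>)" "\<And>w. RR w \<rho> u0 (kk \<rho> u)" using assms(1) by (auto simp: Rz_def)
  have "RR w \<rho> u0 (kk \<rho> u')" for w by (rule RR_cong[OF u0(2) refl]) (simp add: assms(3))
  then show ?thesis using u0 assms(2) by (auto simp: Rz_def)
qed

lemma Rz_App:
  assumes "Rz (\<rho> \<rightarrow> \<eta>) f" "Rz \<rho> x" shows "Rz \<eta> (f \<cdot> x)"
proof -
  obtain f0 where f0: "tyof [] f0 = Some (st (\<rho> \<rightarrow> \<eta>))" "\<And>w. RR w (\<rho> \<rightarrow> \<eta>) f0 (kk (\<rho> \<rightarrow> \<eta>) f)"
    using assms by (auto simp: Rz_def)
  obtain x0 where x0: "tyof [] x0 = Some (st \<rho>)" "\<And>w. RR w \<rho> x0 (kk \<rho> x)"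
    using assms by (auto simp: Rz_def)
  note [simp] = Rz_ty[OF assms(1), THEN tyof_closed] Rz_ty[OF assms(2), THEN tyof_closed]
  have "RR w \<eta> (f0 \<cdot> x0) (kk \<eta> (f \<cdot> x))" for w
    by (rule RR_cong'[OF RR_funE[OF f0(2) x0(2)]]) simp_all
  then show ?thesis using f0 x0 by (auto simp: Rz_def intro!: exI[of _ "f0 \<cdot> x0"])
qed

lemma Rz_K: "Rz (\<rho> \<rightarrow> \<delta> \<rightarrow> \<rho>) (Kc \<rho> \<delta>)"
proof -
  have "RR w (\<rho> \<rightarrow> \<delta> \<rightarrow> \<rho>) (Kc (st \<rho>) (st \<delta>)) (kk (\<rho> \<rightarrow> \<delta> \<rightarrow> \<rho>) (Kc \<rho> \<delta>))" for w
  proof (rule RR_funI2)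
    fix w' x x' y y' assume x: "RR w' \<rho> x x'" and y: "RR w' \<delta> y y'"
    note t = RR_ty[OF x] RR_ty[OF y]
    show "RR w' \<rho> (Kc (st \<rho>) (st \<delta>) \<cdot> x \<cdot> y) (pw \<delta> \<rho> (pw \<rho> (\<delta> \<rightarrow> \<rho>) (kk (\<rho> \<rightarrow> \<delta> \<rightarrow> \<rho>) (Kc \<rho> \<delta>)) x') y')"
      by (rule RR_cong'[OF x]) (use t t[THEN ty_up] in simp_all)
  qed simp_all
  then show ?thesis by (auto simp: Rz_def intro!: exI[of _ "Kc (st \<rho>) (st \<delta>)"])
qed

lemma Rz_I: "Rz (\<rho> \<rightarrow> \<rho>) (Ic \<rho>)"
proof -
  have "RR w (\<rho> \<rightarrow> \<rho>) (Ic (st \<rho>)) (kk (\<rho> \<rightarrow> \<rho>) (Ic \<rho>))" for w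
  proof (rule RR_funI)
    fix w' x x' assume x: "RR w' \<rho> x x'"
    note t = RR_ty[OF x]
    show "RR w' \<rho> (Ic (st \<rho>) \<cdot> x) (pw \<rho> \<rho> (kk (\<rho> \<rightarrow> \<rho>) (Ic \<rho>)) x')"
      by (rule RR_cong'[OF x]) (use t t[THEN ty_up] in simp_all)
  qed simp_all
  then show ?thesis by (auto simp: Rz_def intro!: exI[of _ "Ic (st \<rho>)"])
qed

lemma Rz_S: "Rz ((\<delta> \<rightarrow> \<rho> \<rightarrow> \<eta>) \<rightarrow> (\<delta> \<rightarrow> \<rho>) \<rightarrow> \<delta> \<rightarrow> \<eta>) (Sc \<delta> \<rho> \<eta>)"
proof -
  let ?t = "(\<delta> \<rightarrow> \<rho> \<rightarrow> \<eta>) \<rightarrow> (\<delta> \<rightarrow> \<rho>) \<rightarrow> \<delta> \<rightarrow> \<eta>"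
  have "RR w ?t (Sc (st \<delta>) (st \<rho>) (st \<eta>)) (kk ?t (Sc \<delta> \<rho> \<eta>))" for w
  proof (rule RR_funI3)
    fix w' x x' y y' z z' assume x: "RR w' (\<delta> \<rightarrow> \<rho> \<rightarrow> \<eta>) x x'" and y: "RR w' (\<delta> \<rightarrow> \<rho>) y y'" and z: "RR w' \<delta> z z'"
    note t = RR_ty[OF x, simplified] RR_ty[OF y, simplified] RR_ty[OF z]
    show "RR w' \<eta> (Sc (st \<delta>) (st \<rho>) (st \<eta>) \<cdot> x \<cdot> y \<cdot> z)
      (pw \<delta> \<eta> (pw (\<delta> \<rightarrow> \<rho>) (\<delta> \<rightarrow> \<eta>) (pw (\<delta> \<rightarrow> \<rho> \<rightarrow> \<eta>) ((\<delta> \<rightarrow> \<rho>) \<rightarrow> \<delta> \<rightarrow> \<eta>) (kk ?t (Sc \<delta> \<rho> \<eta>)) x') y') z')"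
      by (rule RR_cong'[OF RR_funE[OF RR_funE[OF x z] RR_funE[OF y z]]]) (use t t[THEN ty_up] in simp_all)
  qed simp_all
  then show ?thesis by (auto simp: Rz_def intro!: exI[of _ "Sc (st \<delta>) (st \<rho>) (st \<eta>)"])
qed

text \<open>
  Open terms are avoided in the logical relation: by bracket abstraction each term built from
  realizable atoms (\<open>gd\<close>) equals a lambda-free one (\<open>cl\<close>), and realizability is closed under application.
\<close>

inductive cl :: "ty list \<Rightarrow> ty \<Rightarrow> trm \<Rightarrow> bool" where
  cl_Var: "i < length \<Gamma> \<Longrightarrow> cl \<Gamma> (\<Gamma> ! i) (Var i)"
| cl_App: "cl \<Gamma> (\<rho> \<rightarrow> \<eta>) t \<Longrightarrow> cl \<Gamma> \<rho> u \<Longrightarrow> cl \<Gamma> \<eta> (t \<cdot> u)"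
| cl_Rz: "Rz \<rho> c \<Longrightarrow> cl \<Gamma> \<rho> c"

inductive gd :: "trm \<Rightarrow> bool" where
  gd_Var: "gd (Var i)"
| gd_App: "gd t \<Longrightarrow> gd u \<Longrightarrow> gd (t \<cdot> u)"
| gd_Lam: "gd t \<Longrightarrow> gd (Lam \<rho> t)"
| gd_Rz: "Rz \<rho> c \<Longrightarrow> gd c"

lemma cl_ty: "cl \<Gamma> \<rho> u \<Longrightarrow> tyof \<Gamma> u = Some \<rho>"
  by (induction rule: cl.induct) (simp_all add: Rz_ty[THEN tyof_closed])

text \<open>Bracket abstraction with \<open>Ic\<close>, \<open>Kc\<close> and \<open>Sc\<close>. The
  abstracted variable stands at the head of the context, where the binders of the calculus put
  it.\<close>

lemma cl_abs:
  "cl \<Gamma>' \<eta> u \<Longrightarrow> \<Gamma>' = \<rho> # \<Gamma> \<Longrightarrow> \<exists>v. cl \<Gamma> (\<rho> \<rightarrow> \<eta>) v \<and> (\<forall>w. ctx w = \<rho> # \<Gamma> \<longrightarrow> den w (shift v \<cdot> Var 0) = den w u)"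
proof (induction rule: cl.induct)
  case (cl_Var i \<Gamma>')
  show ?case
  proof (cases i)
    case 0
    then show ?thesis using cl_Var by (intro exI[of _ "Ic \<rho>"]) (simp add: cl_Rz Rz_I)
  next
    case (Suc j)
    then have "cl \<Gamma> (\<rho> \<rightarrow> \<Gamma> ! j) (Kc (\<Gamma> ! j) \<rho> \<cdot> Var j)"
      using cl_Var by (intro cl_App[OF cl_Rz[OF Rz_K] cl.cl_Var]) simp
    then show ?thesis using cl_Var Suc by (intro exI[of _ "Kc (\<Gamma> ! j) \<rho> \<cdot> Var j"]) simp
  qed
next
  case (cl_App \<Gamma>' \<kappa> \<eta> t u)
  then obtain v1 v2 where v: "cl \<Gamma> (\<rho> \<rightarrow> \<kappa> \<rightarrow> \<eta>) v1" "\<forall>w. ctx w = \<rho> # \<Gamma> \<longrightarrow> den w (shift v1 \<cdot> Var 0) = den w t"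
      "cl \<Gamma> (\<rho> \<rightarrow> \<kappa>) v2" "\<forall>w. ctx w = \<rho> # \<Gamma> \<longrightarrow> den w (shift v2 \<cdot> Var 0) = den w u"
    by auto
  have "cl \<Gamma> (\<rho> \<rightarrow> \<eta>) (Sc \<rho> \<kappa> \<eta> \<cdot> v1 \<cdot> v2)" using v(1,3) by (meson cl.cl_App cl_Rz Rz_S)
  moreover have "den w (shift (Sc \<rho> \<kappa> \<eta> \<cdot> v1 \<cdot> v2) \<cdot> Var 0) = den w (t \<cdot> u)" if "ctx w = \<rho> # \<Gamma>" for w
    using v that cl_ty[OF v(1)] cl_ty[OF v(3)] by simp
  ultimately show ?case by blast
next
  case (cl_Rz \<eta> c \<Gamma>')
  have "cl \<Gamma> (\<rho> \<rightarrow> \<eta>) (Kc \<eta> \<rho> \<cdot> c)" using cl_Rz by (meson cl.intros Rz_K)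
  moreover have "den w (shift (Kc \<eta> \<rho> \<cdot> c) \<cdot> Var 0) = den w c" if "ctx w = \<rho> # \<Gamma>" for w
    using that Rz_ty[OF cl_Rz(1), THEN tyof_closed] Rz_ty[OF cl_Rz(1), THEN ren_closed] by simp
  ultimately show ?case by blast
qed

text \<open>An abstraction is replaced through extensionality: \<open>cl_abs\<close> makes the two
  functions agree at the bound variable.\<close>

lemma gd_cl: "gd t \<Longrightarrow> tyof \<Gamma> t = Some \<rho> \<Longrightarrow> \<exists>u. cl \<Gamma> \<rho> u \<and> (\<forall>w. ctx w = \<Gamma> \<longrightarrow> den w t = den w u)"
proof (induction arbitrary: \<Gamma> \<rho> rule: gd.induct)
  case (gd_Var i)
  then show ?case by (intro exI[of _ "Var i"]) (auto split: if_splits intro: cl_Var)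
next
  case (gd_App t u)
  then obtain \<kappa> where k: "tyof \<Gamma> t = Some (\<kappa> \<rightarrow> \<rho>)" "tyof \<Gamma> u = Some \<kappa>" by (auto simp: appt_Some)
  obtain t' where "cl \<Gamma> (\<kappa> \<rightarrow> \<rho>) t'" "\<forall>w. ctx w = \<Gamma> \<longrightarrow> den w t = den w t'" using gd_App.IH(1)[OF k(1)] by blast
  moreover obtain u' where "cl \<Gamma> \<kappa> u'" "\<forall>w. ctx w = \<Gamma> \<longrightarrow> den w u = den w u'" using gd_App.IH(2)[OF k(2)] by blast
  ultimately show ?case by (intro exI[of _ "t' \<cdot> u'"]) (auto intro: cl_App)
next
  case (gd_Lam t \<kappa>)
  then obtain \<eta> where e: "tyof (\<kappa> # \<Gamma>) t = Some \<eta>" "\<rho> = \<kappa> \<rightarrow> \<eta>" by auto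
  obtain u where u: "cl (\<kappa> # \<Gamma>) \<eta> u" "\<forall>w. ctx w = \<kappa> # \<Gamma> \<longrightarrow> den w t = den w u" using gd_Lam.IH[OF e(1)] by blast
  obtain v where v: "cl \<Gamma> (\<kappa> \<rightarrow> \<eta>) v" "\<forall>w. ctx w = \<kappa> # \<Gamma> \<longrightarrow> den w (shift v \<cdot> Var 0) = den w u"
    using cl_abs[OF u(1) refl] by blast
  have "den w (Lam \<kappa> t) = den w v" if w: "ctx w = \<Gamma>" for w
  proof (rule den_eqI)
    \<comment> \<open>The world under the binder has the new variable at the head and shifted
      hypotheses, as \<open>HA.AllI\<close> demands; in general it is not an extension of
      \<open>w\<close> in the order on worlds.\<close>
    have "wff (\<kappa> # \<Gamma>) A" if "A \<in> fshift ` hyp w" for A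
      using that hyp_wff[of _ w] w by (auto intro: okr_wff simp: okr_def)
    from mkw_simps[OF this] have w': "ctx (mkw (\<kappa> # \<Gamma>) (fshift ` hyp w)) = \<kappa> # \<Gamma>"
      "hyp (mkw (\<kappa> # \<Gamma>) (fshift ` hyp w)) = fshift ` hyp w" by blast+
    let ?w = "mkw (\<kappa> # \<Gamma>) (fshift ` hyp w)"
    have up: "tyof (\<kappa> # \<kappa> # \<Gamma>) (ren (upr Suc) t) = Some \<eta>"
      by (rule okr_ty[OF _ e(1)]) (auto simp: okr_def less_Suc_eq_0_disj)
    have "sub (inst (Var 0)) (ren (upr Suc) t) = sub Var t"
      unfolding sub_ren by (rule arg_cong2[of _ _ _ _ sub]) (auto split: nat.splits)
    then have "den ?w (shift (Lam \<kappa> t) \<cdot> Var 0) = den ?w t"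
      using den_Beta[of \<kappa> ?w "ren (upr Suc) t" \<eta> "Var 0"] up by (simp add: w' sub_Var del: den_App)
    also have "\<dots> = den ?w (shift v \<cdot> Var 0)" using u(2) v(2) w' by metis
    finally have "?w \<tturnstile> Eq \<eta> (shift (Lam \<kappa> t) \<cdot> Var 0) (shift v \<cdot> Var 0)"
      by (rule den_eqD) (use up in \<open>simp add: w'\<close>)
    then have "HA (ctx w) (hyp w) (All \<kappa> (Eq \<eta> (shift (Lam \<kappa> t) \<cdot> Var 0) (shift v \<cdot> Var 0)))"
      unfolding forces_def w' w by (rule HA.AllI)
    then show "w \<tturnstile> Eq (\<kappa> \<rightarrow> \<eta>) (Lam \<kappa> t) v"
      unfolding forces_def using e cl_ty[OF v(1)] w by (intro HA.Ext) (simp_all add: wt_iff)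
  qed
  then show ?case using v(1) e(2) by blast
next
  case (gd_Rz \<kappa> c)
  then have "\<rho> = \<kappa>" using Rz_ty[THEN tyof_closed, of \<kappa> c \<Gamma>] by simp
  then show ?case using gd_Rz by (blast intro: cl_Rz)
qed

lemma cl_closed: "cl \<Gamma> \<rho> u \<Longrightarrow> \<Gamma> = [] \<Longrightarrow> Rz \<rho> u"
  by (induction rule: cl.induct) (auto intro: Rz_App)

text \<open>\<open>gd_cl\<close> compares the two terms in worlds with empty context only;
  \<open>closed_den_eq\<close> carries the equation to all others.\<close>

lemma gd_closed:
  assumes "gd t" "tyof [] t = Some \<rho>" shows "Rz \<rho> t"
proof -
  obtain u where u: "cl [] \<rho> u" "\<forall>w. ctx w = [] \<longrightarrow> den w t = den w u" using gd_cl[OF assms] by blast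
  have "ctx (mkw [] {}) = []" by (rule mkw_simps) simp
  then have "den (mkw [] {}) u = den (mkw [] {}) t" using u(2) by simp
  then have "den w u = den w t" for w by (rule closed_den_eq[OF _ cl_ty[OF u(1)] assms(2)])
  with cl_closed[OF u(1) refl] assms(2) show ?thesis by (rule Rz_eq)
qed

subsection \<open>Constants\<close>

definition etaW :: "trm" where
  "etaW = Lam N (Lam (Seq \<tau>) (Succ \<cdot> Var 1))"

lemma etaW_ty: "tyof [] etaW = Some (N \<rightarrow> (Seq \<tau>) \<rightarrow> N)"
  by (simp add: etaW_def)

lemmas etaW_simps [simp] = closed[OF etaW_ty]
lemmas etaW_app [simp] = app_lam2[OF etaW_def, simplified]

definition etaB :: "trm" where
  "etaB = Lam GT (Lam HT (Lam (Seq \<tau>) (Var 2 \<cdot> Var 0)))"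

lemma etaB_ty: "tyof [] etaB = Some (GT \<rightarrow> HT \<rightarrow> (Seq \<tau>) \<rightarrow> \<sigma>)"
  by (simp add: etaB_def)

lemmas etaB_simps [simp] = closed[OF etaB_ty]
lemmas etaB_app [simp] = app_lam3[OF etaB_def, simplified]

text \<open>The constant family \<open>k\<close> as a translated number: every sequence secures it,
  and its recursor stops at once.\<close>

definition eta :: "trm" where
  "eta = Lam N (Pair WT BT \<cdot> (etaW \<cdot> Var 0) \<cdot> etaB)"

lemma eta_ty: "tyof [] eta = Some (N \<rightarrow> N0)"
  by (simp add: eta_def)

lemmas eta_simps [simp] = closed[OF eta_ty]
lemmas eta_app [simp] = app_lam1[OF eta_def, simplified]


lemma RR_eta:
  assumes "ty w k = Some N" shows "RR w N (eta \<cdot> k) (kk N k)"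
proof -
  have "w \<tturnstile> RN (eta \<cdot> k) (kk N k)"
  proof (rule RN_I)
    fix w' s g h assume *: "w \<sqsubseteq> w'" "ty w' s = Some (Seq \<tau>)" "ty w' g = Some GT" "ty w' h = Some HT"
      and z: "den w' (fW \<cdot> (eta \<cdot> k) \<cdot> s) = den w' Zero"
    note t = ty_mono[OF *(1) assms] *(2-4)
    show "den w' (fB \<cdot> (eta \<cdot> k) \<cdot> g \<cdot> h \<cdot> s) = den w' (h \<cdot> s \<cdot> (nxt \<cdot> (fB \<cdot> (eta \<cdot> k) \<cdot> g \<cdot> h) \<cdot> s))"
      by (rule den_absurd[of w' k _ \<sigma>]) (use z t in simp_all)
  next
    fix w' s j b assume *: "w \<sqsubseteq> w'" "ty w' s = Some (Seq \<tau>)" "ty w' j = Some N" "ty w' b = Some B"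
      and z: "den w' (fW \<cdot> (eta \<cdot> k) \<cdot> s) = den w' (Succ \<cdot> j)"
    note t = ty_mono[OF *(1) assms] *(2-4)
    have "den w' k = den w' j" by (rule den_Succ_inj) (use z t in simp_all)
    then show "den w' (kk N k \<cdot> (prepend \<tau> \<cdot> s \<cdot> b)) = den w' j" using t by simp
  next
    fix w' s j x assume *: "w \<sqsubseteq> w'" "ty w' s = Some (Seq \<tau>)" "ty w' j = Some N" "ty w' x = Some \<tau>"
      and z: "den w' (fW \<cdot> (eta \<cdot> k) \<cdot> s) = den w' (Succ \<cdot> j)"
    note t = ty_mono[OF *(1) assms] *(2-4)
    show "den w' (fW \<cdot> (eta \<cdot> k) \<cdot> (Snoc \<tau> \<cdot> s \<cdot> x)) = den w' (Succ \<cdot> j)" using z t by simp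
  next
    fix w' s j g h assume *: "w \<sqsubseteq> w'" "ty w' s = Some (Seq \<tau>)" "ty w' j = Some N" "ty w' g = Some GT" "ty w' h = Some HT"
    note t = ty_mono[OF *(1) assms] *(2-5)
    show "den w' (fB \<cdot> (eta \<cdot> k) \<cdot> g \<cdot> h \<cdot> s) = den w' (g \<cdot> s)" using t by simp
  qed (use assms in simp_all)
  then show ?thesis using assms by (simp add: RR_def)
qed

lemma Rz_Zero: "Rz N Zero"
proof -
  have "RR w N (eta \<cdot> Zero) (kk N Zero)" for w by (rule RR_eta) simp
  then show ?thesis by (auto simp: Rz_def intro!: exI[of _ "eta \<cdot> Zero"])
qed

lemma Rz_Succ: "Rz (N \<rightarrow> N) Succ"
proof -
  let ?F = "Cmp N N N0 \<cdot> eta \<cdot> Succ"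
  have "RR w (N \<rightarrow> N) (extN \<cdot> ?F) (kk (N \<rightarrow> N) Succ)" for w
  proof (rule RR_funI)
    fix w' n y assume n: "RR w' N n y"
    show "RR w' N (extN \<cdot> ?F \<cdot> n) (pw N N (kk (N \<rightarrow> N) Succ) y)"
    proof (rule extN[OF _ _ n])
      fix v k assume k: "ty v k = Some N"
      have "RR v N (eta \<cdot> (Succ \<cdot> k)) (kk N (Succ \<cdot> k))" by (rule RR_eta) (use k in simp)
      then show "RR v N (?F \<cdot> k) (pw N N (kk (N \<rightarrow> N) Succ) (kk N k))"
        by (rule RR_cong') (use k k[THEN ty_up] in simp_all)
    qed simp_all
  qed simp_all
  then show ?thesis by (auto simp: Rz_def intro!: exI[of _ "extN \<cdot> ?F"])
qed

text \<open>Recursion runs on true numbers, which \<open>eta\<close> feeds to the translated step.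
  The result, a function of a true number, is then extended to translated numbers.\<close>

definition rec0 :: "ty \<Rightarrow> trm" where
  "rec0 \<rho> = Lam ((N \<rightarrow> \<rho>) \<rightarrow> N0 \<rightarrow> \<rho>) (Lam \<rho> (Lam (N0 \<rightarrow> \<rho> \<rightarrow> \<rho>) (Lam N0 (
     Var 3 \<cdot> (Rec \<rho> \<cdot> Var 2 \<cdot> (Cmp N N0 (\<rho> \<rightarrow> \<rho>)
      \<cdot> Var 1 \<cdot> eta)) \<cdot> Var 0))))"

lemma rec0_ty: "tyof [] (rec0 \<rho>) = Some (((N \<rightarrow> \<rho>) \<rightarrow> N0 \<rightarrow> \<rho>) \<rightarrow> \<rho> \<rightarrow> (N0 \<rightarrow> \<rho> \<rightarrow> \<rho>) \<rightarrow> N0 \<rightarrow> \<rho>)"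
  by (simp add: rec0_def)

lemmas rec0_simps [simp] = closed[OF rec0_ty]
lemmas rec0_app [simp] = app_lam4[OF rec0_def, simplified]

definition rcf :: "ty \<Rightarrow> trm" where
  "rcf \<rho> = Lam (B \<rightarrow> \<rho>) (Lam (B \<rightarrow> N \<rightarrow> \<rho> \<rightarrow> \<rho>) (Lam B (Lam N (
     Rec \<rho> \<cdot> (Var 3 \<cdot> Var 1) \<cdot> (Var 2 \<cdot> Var 1) \<cdot> Var 0))))"

lemma rcf_ty: "tyof [] (rcf \<rho>) = Some ((B \<rightarrow> \<rho>) \<rightarrow> (B \<rightarrow> N \<rightarrow> \<rho> \<rightarrow> \<rho>) \<rightarrow> B \<rightarrow> N \<rightarrow> \<rho>)"
  by (simp add: rcf_def)

lemmas rcf_simps [simp] = closed[OF rcf_ty]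
lemmas rcf_app [simp] = app_lam4[OF rcf_def, simplified]


lemma Rz_Rec: "Rz (\<rho> \<rightarrow> (N \<rightarrow> \<rho> \<rightarrow> \<rho>) \<rightarrow> N \<rightarrow> \<rho>) (Rec \<rho>)"
proof -
  obtain E where E: "ext_ok \<rho> E" using ext_ex by blast
  then have "tyof [] E = Some ((N \<rightarrow> st \<rho>) \<rightarrow> N0 \<rightarrow> st \<rho>)" by (simp add: ext_ok_def)
  note [simp] = closed[OF this]
  let ?t = "\<rho> \<rightarrow> (N \<rightarrow> \<rho> \<rightarrow> \<rho>) \<rightarrow> N \<rightarrow> \<rho>"
  have "RR w ?t (rec0 (st \<rho>) \<cdot> E) (kk ?t (Rec \<rho>))" for w
  proof (rule RR_funI3)
    fix w' a a' f f' n n' assume a: "RR w' \<rho> a a'" and f: "RR w' (N \<rightarrow> \<rho> \<rightarrow> \<rho>) f f'" and n: "RR w' N n n'"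
    note t = RR_ty[OF a] RR_ty[OF f, simplified] RR_ty[OF n, simplified]
    let ?F = "Rec (st \<rho>) \<cdot> a \<cdot> (Cmp N N0 (st \<rho> \<rightarrow> st \<rho>) \<cdot> f \<cdot> eta)"
    have "RR w' \<rho> (E \<cdot> ?F \<cdot> n) (pw N \<rho> (rcf \<rho> \<cdot> a' \<cdot> f') n')"
    proof (rule ext_okD[OF E _ _ n])
      fix v k assume v: "w' \<sqsubseteq> v" and k: "ty v k = Some N"
      note tv = t[THEN ty_mono[OF v]]
      \<comment> \<open>The induction takes place inside the calculus, so the relation at
        \<open>k\<close> is written as a formula with \<open>Var 0\<close> for
        \<open>k\<close>.\<close>
      have "v \<tturnstile> fsub (inst k) (R \<rho> (shift ?F \<cdot> Var 0) (pw N \<rho> (shift (rcf \<rho> \<cdot> a' \<cdot> f')) (kk N (Var 0))))"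
      proof (rule forces_nat_induct)
        have "RR v \<rho> (?F \<cdot> Zero) (pw N \<rho> (rcf \<rho> \<cdot> a' \<cdot> f') (kk N Zero))"
          by (rule RR_cong'[OF RR_mono[OF v a]]) (use tv tv[THEN ty_up] in simp_all)
        then show "v \<tturnstile> fsub (inst Zero) (R \<rho> (shift ?F \<cdot> Var 0) (pw N \<rho> (shift (rcf \<rho> \<cdot> a' \<cdot> f')) (kk N (Var 0))))"
          by (simp add: RR_def)
      next
        fix u m assume u: "v \<sqsubseteq> u" and m: "ty u m = Some N"
          and IH: "u \<tturnstile> fsub (inst m) (R \<rho> (shift ?F \<cdot> Var 0) (pw N \<rho> (shift (rcf \<rho> \<cdot> a' \<cdot> f')) (kk N (Var 0))))"
        note tu = m tv[THEN ty_mono[OF u]]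
        have "RR u \<rho> (?F \<cdot> m) (pw N \<rho> (rcf \<rho> \<cdot> a' \<cdot> f') (kk N m))" using IH tu by (simp add: RR_def)
        then have "RR u \<rho> (f \<cdot> (eta \<cdot> m) \<cdot> (?F \<cdot> m)) (pw \<rho> \<rho> (pw N (\<rho> \<rightarrow> \<rho>) f' (kk N m)) (pw N \<rho> (rcf \<rho> \<cdot> a' \<cdot> f') (kk N m)))"
          by (rule RR_funE[OF RR_funE[OF RR_mono[OF wle_trans[OF v u] f] RR_eta[OF m]]])
        then have "RR u \<rho> (?F \<cdot> (Succ \<cdot> m)) (pw N \<rho> (rcf \<rho> \<cdot> a' \<cdot> f') (kk N (Succ \<cdot> m)))"
          by (rule RR_cong') (use tu tu[THEN ty_up] in simp_all)
        then show "u \<tturnstile> fsub (inst (Succ \<cdot> m)) (R \<rho> (shift ?F \<cdot> Var 0) (pw N \<rho> (shift (rcf \<rho> \<cdot> a' \<cdot> f')) (kk N (Var 0))))"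
          by (simp add: RR_def)
      qed (use tv k in simp_all)
      then show "RR v \<rho> (?F \<cdot> k) (pw N \<rho> (rcf \<rho> \<cdot> a' \<cdot> f') (kk N k))" using tv k by (simp add: RR_def)
    qed (use t in simp_all)
    then show "RR w' \<rho> (rec0 (st \<rho>) \<cdot> E \<cdot> a \<cdot> f \<cdot> n)
      (pw N \<rho> (pw (N \<rightarrow> \<rho> \<rightarrow> \<rho>) (N \<rightarrow> \<rho>) (pw \<rho> ((N \<rightarrow> \<rho> \<rightarrow> \<rho>) \<rightarrow> N \<rightarrow> \<rho>) (kk ?t (Rec \<rho>)) a') f') n')"
      by (rule RR_cong') (use t t[THEN ty_up] in simp_all)
  qed simp_all
  then show ?thesis by (auto simp: Rz_def intro!: exI[of _ "rec0 (st \<rho>) \<cdot> E"])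
qed

lemma Rz_Pair: "Rz (\<rho> \<rightarrow> \<eta> \<rightarrow> \<rho> \<otimes> \<eta>) (Pair \<rho> \<eta>)"
proof -
  let ?t = "\<rho> \<rightarrow> \<eta> \<rightarrow> \<rho> \<otimes> \<eta>"
  have "RR w ?t (Pair (st \<rho>) (st \<eta>)) (kk ?t (Pair \<rho> \<eta>))" for w
  proof (rule RR_funI2)
    fix w' x x' y y' assume x: "RR w' \<rho> x x'" and y: "RR w' \<eta> y y'"
    note t = RR_ty[OF x] RR_ty[OF y]
    show "RR w' (\<rho> \<otimes> \<eta>) (Pair (st \<rho>) (st \<eta>) \<cdot> x \<cdot> y) (pw \<eta> (\<rho> \<otimes> \<eta>) (pw \<rho> (\<eta> \<rightarrow> \<rho> \<otimes> \<eta>) (kk ?t (Pair \<rho> \<eta>)) x') y')"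
    proof (subst RR_prod)
      show "RR w' \<rho> (Fst (st \<rho>) (st \<eta>) \<cdot> (Pair (st \<rho>) (st \<eta>) \<cdot> x \<cdot> y))
          (pk (\<rho> \<otimes> \<eta>) \<rho> (Fst \<rho> \<eta>) (pw \<eta> (\<rho> \<otimes> \<eta>) (pw \<rho> (\<eta> \<rightarrow> \<rho> \<otimes> \<eta>) (kk ?t (Pair \<rho> \<eta>)) x') y'))
        \<and> RR w' \<eta> (Snd (st \<rho>) (st \<eta>) \<cdot> (Pair (st \<rho>) (st \<eta>) \<cdot> x \<cdot> y))
          (pk (\<rho> \<otimes> \<eta>) \<eta> (Snd \<rho> \<eta>) (pw \<eta> (\<rho> \<otimes> \<eta>) (pw \<rho> (\<eta> \<rightarrow> \<rho> \<otimes> \<eta>) (kk ?t (Pair \<rho> \<eta>)) x') y'))"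
      proof (rule conjI)
        show "RR w' \<rho> (Fst (st \<rho>) (st \<eta>) \<cdot> (Pair (st \<rho>) (st \<eta>) \<cdot> x \<cdot> y))
          (pk (\<rho> \<otimes> \<eta>) \<rho> (Fst \<rho> \<eta>) (pw \<eta> (\<rho> \<otimes> \<eta>) (pw \<rho> (\<eta> \<rightarrow> \<rho> \<otimes> \<eta>) (kk ?t (Pair \<rho> \<eta>)) x') y'))"
          by (rule RR_cong'[OF x]) (use t t[THEN ty_up] in simp_all)
        show "RR w' \<eta> (Snd (st \<rho>) (st \<eta>) \<cdot> (Pair (st \<rho>) (st \<eta>) \<cdot> x \<cdot> y))
          (pk (\<rho> \<otimes> \<eta>) \<eta> (Snd \<rho> \<eta>) (pw \<eta> (\<rho> \<otimes> \<eta>) (pw \<rho> (\<eta> \<rightarrow> \<rho> \<otimes> \<eta>) (kk ?t (Pair \<rho> \<eta>)) x') y'))"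
          by (rule RR_cong'[OF y]) (use t t[THEN ty_up] in simp_all)
      qed
    qed (use t in simp_all)
  qed simp_all
  then show ?thesis by (auto simp: Rz_def intro!: exI[of _ "Pair (st \<rho>) (st \<eta>)"])
qed

lemma Rz_Fst: "Rz (\<rho> \<otimes> \<eta> \<rightarrow> \<rho>) (Fst \<rho> \<eta>)"
proof -
  have "RR w (\<rho> \<otimes> \<eta> \<rightarrow> \<rho>) (Fst (st \<rho>) (st \<eta>)) (kk (\<rho> \<otimes> \<eta> \<rightarrow> \<rho>) (Fst \<rho> \<eta>))" for w
  proof (rule RR_funI)
    fix w' x y assume x: "RR w' (\<rho> \<otimes> \<eta>) x y"
    then show "RR w' \<rho> (Fst (st \<rho>) (st \<eta>) \<cdot> x) (pk (\<rho> \<otimes> \<eta>) \<rho> (Fst \<rho> \<eta>) y)"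
      using RR_prod RR_ty[OF x] by simp
  qed simp_all
  then show ?thesis by (auto simp: Rz_def intro!: exI[of _ "Fst (st \<rho>) (st \<eta>)"])
qed

lemma Rz_Snd: "Rz (\<rho> \<otimes> \<eta> \<rightarrow> \<eta>) (Snd \<rho> \<eta>)"
proof -
  have "RR w (\<rho> \<otimes> \<eta> \<rightarrow> \<eta>) (Snd (st \<rho>) (st \<eta>)) (kk (\<rho> \<otimes> \<eta> \<rightarrow> \<eta>) (Snd \<rho> \<eta>))" for w
  proof (rule RR_funI)
    fix w' x y assume x: "RR w' (\<rho> \<otimes> \<eta>) x y"
    then show "RR w' \<eta> (Snd (st \<rho>) (st \<eta>) \<cdot> x) (pk (\<rho> \<otimes> \<eta>) \<eta> (Snd \<rho> \<eta>) y)"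
      using RR_prod RR_ty[OF x] by simp
  qed simp_all
  then show ?thesis by (auto simp: Rz_def intro!: exI[of _ "Snd (st \<rho>) (st \<eta>)"])
qed

text \<open>The code of the empty sequence has zeros as entries, so its realizer contains one for
  \<open>zero \<rho>\<close>. \<open>Rz_zero\<close> provides that by induction on the type and uses
  this lemma at sequence types.\<close>

lemma Rz_Emp:
  assumes "Rz \<rho> (zero \<rho>)" shows "Rz (Seq \<rho>) (Emp \<rho>)"
proof -
  let ?\<kappa> = "N \<otimes> (N \<rightarrow> \<rho>)"
  have "Rz ?\<kappa> (Pair N (N \<rightarrow> \<rho>) \<cdot> Zero \<cdot> (Kc \<rho> N \<cdot> zero \<rho>))"
    by (rule Rz_App[OF Rz_App[OF Rz_Pair Rz_Zero] Rz_App[OF Rz_K assms]])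
  then obtain u where u: "tyof [] u = Some (st ?\<kappa>)"
    "\<And>w. RR w ?\<kappa> u (kk ?\<kappa> (Pair N (N \<rightarrow> \<rho>) \<cdot> Zero \<cdot> (Kc \<rho> N \<cdot> zero \<rho>)))" by (auto simp: Rz_def)
  have "RR w (Seq \<rho>) u (kk (Seq \<rho>) (Emp \<rho>))" for w
  proof (subst RR_Seq)
    show "RR w ?\<kappa> u (pk (Seq \<rho>) ?\<kappa> (code \<rho>) (kk (Seq \<rho>) (Emp \<rho>)))"
      by (rule RR_cong'[OF u(2)]) simp_all
  qed simp
  then show ?thesis using u by (auto simp: Rz_def)
qed

lemma Rz_zero: "Rz \<rho> (zero \<rho>)"
proof (induction \<rho>)
  case (Fun \<rho> \<eta>)
  show ?case by (rule gd_closed) (use Fun in \<open>auto intro: gd.intros\<close>)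
next
  case (Prod \<rho> \<eta>)
  then show ?case by (simp add: Rz_App[OF Rz_App[OF Rz_Pair]])
qed (simp_all add: Rz_Zero Rz_Emp)

lemmas gd_const [simp, intro] = gd_Var gd_App gd_Lam Rz_Zero[THEN gd_Rz] Rz_Succ[THEN gd_Rz] Rz_Rec[THEN gd_Rz]
  Rz_Pair[THEN gd_Rz] Rz_Fst[THEN gd_Rz] Rz_Snd[THEN gd_Rz] Rz_zero[THEN Rz_Emp, THEN gd_Rz]
  Rz_K[THEN gd_Rz]

lemma Rz_snc: "Rz (N \<otimes> (N \<rightarrow> \<rho>) \<rightarrow> \<rho> \<rightarrow> N \<otimes> (N \<rightarrow> \<rho>)) (snc \<rho>)"
  by (rule gd_closed) (simp_all add: snc_ty, simp add: snc_def scons_def)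

text \<open>At \<open>Seq \<rho>\<close> translation and relation are those of the code type, so the
  realizer of \<open>snc\<close>, which appends to a code, also realizes
  \<open>Snoc\<close>.\<close>

lemma Rz_Snoc: "Rz (Seq \<rho> \<rightarrow> \<rho> \<rightarrow> Seq \<rho>) (Snoc \<rho>)"
proof -
  let ?\<kappa> = "N \<otimes> (N \<rightarrow> \<rho>)"
  let ?t = "Seq \<rho> \<rightarrow> \<rho> \<rightarrow> Seq \<rho>" and ?t' = "?\<kappa> \<rightarrow> \<rho> \<rightarrow> ?\<kappa>"
  obtain u where u: "tyof [] u = Some (st ?t')" "\<And>w. RR w ?t' u (kk ?t' (snc \<rho>))"
    using Rz_snc by (auto simp: Rz_def)
  note [simp] = closed[OF u(1), simplified]
  have "RR w ?t u (kk ?t (Snoc \<rho>))" for w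
  proof (rule RR_funI2)
    fix w' s s' x x' assume s: "RR w' (Seq \<rho>) s s'" and x: "RR w' \<rho> x x'"
    note t = RR_ty[OF s, simplified] RR_ty[OF x]
    have "RR w' ?\<kappa> s (pk (Seq \<rho>) ?\<kappa> (code \<rho>) s')" using s t(2) RR_Seq by simp
    from RR_funE[OF RR_funE[OF u(2) this] x]
    have "RR w' ?\<kappa> (u \<cdot> s \<cdot> x) (pk (Seq \<rho>) ?\<kappa> (code \<rho>) (pw \<rho> (Seq \<rho>) (pw (Seq \<rho>) (\<rho> \<rightarrow> Seq \<rho>) (kk ?t (Snoc \<rho>)) s') x'))"
      by (rule RR_cong') (use t t[THEN ty_up] in simp_all)
    then show "RR w' (Seq \<rho>) (u \<cdot> s \<cdot> x) (pw \<rho> (Seq \<rho>) (pw (Seq \<rho>) (\<rho> \<rightarrow> Seq \<rho>) (kk ?t (Snoc \<rho>)) s') x')"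
      using t by (subst RR_Seq) simp_all
  qed simp_all
  then show ?thesis using u(1) by (auto simp: Rz_def intro!: exI[of _ u])
qed

lemmas gd_Snoc [simp, intro] = Rz_Snoc[THEN gd_Rz]

lemma Rz_srk: "Rz (\<rho> \<rightarrow> (Seq \<kappa> \<rightarrow> \<kappa> \<rightarrow> \<rho> \<rightarrow> \<rho>) \<rightarrow> N \<otimes> (N \<rightarrow> \<kappa>) \<rightarrow> \<rho>) (srk \<kappa> \<rho>)"
  by (rule gd_closed) (simp_all add: srk_ty, simp add: srk_def srs_def mkr_def mkrs_def tlc_def)

text \<open>The realizer is that of recursion on codes, and \<open>srk_code\<close> identifies the
  families.\<close>

lemma Rz_SRec: "Rz (\<rho> \<rightarrow> (Seq \<kappa> \<rightarrow> \<kappa> \<rightarrow> \<rho> \<rightarrow> \<rho>) \<rightarrow> Seq \<kappa> \<rightarrow> \<rho>) (SRec \<kappa> \<rho>)"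
proof -
  let ?\<kappa> = "N \<otimes> (N \<rightarrow> \<kappa>)" and ?f = "Seq \<kappa> \<rightarrow> \<kappa> \<rightarrow> \<rho> \<rightarrow> \<rho>"
  let ?t = "\<rho> \<rightarrow> ?f \<rightarrow> Seq \<kappa> \<rightarrow> \<rho>" and ?t' = "\<rho> \<rightarrow> ?f \<rightarrow> ?\<kappa> \<rightarrow> \<rho>"
  obtain u where u: "tyof [] u = Some (st ?t')" "\<And>w. RR w ?t' u (kk ?t' (srk \<kappa> \<rho>))"
    using Rz_srk[of \<rho> \<kappa>] unfolding Rz_def by blast
  note [simp] = closed[OF u(1), simplified]
  have "RR w ?t u (kk ?t (SRec \<kappa> \<rho>))" for w
  proof (rule RR_funI3)
    fix w' a a' f f' s s' assume a: "RR w' \<rho> a a'" and f: "RR w' ?f f f'" and s: "RR w' (Seq \<kappa>) s s'"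
    note t = RR_ty[OF a] RR_ty[OF f, simplified] RR_ty[OF s, simplified]
    have "RR w' ?\<kappa> s (pk (Seq \<kappa>) ?\<kappa> (code \<kappa>) s')" using s t RR_Seq by simp
    from RR_funE[OF RR_funE[OF RR_funE[OF u(2) a] f] this]
    show "RR w' \<rho> (u \<cdot> a \<cdot> f \<cdot> s) (pw (Seq \<kappa>) \<rho> (pw ?f (Seq \<kappa> \<rightarrow> \<rho>) (pw \<rho> (?f \<rightarrow> Seq \<kappa> \<rightarrow> \<rho>) (kk ?t (SRec \<kappa> \<rho>)) a') f') s')"
    proof (rule RR_cong')
      fix v b assume v: "w' \<sqsubseteq> v" and b: "ty v b = Some B"
      note tv = b t[THEN ty_mono[OF v]]
      have "den v (srk \<kappa> \<rho> \<cdot> (a' \<cdot> b) \<cdot> (f' \<cdot> b) \<cdot> (code \<kappa> \<cdot> (s' \<cdot> b))) = den v (SRec \<kappa> \<rho> \<cdot> (a' \<cdot> b) \<cdot> (f' \<cdot> b) \<cdot> (s' \<cdot> b))"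
        by (rule srk_code) (use tv in simp_all)
      then show "den v (pw ?\<kappa> \<rho> (pw ?f (?\<kappa> \<rightarrow> \<rho>) (pw \<rho> (?f \<rightarrow> ?\<kappa> \<rightarrow> \<rho>) (kk ?t' (srk \<kappa> \<rho>)) a') f') (pk (Seq \<kappa>) ?\<kappa> (code \<kappa>) s') \<cdot> b)
        = den v (pw (Seq \<kappa>) \<rho> (pw ?f (Seq \<kappa> \<rightarrow> \<rho>) (pw \<rho> (?f \<rightarrow> Seq \<kappa> \<rightarrow> \<rho>) (kk ?t (SRec \<kappa> \<rho>)) a') f') s' \<cdot> b)"
        using tv by (simp del: srk_app code_app)
    qed (use t in simp_all)
  qed simp_all
  then show ?thesis using u(1) by (auto simp: Rz_def intro!: exI[of _ u])
qed

text \<open>The fundamental theorem of the logical relation: every constant is realizable, so every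
  term is \<open>gd\<close>.\<close>

theorem Rz_closed:
  assumes "tyof [] t = Some \<rho>" shows "Rz \<rho> t"
proof (rule gd_closed[OF _ assms])
  show "gd t" by (induction t) (auto intro: gd_Rz[OF Rz_SRec])
qed

end

text \<open>\<open>ma h k u\<close> appends \<open>h (k - 1), \<dots>, h 0\<close> to \<open>u\<close>.\<close>

definition mas :: "ty \<Rightarrow> trm" where
  "mas \<kappa> = Lam (N \<rightarrow> \<kappa>) (Lam N (Lam (Seq \<kappa> \<rightarrow> Seq \<kappa>) (Lam (Seq \<kappa>) (
     Var 1 \<cdot> (Snoc \<kappa> \<cdot> Var 0 \<cdot> (Var 3 \<cdot> Var 2))))))"

lemma mas_ty: "tyof [] (mas \<kappa>) = Some ((N \<rightarrow> \<kappa>) \<rightarrow> N \<rightarrow> (Seq \<kappa> \<rightarrow> Seq \<kappa>) \<rightarrow> (Seq \<kappa>) \<rightarrow> (Seq \<kappa>))"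
  by (simp add: mas_def)

lemmas mas_simps [simp] = closed[OF mas_ty]
lemmas mas_app [simp] = app_lam4[OF mas_def, simplified]

definition ma :: "ty \<Rightarrow> trm" where
  "ma \<kappa> = Lam (N \<rightarrow> \<kappa>) (Lam N (Lam (Seq \<kappa>) (
     Rec (Seq \<kappa> \<rightarrow> Seq \<kappa>) \<cdot> Ic (Seq \<kappa>)
      \<cdot> (mas \<kappa> \<cdot> Var 2) \<cdot> Var 1 \<cdot> Var 0)))"

lemma ma_ty: "tyof [] (ma \<kappa>) = Some ((N \<rightarrow> \<kappa>) \<rightarrow> N \<rightarrow> (Seq \<kappa>) \<rightarrow> (Seq \<kappa>))"
  by (simp add: ma_def)

lemmas ma_simps [simp] = closed[OF ma_ty]
lemmas ma_app = app_lam3[OF ma_def, simplified]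

definition mac :: "ty \<Rightarrow> trm" where
  "mac \<kappa> = Lam \<kappa> (Lam (N \<rightarrow> \<kappa>) (Lam N (Lam (Seq \<kappa>) (
     Snoc \<kappa> \<cdot> (ma \<kappa> \<cdot> Var 2 \<cdot> Var 1 \<cdot> Var 0) \<cdot> Var 3))))"

lemma mac_ty: "tyof [] (mac \<kappa>) = Some (\<kappa> \<rightarrow> (N \<rightarrow> \<kappa>) \<rightarrow> N \<rightarrow> (Seq \<kappa>) \<rightarrow> (Seq \<kappa>))"
  by (simp add: mac_def)

lemmas mac_simps [simp] = closed[OF mac_ty]
lemmas mac_app [simp] = app_lam4[OF mac_def, simplified]


lemma ma_Zero [simp]: "tyv w h = Some (N \<rightarrow> \<kappa>) \<Longrightarrow> tyv w u = Some (Seq \<kappa>) \<Longrightarrow>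
    app w (app w (app w (den w (ma \<kappa>)) h) (den w Zero)) u = u"
  by (simp add: ma_app)

lemma ma_Succ: "tyv w h = Some (N \<rightarrow> \<kappa>) \<Longrightarrow> tyv w k = Some N \<Longrightarrow> tyv w u = Some (Seq \<kappa>) \<Longrightarrow>
    app w (app w (app w (den w (ma \<kappa>)) h) (app w (den w Succ) k)) u
      = app w (app w (app w (den w (ma \<kappa>)) h) k) (app w (app w (den w (Snoc \<kappa>)) u) (app w h k))"
  by (simp add: ma_app)

text \<open>\<open>ma\<close> works with an accumulator and puts entry \<open>0\<close> last,
  whereas \<open>scons\<close> adds an entry \<open>0\<close>; the equation says that this entry
  becomes the element appended at the end.\<close>

lemma ma_scons:
  assumes x: "ty w x = Some \<kappa>" "ty w h = Some (N \<rightarrow> \<kappa>)" "ty w k = Some N"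
  shows "den w (ma \<kappa> \<cdot> (scons \<kappa> \<cdot> x \<cdot> h) \<cdot> (Succ \<cdot> k)) = den w (mac \<kappa> \<cdot> x \<cdot> h \<cdot> k)"
proof -
  have "den w (sub (inst k) (ma \<kappa> \<cdot> shift (scons \<kappa> \<cdot> x \<cdot> h) \<cdot> (Succ \<cdot> Var 0)))
    = den w (sub (inst k) (mac \<kappa> \<cdot> shift x \<cdot> shift h \<cdot> Var 0))"
  proof (rule den_nat_induct[where \<rho> = "Seq \<kappa> \<rightarrow> Seq \<kappa>"])
    have "den w (ma \<kappa> \<cdot> (scons \<kappa> \<cdot> x \<cdot> h) \<cdot> (Succ \<cdot> Zero)) = den w (mac \<kappa> \<cdot> x \<cdot> h \<cdot> Zero)"
      by (rule den_ext[where \<rho> = "Seq \<kappa>" and \<eta> = "Seq \<kappa>"])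
        (use x x[THEN ty_up] in \<open>simp_all add: ma_Succ\<close>)
    then show "den w (sub (inst Zero) (ma \<kappa> \<cdot> shift (scons \<kappa> \<cdot> x \<cdot> h) \<cdot> (Succ \<cdot> Var 0)))
      = den w (sub (inst Zero) (mac \<kappa> \<cdot> shift x \<cdot> shift h \<cdot> Var 0))" by simp
  next
    fix w' m assume w': "w \<sqsubseteq> w'" and m: "ty w' m = Some N"
      and IH: "den w' (sub (inst m) (ma \<kappa> \<cdot> shift (scons \<kappa> \<cdot> x \<cdot> h) \<cdot> (Succ \<cdot> Var 0)))
      = den w' (sub (inst m) (mac \<kappa> \<cdot> shift x \<cdot> shift h \<cdot> Var 0))"
    note t = m x[THEN ty_mono[OF w']]
    from IH have IH': "den w' (ma \<kappa> \<cdot> (scons \<kappa> \<cdot> x \<cdot> h) \<cdot> (Succ \<cdot> m)) = den w' (mac \<kappa> \<cdot> x \<cdot> h \<cdot> m)" by simp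
    have "den w' (ma \<kappa> \<cdot> (scons \<kappa> \<cdot> x \<cdot> h) \<cdot> (Succ \<cdot> (Succ \<cdot> m))) = den w' (mac \<kappa> \<cdot> x \<cdot> h \<cdot> (Succ \<cdot> m))"
    proof (rule den_ext[where \<rho> = "Seq \<kappa>" and \<eta> = "Seq \<kappa>"])
      \<comment> \<open>The accumulator grows in the step, so the induction is on an equation
        between functions of it, and the hypothesis is used at \<open>u\<close> extended by
        \<open>h m\<close>.\<close>
      fix v u assume v: "w' \<sqsubseteq> v" and u: "ty v u = Some (Seq \<kappa>)"
      note tv = u t[THEN ty_mono[OF v]]
      have "den v (ma \<kappa> \<cdot> (scons \<kappa> \<cdot> x \<cdot> h) \<cdot> (Succ \<cdot> m)) = den v (mac \<kappa> \<cdot> x \<cdot> h \<cdot> m)"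
        by (rule den_mono[OF v IH']) (use t in simp)
      then have "den v (ma \<kappa> \<cdot> (scons \<kappa> \<cdot> x \<cdot> h) \<cdot> (Succ \<cdot> m) \<cdot> (Snoc \<kappa> \<cdot> u \<cdot> (h \<cdot> m)))
        = den v (mac \<kappa> \<cdot> x \<cdot> h \<cdot> m \<cdot> (Snoc \<kappa> \<cdot> u \<cdot> (h \<cdot> m)))" by simp
      moreover have "den v (ma \<kappa> \<cdot> (scons \<kappa> \<cdot> x \<cdot> h) \<cdot> (Succ \<cdot> (Succ \<cdot> m)) \<cdot> u)
        = den v (ma \<kappa> \<cdot> (scons \<kappa> \<cdot> x \<cdot> h) \<cdot> (Succ \<cdot> m) \<cdot> (Snoc \<kappa> \<cdot> u \<cdot> (h \<cdot> m)))"
        using tv ma_Succ[of v "den v (scons \<kappa> \<cdot> x \<cdot> h)" \<kappa> "den v (Succ \<cdot> m)" "den v u"] by simp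
      moreover have "den v (mac \<kappa> \<cdot> x \<cdot> h \<cdot> (Succ \<cdot> m) \<cdot> u) = den v (mac \<kappa> \<cdot> x \<cdot> h \<cdot> m \<cdot> (Snoc \<kappa> \<cdot> u \<cdot> (h \<cdot> m)))"
        using tv by (simp add: ma_Succ)
      ultimately show "den v (ma \<kappa> \<cdot> (scons \<kappa> \<cdot> x \<cdot> h) \<cdot> (Succ \<cdot> (Succ \<cdot> m)) \<cdot> u) = den v (mac \<kappa> \<cdot> x \<cdot> h \<cdot> (Succ \<cdot> m) \<cdot> u)"
        by metis
    qed (use t in simp_all)
    then show "den w' (sub (inst (Succ \<cdot> m)) (ma \<kappa> \<cdot> shift (scons \<kappa> \<cdot> x \<cdot> h) \<cdot> (Succ \<cdot> Var 0)))
      = den w' (sub (inst (Succ \<cdot> m)) (mac \<kappa> \<cdot> shift x \<cdot> shift h \<cdot> Var 0))" by simp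
  qed (use x in simp_all)
  then show ?thesis by simp
qed

text \<open>A second way to decode, from the front and with an accumulator. This is the order in
  which \<open>psi\<close> secures the entries of a sequence.\<close>

lemma ma_len_rf:
  assumes "ty w s = Some (Seq \<kappa>)" shows "den w (ma \<kappa> \<cdot> (rf \<kappa> \<cdot> s) \<cdot> (len \<kappa> \<cdot> s) \<cdot> Emp \<kappa>) = den w s"
proof -
  have "den w (sub (inst s) (ma \<kappa> \<cdot> (rf \<kappa> \<cdot> Var 0) \<cdot> (len \<kappa> \<cdot> Var 0) \<cdot> Emp \<kappa>)) = den w (sub (inst s) (Var 0))"
  proof (rule den_seq_induct[where \<rho> = "Seq \<kappa>"])
    fix w' s x assume w': "w \<sqsubseteq> w'" and t: "ty w' s = Some (Seq \<kappa>)" "ty w' x = Some \<kappa>"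
      and IH: "den w' (sub (inst s) (ma \<kappa> \<cdot> (rf \<kappa> \<cdot> Var 0) \<cdot> (len \<kappa> \<cdot> Var 0) \<cdot> Emp \<kappa>)) = den w' (sub (inst s) (Var 0))"
    have "den w' (ma \<kappa> \<cdot> (scons \<kappa> \<cdot> x \<cdot> (rf \<kappa> \<cdot> s)) \<cdot> (Succ \<cdot> (len \<kappa> \<cdot> s))) = den w' (mac \<kappa> \<cdot> x \<cdot> (rf \<kappa> \<cdot> s) \<cdot> (len \<kappa> \<cdot> s))"
      by (rule ma_scons) (use t in simp_all)
    then show "den w' (sub (inst (Snoc \<kappa> \<cdot> s \<cdot> x)) (ma \<kappa> \<cdot> (rf \<kappa> \<cdot> Var 0) \<cdot> (len \<kappa> \<cdot> Var 0) \<cdot> Emp \<kappa>))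
      = den w' (sub (inst (Snoc \<kappa> \<cdot> s \<cdot> x)) (Var 0))"
      using t IH by simp
  qed (use assms in simp_all)
  then show ?thesis by simp
qed

context bar_types
begin

subsection \<open>Extension of functions on types of level 0\<close>

text \<open>Like \<open>ext_ok\<close>, with \<delta> in place of \<open>N\<close> as the argument
  type. Level 0 is what makes it attainable: elements of such types are finite data, which can be
  secured completely.\<close>

definition dext_ok :: "ty \<Rightarrow> ty \<Rightarrow> trm \<Rightarrow> bool" where
  "dext_ok \<delta> \<rho> E \<longleftrightarrow> tyof [] E = Some ((\<delta> \<rightarrow> st \<rho>) \<rightarrow> st \<delta> \<rightarrow> st \<rho>) \<and>
    (\<forall>w F f x y. ty w F = Some (\<delta> \<rightarrow> st \<rho>) \<longrightarrow> ty w f = Some (B \<rightarrow> \<delta> \<rightarrow> \<rho>) \<longrightarrow> RR w \<delta> x y \<longrightarrow>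
      (\<forall>w' d. w \<sqsubseteq> w' \<longrightarrow> ty w' d = Some \<delta> \<longrightarrow> RR w' \<rho> (F \<cdot> d) (pw \<delta> \<rho> f (kk \<delta> d))) \<longrightarrow>
      RR w \<rho> (E \<cdot> F \<cdot> x) (pw \<delta> \<rho> f y))"

lemma dext_okD:
  assumes "dext_ok \<delta> \<rho> E" "ty w F = Some (\<delta> \<rightarrow> st \<rho>)" "ty w f = Some (B \<rightarrow> \<delta> \<rightarrow> \<rho>)" "RR w \<delta> x y"
    and "\<And>w' d. w \<sqsubseteq> w' \<Longrightarrow> ty w' d = Some \<delta> \<Longrightarrow> RR w' \<rho> (F \<cdot> d) (pw \<delta> \<rho> f (kk \<delta> d))"
  shows "RR w \<rho> (E \<cdot> F \<cdot> x) (pw \<delta> \<rho> f y)"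
  using assms by (simp add: dext_ok_def)

lemma dext_ok_N: "ext_ok \<rho> E \<Longrightarrow> dext_ok N \<rho> E"
  by (simp add: dext_ok_def ext_ok_def)

definition exq2 :: "ty \<Rightarrow> ty \<Rightarrow> ty \<Rightarrow> trm" where
  "exq2 \<delta> \<epsilon> \<rho> = Lam (\<delta> \<otimes> \<epsilon> \<rightarrow> \<rho>) (Lam \<delta> (Lam \<epsilon> (
     Var 2 \<cdot> (Pair \<delta> \<epsilon> \<cdot> Var 1 \<cdot> Var 0))))"

lemma exq2_ty: "tyof [] (exq2 \<delta> \<epsilon> \<rho>) = Some ((\<delta> \<otimes> \<epsilon> \<rightarrow> \<rho>) \<rightarrow> \<delta> \<rightarrow> \<epsilon> \<rightarrow> \<rho>)"
  by (simp add: exq2_def)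

lemmas exq2_simps [simp] = closed[OF exq2_ty]
lemmas exq2_app [simp] = app_lam3[OF exq2_def, simplified]

definition exq1 :: "ty \<Rightarrow> ty \<Rightarrow> ty \<Rightarrow> ty \<Rightarrow> trm" where
  "exq1 \<delta> \<epsilon> \<epsilon>' \<rho> = Lam ((\<epsilon> \<rightarrow> \<rho>) \<rightarrow> \<epsilon>' \<rightarrow> \<rho>) (Lam (\<delta> \<otimes> \<epsilon> \<rightarrow> \<rho>) (Lam \<epsilon>' (Lam \<delta> (
     Var 3 \<cdot> (exq2 \<delta> \<epsilon> \<rho> \<cdot> Var 2 \<cdot> Var 0) \<cdot> Var 1))))"

lemma exq1_ty: "tyof [] (exq1 \<delta> \<epsilon> \<epsilon>' \<rho>) = Some (((\<epsilon> \<rightarrow> \<rho>) \<rightarrow> \<epsilon>' \<rightarrow> \<rho>) \<rightarrow> (\<delta> \<otimes> \<epsilon> \<rightarrow> \<rho>) \<rightarrow> \<epsilon>' \<rightarrow> \<delta> \<rightarrow> \<rho>)"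
  by (simp add: exq1_def)

lemmas exq1_simps [simp] = closed[OF exq1_ty]
lemmas exq1_app [simp] = app_lam4[OF exq1_def, simplified]

text \<open>\<open>D\<close> secures the first component to some \<open>d\<close>, and inside it
  \<open>E\<close> secures the second to some \<open>e\<close>; then \<open>F\<close> can be applied
  to the pair. \<open>fq1\<close> and \<open>fq2\<close> are the families of these two
  stages.\<close>

definition exq :: "ty \<Rightarrow> ty \<Rightarrow> ty \<Rightarrow> ty \<Rightarrow> ty \<Rightarrow> trm" where
  "exq \<delta> \<delta>' \<epsilon> \<epsilon>' \<rho> = Lam ((\<delta> \<rightarrow> \<rho>) \<rightarrow> \<delta>' \<rightarrow> \<rho>) (Lam ((\<epsilon> \<rightarrow> \<rho>) \<rightarrow> \<epsilon>' \<rightarrow> \<rho>) (Lam (\<delta> \<otimes> \<epsilon> \<rightarrow> \<rho>) (Lam (\<delta>' \<otimes> \<epsilon>') (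
     Var 3 \<cdot> (exq1 \<delta> \<epsilon> \<epsilon>' \<rho> \<cdot> Var 2 \<cdot> Var 1 \<cdot> (Snd \<delta>' \<epsilon>'
      \<cdot> Var 0)) \<cdot> (Fst \<delta>' \<epsilon>' \<cdot> Var 0)))))"

lemma exq_ty: "tyof [] (exq \<delta> \<delta>' \<epsilon> \<epsilon>' \<rho>) = Some (((\<delta> \<rightarrow> \<rho>) \<rightarrow> \<delta>' \<rightarrow> \<rho>) \<rightarrow> ((\<epsilon> \<rightarrow> \<rho>) \<rightarrow> \<epsilon>' \<rightarrow> \<rho>) \<rightarrow> (\<delta> \<otimes> \<epsilon> \<rightarrow> \<rho>) \<rightarrow> (\<delta>' \<otimes> \<epsilon>') \<rightarrow> \<rho>)"
  by (simp add: exq_def)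

lemmas exq_simps [simp] = closed[OF exq_ty]
lemmas exq_app [simp] = app_lam4[OF exq_def, simplified]

definition fq1 :: "ty \<Rightarrow> ty \<Rightarrow> ty \<Rightarrow> trm" where
  "fq1 \<delta> \<epsilon> \<rho> = Lam (B \<rightarrow> \<delta> \<otimes> \<epsilon> \<rightarrow> \<rho>) (Lam (B \<rightarrow> \<epsilon>) (Lam B (Lam \<delta> (
     Var 3 \<cdot> Var 1 \<cdot> (Pair \<delta> \<epsilon>
      \<cdot> Var 0 \<cdot> (Var 2 \<cdot> Var 1))))))"

lemma fq1_ty: "tyof [] (fq1 \<delta> \<epsilon> \<rho>) = Some ((B \<rightarrow> \<delta> \<otimes> \<epsilon> \<rightarrow> \<rho>) \<rightarrow> (B \<rightarrow> \<epsilon>) \<rightarrow> B \<rightarrow> \<delta> \<rightarrow> \<rho>)"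
  by (simp add: fq1_def)

lemmas fq1_simps [simp] = closed[OF fq1_ty]
lemmas fq1_app [simp] = app_lam4[OF fq1_def, simplified]

definition fq2 :: "ty \<Rightarrow> ty \<Rightarrow> ty \<Rightarrow> trm" where
  "fq2 \<delta> \<epsilon> \<rho> = Lam (B \<rightarrow> \<delta> \<otimes> \<epsilon> \<rightarrow> \<rho>) (Lam \<delta> (Lam B (Lam \<epsilon> (
     Var 3 \<cdot> Var 1 \<cdot> (Pair \<delta> \<epsilon> \<cdot> Var 2 \<cdot> Var 0)))))"

lemma fq2_ty: "tyof [] (fq2 \<delta> \<epsilon> \<rho>) = Some ((B \<rightarrow> \<delta> \<otimes> \<epsilon> \<rightarrow> \<rho>) \<rightarrow> \<delta> \<rightarrow> B \<rightarrow> \<epsilon> \<rightarrow> \<rho>)"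
  by (simp add: fq2_def)

lemmas fq2_simps [simp] = closed[OF fq2_ty]
lemmas fq2_app [simp] = app_lam4[OF fq2_def, simplified]


lemma dext_ok_prod:
  assumes "dext_ok \<delta> \<rho> D" "dext_ok \<epsilon> \<rho> E" shows "dext_ok (\<delta> \<otimes> \<epsilon>) \<rho> (exq \<delta> (st \<delta>) \<epsilon> (st \<epsilon>) (st \<rho>) \<cdot> D \<cdot> E)"
  unfolding dext_ok_def
proof (intro conjI allI impI)
  have D: "tyof [] D = Some ((\<delta> \<rightarrow> st \<rho>) \<rightarrow> st \<delta> \<rightarrow> st \<rho>)" and E: "tyof [] E = Some ((\<epsilon> \<rightarrow> st \<rho>) \<rightarrow> st \<epsilon> \<rightarrow> st \<rho>)"
    using assms by (simp_all add: dext_ok_def)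
  note [simp] = closed[OF E] closed[OF D]
  let ?Q = "exq \<delta> (st \<delta>) \<epsilon> (st \<epsilon>) (st \<rho>) \<cdot> D \<cdot> E"
  show "tyof [] ?Q = Some ((\<delta> \<otimes> \<epsilon> \<rightarrow> st \<rho>) \<rightarrow> st (\<delta> \<otimes> \<epsilon>) \<rightarrow> st \<rho>)" by simp
  fix w F f p y
  assume t: "ty w F = Some (\<delta> \<otimes> \<epsilon> \<rightarrow> st \<rho>)" "ty w f = Some (B \<rightarrow> \<delta> \<otimes> \<epsilon> \<rightarrow> \<rho>)" and p: "RR w (\<delta> \<otimes> \<epsilon>) p y"
    and Ff: "\<forall>w' d. w \<sqsubseteq> w' \<longrightarrow> ty w' d = Some (\<delta> \<otimes> \<epsilon>) \<longrightarrow> RR w' \<rho> (F \<cdot> d) (pw (\<delta> \<otimes> \<epsilon>) \<rho> f (kk (\<delta> \<otimes> \<epsilon>) d))"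
  note t = t RR_ty[OF p, simplified]
  let ?p1 = "Fst (st \<delta>) (st \<epsilon>) \<cdot> p" and ?p2 = "Snd (st \<delta>) (st \<epsilon>) \<cdot> p"
  let ?y1 = "pk (\<delta> \<otimes> \<epsilon>) \<delta> (Fst \<delta> \<epsilon>) y" and ?y2 = "pk (\<delta> \<otimes> \<epsilon>) \<epsilon> (Snd \<delta> \<epsilon>) y"
  have p1: "RR w \<delta> ?p1 ?y1" and p2: "RR w \<epsilon> ?p2 ?y2" using p t RR_prod by simp_all
  have "RR w \<rho> (D \<cdot> (exq1 \<delta> \<epsilon> (st \<epsilon>) (st \<rho>) \<cdot> E \<cdot> F \<cdot> ?p2) \<cdot> ?p1) (pw \<delta> \<rho> (fq1 \<delta> \<epsilon> \<rho> \<cdot> f \<cdot> ?y2) ?y1)"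
  proof (rule dext_okD[OF assms(1) _ _ p1])
    fix v d assume v: "w \<sqsubseteq> v" and d: "ty v d = Some \<delta>"
    note tv = d t[THEN ty_mono[OF v]]
    have "RR v \<rho> (E \<cdot> (exq2 \<delta> \<epsilon> (st \<rho>) \<cdot> F \<cdot> d) \<cdot> ?p2) (pw \<epsilon> \<rho> (fq2 \<delta> \<epsilon> \<rho> \<cdot> f \<cdot> d) ?y2)"
    proof (rule dext_okD[OF assms(2) _ _ RR_mono[OF v p2]])
      fix u e assume u: "v \<sqsubseteq> u" and e: "ty u e = Some \<epsilon>"
      note tu = e tv[THEN ty_mono[OF u]]
      have "RR u \<rho> (F \<cdot> (Pair \<delta> \<epsilon> \<cdot> d \<cdot> e)) (pw (\<delta> \<otimes> \<epsilon>) \<rho> f (kk (\<delta> \<otimes> \<epsilon>) (Pair \<delta> \<epsilon> \<cdot> d \<cdot> e)))"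
        by (rule Ff[rule_format, OF wle_trans[OF v u]]) (use tu in simp)
      then show "RR u \<rho> (exq2 \<delta> \<epsilon> (st \<rho>) \<cdot> F \<cdot> d \<cdot> e) (pw \<epsilon> \<rho> (fq2 \<delta> \<epsilon> \<rho> \<cdot> f \<cdot> d) (kk \<epsilon> e))"
        by (rule RR_cong') (use tu tu[THEN ty_up] in simp_all)
    qed (use tv in simp_all)
    then show "RR v \<rho> (exq1 \<delta> \<epsilon> (st \<epsilon>) (st \<rho>) \<cdot> E \<cdot> F \<cdot> ?p2 \<cdot> d) (pw \<delta> \<rho> (fq1 \<delta> \<epsilon> \<rho> \<cdot> f \<cdot> ?y2) (kk \<delta> d))"
      by (rule RR_cong') (use tv tv[THEN ty_up] in simp_all)
  qed (use t in simp_all)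
  then show "RR w \<rho> (?Q \<cdot> F \<cdot> p) (pw (\<delta> \<otimes> \<epsilon>) \<rho> f y)"
    by (rule RR_cong') (use t t[THEN ty_up] in simp_all)
qed

text \<open>The entries of a sequence of length \<open>k\<close> are secured one after the other, \<open>u\<close> being the part known so far.\<close>

definition psi1 :: "ty \<Rightarrow> ty \<Rightarrow> trm" where
  "psi1 \<delta> \<rho> = Lam (Seq \<delta> \<rightarrow> \<rho>) (Lam (Seq \<delta>) (Lam \<delta> (
     Var 2 \<cdot> (Snoc \<delta> \<cdot> Var 1 \<cdot> Var 0))))"

lemma psi1_ty: "tyof [] (psi1 \<delta> \<rho>) = Some ((Seq \<delta> \<rightarrow> \<rho>) \<rightarrow> (Seq \<delta>) \<rightarrow> \<delta> \<rightarrow> \<rho>)"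
  by (simp add: psi1_def)

lemmas psi1_simps [simp] = closed[OF psi1_ty]
lemmas psi1_app [simp] = app_lam3[OF psi1_def, simplified]

definition psi :: "ty \<Rightarrow> ty \<Rightarrow> ty \<Rightarrow> trm" where
  "psi \<delta> \<delta>' \<rho> = Lam ((\<delta> \<rightarrow> \<rho>) \<rightarrow> \<delta>' \<rightarrow> \<rho>) (Lam (N0 \<rightarrow> \<delta>') (Lam N (Lam (Seq \<delta> \<rightarrow> \<rho>) (Lam (Seq \<delta>) (
     Var 4 \<cdot> (psi1 \<delta> \<rho> \<cdot> Var 1 \<cdot> Var 0)
      \<cdot> (Var 3 \<cdot> (eta \<cdot> Var 2)))))))"

lemma psi_ty: "tyof [] (psi \<delta> \<delta>' \<rho>) = Some (((\<delta> \<rightarrow> \<rho>) \<rightarrow> \<delta>' \<rightarrow> \<rho>) \<rightarrow> (N0 \<rightarrow> \<delta>') \<rightarrow> N \<rightarrow> (Seq \<delta> \<rightarrow> \<rho>) \<rightarrow> (Seq \<delta>) \<rightarrow> \<rho>)"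
  by (simp add: psi_def)

lemmas psi_simps [simp] = closed[OF psi_ty]
lemmas psi_app [simp] = app_lam5[OF psi_def, simplified]

definition exs1 :: "ty \<Rightarrow> ty \<Rightarrow> ty \<Rightarrow> trm" where
  "exs1 \<delta> \<delta>' \<rho> = Lam ((\<delta> \<rightarrow> \<rho>) \<rightarrow> \<delta>' \<rightarrow> \<rho>) (Lam (Seq \<delta> \<rightarrow> \<rho>) (Lam (N0 \<rightarrow> \<delta>') (Lam N (
     Rec (Seq \<delta> \<rightarrow> \<rho>) \<cdot> Var 2 \<cdot> (psi \<delta> \<delta>' \<rho>
      \<cdot> Var 3 \<cdot> Var 1) \<cdot> Var 0 \<cdot> Emp \<delta>))))"

lemma exs1_ty: "tyof [] (exs1 \<delta> \<delta>' \<rho>) = Some (((\<delta> \<rightarrow> \<rho>) \<rightarrow> \<delta>' \<rightarrow> \<rho>) \<rightarrow> (Seq \<delta> \<rightarrow> \<rho>) \<rightarrow> (N0 \<rightarrow> \<delta>') \<rightarrow> N \<rightarrow> \<rho>)"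
  by (simp add: exs1_def)

lemmas exs1_simps [simp] = closed[OF exs1_ty]
lemmas exs1_app [simp] = app_lam4[OF exs1_def, simplified]

definition exs :: "ty \<Rightarrow> ty \<Rightarrow> ty \<Rightarrow> trm" where
  "exs \<delta> \<delta>' \<rho> = Lam ((N \<rightarrow> \<rho>) \<rightarrow> N0 \<rightarrow> \<rho>) (Lam ((\<delta> \<rightarrow> \<rho>) \<rightarrow> \<delta>' \<rightarrow> \<rho>) (Lam (Seq \<delta> \<rightarrow> \<rho>) (Lam (N0 \<otimes> (N0 \<rightarrow> \<delta>')) (
     Var 3 \<cdot> (exs1 \<delta> \<delta>' \<rho> \<cdot> Var 2 \<cdot> Var 1 \<cdot> (Snd N0 (N0 \<rightarrow> \<delta>')
      \<cdot> Var 0)) \<cdot> (Fst N0 (N0 \<rightarrow> \<delta>') \<cdot> Var 0)))))"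

lemma exs_ty: "tyof [] (exs \<delta> \<delta>' \<rho>) = Some (((N \<rightarrow> \<rho>) \<rightarrow> N0 \<rightarrow> \<rho>) \<rightarrow> ((\<delta> \<rightarrow> \<rho>) \<rightarrow> \<delta>' \<rightarrow> \<rho>) \<rightarrow> (Seq \<delta> \<rightarrow> \<rho>) \<rightarrow> (N0 \<otimes> (N0 \<rightarrow> \<delta>')) \<rightarrow> \<rho>)"
  by (simp add: exs_def)

lemmas exs_simps [simp] = closed[OF exs_ty]
lemmas exs_app [simp] = app_lam4[OF exs_def, simplified]

text \<open>The family that stage \<open>k\<close> of \<open>psi\<close> realizes: the known part
  \<open>u\<close>, completed by the entries \<open>h (k - 1), \<dots>, h 0\<close> taken at the
  given infinite sequence.\<close>

definition fu :: "ty \<Rightarrow> ty \<Rightarrow> trm" where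
  "fu \<delta> \<rho> = Lam (B \<rightarrow> Seq \<delta> \<rightarrow> \<rho>) (Lam (B \<rightarrow> N \<rightarrow> \<delta>) (Lam B (Lam N (Lam (Seq \<delta>) (
     Var 4 \<cdot> Var 2 \<cdot> (ma \<delta> \<cdot> (Var 3
      \<cdot> Var 2) \<cdot> Var 1 \<cdot> Var 0))))))"

lemma fu_ty: "tyof [] (fu \<delta> \<rho>) = Some ((B \<rightarrow> Seq \<delta> \<rightarrow> \<rho>) \<rightarrow> (B \<rightarrow> N \<rightarrow> \<delta>) \<rightarrow> B \<rightarrow> N \<rightarrow> (Seq \<delta>) \<rightarrow> \<rho>)"
  by (simp add: fu_def)

lemmas fu_simps [simp] = closed[OF fu_ty]
lemmas fu_app [simp] = app_lam5[OF fu_def, simplified]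

definition fs :: "ty \<Rightarrow> ty \<Rightarrow> trm" where
  "fs \<delta> \<rho> = Lam (B \<rightarrow> Seq \<delta> \<rightarrow> \<rho>) (Lam (B \<rightarrow> N \<rightarrow> \<delta>) (Lam B (Lam N (
     Var 3 \<cdot> Var 1 \<cdot> (ma \<delta> \<cdot> (Var 2
      \<cdot> Var 1) \<cdot> Var 0 \<cdot> Emp \<delta>)))))"

lemma fs_ty: "tyof [] (fs \<delta> \<rho>) = Some ((B \<rightarrow> Seq \<delta> \<rightarrow> \<rho>) \<rightarrow> (B \<rightarrow> N \<rightarrow> \<delta>) \<rightarrow> B \<rightarrow> N \<rightarrow> \<rho>)"
  by (simp add: fs_def)

lemmas fs_simps [simp] = closed[OF fs_ty]
lemmas fs_app [simp] = app_lam4[OF fs_def, simplified]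

definition fd :: "ty \<Rightarrow> ty \<Rightarrow> trm" where
  "fd \<delta> \<rho> = Lam (B \<rightarrow> N \<rightarrow> Seq \<delta> \<rightarrow> \<rho>) (Lam N (Lam (Seq \<delta>) (Lam B (Lam \<delta> (
     Var 4 \<cdot> Var 1 \<cdot> Var 3 \<cdot> (Snoc \<delta> \<cdot> Var 2 \<cdot> Var 0))))))"

lemma fd_ty: "tyof [] (fd \<delta> \<rho>) = Some ((B \<rightarrow> N \<rightarrow> Seq \<delta> \<rightarrow> \<rho>) \<rightarrow> N \<rightarrow> (Seq \<delta>) \<rightarrow> B \<rightarrow> \<delta> \<rightarrow> \<rho>)"
  by (simp add: fd_def)

lemmas fd_simps [simp] = closed[OF fd_ty]
lemmas fd_app [simp] = app_lam5[OF fd_def, simplified]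


lemma psi_realizes:
  assumes D: "dext_ok \<delta> \<rho> D" and t: "ty w F = Some (Seq \<delta> \<rightarrow> st \<rho>)" "ty w f = Some (B \<rightarrow> Seq \<delta> \<rightarrow> \<rho>)"
    and g: "RR w (N \<rightarrow> \<delta>) g h" and k: "ty w k = Some N" and u: "ty w u = Some (Seq \<delta>)"
    and Ff: "\<And>w' d. w \<sqsubseteq> w' \<Longrightarrow> ty w' d = Some (Seq \<delta>) \<Longrightarrow> RR w' \<rho> (F \<cdot> d) (pw (Seq \<delta>) \<rho> f (kk (Seq \<delta>) d))"
  shows "RR w \<rho> (Rec (Seq \<delta> \<rightarrow> st \<rho>) \<cdot> F \<cdot> (psi \<delta> (st \<delta>) (st \<rho>) \<cdot> D \<cdot> g) \<cdot> k \<cdot> u)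
    (pw (Seq \<delta>) \<rho> (pw N (Seq \<delta> \<rightarrow> \<rho>) (fu \<delta> \<rho> \<cdot> f \<cdot> h) (kk N k)) (kk (Seq \<delta>) u))"
proof -
  have "tyof [] D = Some ((\<delta> \<rightarrow> st \<rho>) \<rightarrow> st \<delta> \<rightarrow> st \<rho>)" using D by (simp add: dext_ok_def)
  note [simp] = closed[OF this]
  note t = t RR_ty[OF g, simplified]
  let ?P = "Rec (Seq \<delta> \<rightarrow> st \<rho>) \<cdot> F \<cdot> (psi \<delta> (st \<delta>) (st \<rho>) \<cdot> D \<cdot> g)" and ?q = "fu \<delta> \<rho> \<cdot> f \<cdot> h"
  \<comment> \<open>The quantifier over the known part belongs to the induction formula: the step
    from \<open>m\<close> to \<open>m + 1\<close> uses the hypothesis at \<open>u\<close> with a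
    newly secured entry appended.\<close>
  let ?A = "All (Seq \<delta>) (R \<rho> (shift (shift ?P) \<cdot> Var 1 \<cdot> Var 0)
    (pw (Seq \<delta>) \<rho> (pw N (Seq \<delta> \<rightarrow> \<rho>) (shift (shift ?q)) (kk N (Var 1))) (kk (Seq \<delta>) (Var 0))))"
  have A: "v \<tturnstile> fsub (inst m) ?A \<longleftrightarrow> (\<forall>v' u. v \<sqsubseteq> v' \<longrightarrow> ty v' u = Some (Seq \<delta>) \<longrightarrow>
      RR v' \<rho> (?P \<cdot> m \<cdot> u) (pw (Seq \<delta>) \<rho> (pw N (Seq \<delta> \<rightarrow> \<rho>) ?q (kk N m)) (kk (Seq \<delta>) u)))" (is "_ \<longleftrightarrow> ?r")
    if v: "w \<sqsubseteq> v" and m: "ty v m = Some N" for v m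
  proof
    let ?M = "R \<rho> (shift ?P \<cdot> shift m \<cdot> Var 0) (pw (Seq \<delta>) \<rho> (pw N (Seq \<delta> \<rightarrow> \<rho>) (shift ?q) (kk N (shift m))) (kk (Seq \<delta>) (Var 0)))"
    note tv = m t[THEN ty_mono[OF v]]
    have i: "fsub (inst m) ?A = All (Seq \<delta>) ?M" by simp
    {
      assume a: "v \<tturnstile> fsub (inst m) ?A"
      show ?r
      proof (intro allI impI)
        fix v' u assume v': "v \<sqsubseteq> v'" and u: "ty v' u = Some (Seq \<delta>)"
        have "v' \<tturnstile> fsub (inst u) ?M" by (rule forces_AllE[OF forces_mono[OF v' a[unfolded i]] u])
        then show "RR v' \<rho> (?P \<cdot> m \<cdot> u) (pw (Seq \<delta>) \<rho> (pw N (Seq \<delta> \<rightarrow> \<rho>) ?q (kk N m)) (kk (Seq \<delta>) u))"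
          using u tv[THEN ty_mono[OF v']] by (simp add: RR_def)
      qed
    next
      assume r: ?r
      show "v \<tturnstile> fsub (inst m) ?A"
        unfolding i
      proof (rule forces_AllI)
        fix v' u assume v': "v \<sqsubseteq> v'" and u: "ty v' u = Some (Seq \<delta>)"
        then have "RR v' \<rho> (?P \<cdot> m \<cdot> u) (pw (Seq \<delta>) \<rho> (pw N (Seq \<delta> \<rightarrow> \<rho>) ?q (kk N m)) (kk (Seq \<delta>) u))"
          using r by blast
        then show "v' \<tturnstile> fsub (inst u) ?M" by (simp add: RR_def)
      qed (use tv in simp)
    }
  qed
  have "w \<tturnstile> fsub (inst k) ?A"
  proof (rule forces_nat_induct)
    show "w \<tturnstile> fsub (inst Zero) ?A"
    proof (subst A; (intro allI impI)?)
      fix v u assume v: "w \<sqsubseteq> v" and u: "ty v u = Some (Seq \<delta>)"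
      note tv = u t[THEN ty_mono[OF v]]
      show "RR v \<rho> (?P \<cdot> Zero \<cdot> u) (pw (Seq \<delta>) \<rho> (pw N (Seq \<delta> \<rightarrow> \<rho>) ?q (kk N Zero)) (kk (Seq \<delta>) u))"
        by (rule RR_cong'[OF Ff[OF v u]]) (use tv tv[THEN ty_up] in simp_all)
    qed simp_all
  next
    fix v m assume v: "w \<sqsubseteq> v" and m: "ty v m = Some N" and IH: "v \<tturnstile> fsub (inst m) ?A"
    note tv = m t[THEN ty_mono[OF v]]
    note IH = IH[unfolded A[OF v m], rule_format]
    show "v \<tturnstile> fsub (inst (Succ \<cdot> m)) ?A"
    proof (subst A[OF v]; (intro allI impI)?)
      fix v' u assume v': "v \<sqsubseteq> v'" and u: "ty v' u = Some (Seq \<delta>)"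
      note tu = u tv[THEN ty_mono[OF v']]
      have gm: "RR v' \<delta> (g \<cdot> (eta \<cdot> m)) (pw N \<delta> h (kk N m))"
        by (rule RR_funE[OF RR_mono[OF wle_trans[OF v v'] g] RR_eta]) (use tu in simp)
      have "RR v' \<rho> (D \<cdot> (psi1 \<delta> (st \<rho>) \<cdot> (?P \<cdot> m) \<cdot> u) \<cdot> (g \<cdot> (eta \<cdot> m))) (pw \<delta> \<rho> (fd \<delta> \<rho> \<cdot> ?q \<cdot> m \<cdot> u) (pw N \<delta> h (kk N m)))"
      proof (rule dext_okD[OF D _ _ gm])
        fix v'' d assume v'': "v' \<sqsubseteq> v''" and d: "ty v'' d = Some \<delta>"
        note td = d tu[THEN ty_mono[OF v'']]
        have "RR v'' \<rho> (?P \<cdot> m \<cdot> (Snoc \<delta> \<cdot> u \<cdot> d)) (pw (Seq \<delta>) \<rho> (pw N (Seq \<delta> \<rightarrow> \<rho>) ?q (kk N m)) (kk (Seq \<delta>) (Snoc \<delta> \<cdot> u \<cdot> d)))"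
          by (rule IH[OF wle_trans[OF v' v'']]) (use td in simp)
        then show "RR v'' \<rho> (psi1 \<delta> (st \<rho>) \<cdot> (?P \<cdot> m) \<cdot> u \<cdot> d) (pw \<delta> \<rho> (fd \<delta> \<rho> \<cdot> ?q \<cdot> m \<cdot> u) (kk \<delta> d))"
          by (rule RR_cong') (use td td[THEN ty_up] in simp_all)
      qed (use tu in simp_all)
      then show "RR v' \<rho> (?P \<cdot> (Succ \<cdot> m) \<cdot> u) (pw (Seq \<delta>) \<rho> (pw N (Seq \<delta> \<rightarrow> \<rho>) ?q (kk N (Succ \<cdot> m))) (kk (Seq \<delta>) u))"
        by (rule RR_cong') (use tu tu[THEN ty_up] in \<open>simp_all add: ma_Succ\<close>)
    qed (use m in simp)
  qed (use t k in simp_all)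
  then show ?thesis using A[OF wle_refl k] u wle_refl by blast
qed

text \<open>The length is a translated number, which \<open>E\<close> secures; for a true length
  \<open>k\<close> there remain \<open>k\<close> entries in \<delta>, and
  \<open>psi_realizes\<close> handles them.\<close>

lemma dext_ok_Seq:
  assumes D: "dext_ok \<delta> \<rho> D" and E: "ext_ok \<rho> E" shows "dext_ok (Seq \<delta>) \<rho> (exs \<delta> (st \<delta>) (st \<rho>) \<cdot> E \<cdot> D)"
  unfolding dext_ok_def
proof (intro conjI allI impI)
  have tD: "tyof [] D = Some ((\<delta> \<rightarrow> st \<rho>) \<rightarrow> st \<delta> \<rightarrow> st \<rho>)" and tE: "tyof [] E = Some ((N \<rightarrow> st \<rho>) \<rightarrow> N0 \<rightarrow> st \<rho>)"
    using assms by (simp_all add: dext_ok_def ext_ok_def)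
  note [simp] = closed[OF tE] closed[OF tD]
  let ?Q = "exs \<delta> (st \<delta>) (st \<rho>) \<cdot> E \<cdot> D"
  show "tyof [] ?Q = Some ((Seq \<delta> \<rightarrow> st \<rho>) \<rightarrow> st (Seq \<delta>) \<rightarrow> st \<rho>)" by simp
  fix w F f p y
  assume t: "ty w F = Some (Seq \<delta> \<rightarrow> st \<rho>)" "ty w f = Some (B \<rightarrow> Seq \<delta> \<rightarrow> \<rho>)" and p: "RR w (Seq \<delta>) p y"
    and Ff: "\<forall>w' d. w \<sqsubseteq> w' \<longrightarrow> ty w' d = Some (Seq \<delta>) \<longrightarrow> RR w' \<rho> (F \<cdot> d) (pw (Seq \<delta>) \<rho> f (kk (Seq \<delta>) d))"
  note t = t RR_ty[OF p, simplified]
  let ?\<kappa> = "N \<otimes> (N \<rightarrow> \<delta>)"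
  let ?c = "pk (Seq \<delta>) ?\<kappa> (code \<delta>) y"
  let ?g = "Snd N0 (N0 \<rightarrow> st \<delta>) \<cdot> p" and ?h = "pk ?\<kappa> (N \<rightarrow> \<delta>) (Snd N (N \<rightarrow> \<delta>)) ?c"
  let ?n = "Fst N0 (N0 \<rightarrow> st \<delta>) \<cdot> p" and ?n' = "pk ?\<kappa> N (Fst N (N \<rightarrow> \<delta>)) ?c"
  have "RR w ?\<kappa> p ?c" using p t RR_Seq by simp
  then have n: "RR w N ?n ?n'" and g: "RR w (N \<rightarrow> \<delta>) ?g ?h"
    using RR_prod[of w p N "N \<rightarrow> \<delta>" ?c] t by simp_all
  have "RR w \<rho> (E \<cdot> (exs1 \<delta> (st \<delta>) (st \<rho>) \<cdot> D \<cdot> F \<cdot> ?g) \<cdot> ?n) (pw N \<rho> (fs \<delta> \<rho> \<cdot> f \<cdot> ?h) ?n')"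
  proof (rule ext_okD[OF E _ _ n])
    fix v k assume v: "w \<sqsubseteq> v" and k: "ty v k = Some N"
    note tv = k t[THEN ty_mono[OF v]]
    have "RR v \<rho> (Rec (Seq \<delta> \<rightarrow> st \<rho>) \<cdot> F \<cdot> (psi \<delta> (st \<delta>) (st \<rho>) \<cdot> D \<cdot> ?g) \<cdot> k \<cdot> Emp \<delta>)
      (pw (Seq \<delta>) \<rho> (pw N (Seq \<delta> \<rightarrow> \<rho>) (fu \<delta> \<rho> \<cdot> f \<cdot> ?h) (kk N k)) (kk (Seq \<delta>) (Emp \<delta>)))"
      by (rule psi_realizes[OF D _ _ RR_mono[OF v g] k]) (use tv Ff wle_trans[OF v] in simp_all)
    then show "RR v \<rho> (exs1 \<delta> (st \<delta>) (st \<rho>) \<cdot> D \<cdot> F \<cdot> ?g \<cdot> k) (pw N \<rho> (fs \<delta> \<rho> \<cdot> f \<cdot> ?h) (kk N k))"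
      by (rule RR_cong') (use tv tv[THEN ty_up] in simp_all)
  qed (use t in simp_all)
  then show "RR w \<rho> (?Q \<cdot> F \<cdot> p) (pw (Seq \<delta>) \<rho> f y)"
  proof (rule RR_cong')
    fix v b assume v: "w \<sqsubseteq> v" and b: "ty v b = Some B"
    note tv = b t[THEN ty_mono[OF v]]
    have "den v (ma \<delta> \<cdot> (rf \<delta> \<cdot> (y \<cdot> b)) \<cdot> (len \<delta> \<cdot> (y \<cdot> b)) \<cdot> Emp \<delta>) = den v (y \<cdot> b)"
      by (rule ma_len_rf) (use tv in simp)
    then show "den v (pw N \<rho> (fs \<delta> \<rho> \<cdot> f \<cdot> ?h) ?n' \<cdot> b) = den v (pw (Seq \<delta>) \<rho> f y \<cdot> b)"
      using tv by simp
  qed (use t in simp_all)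
qed

text \<open>Level 0 excludes function types, and the other types are covered by the constructions
  above.\<close>

lemma dext_ex: "level \<delta> = 0 \<Longrightarrow> \<exists>E. dext_ok \<delta> \<rho> E"
proof (induction \<delta>)
  case N
  then show ?case using ext_ex dext_ok_N by blast
next
  case (Prod \<delta> \<epsilon>)
  then show ?case using dext_ok_prod by fastforce
next
  case (Seq \<delta>)
  then show ?case using dext_ok_Seq ext_ex by fastforce
qed simp

end

text \<open>Keeps \<open>zero (N \<rightarrow> \<tau>)\<close> folded. Unfolded it is an
  abstraction, whereas folded it is a closed constant that the simplifier passes by.\<close>

declare zero.simps(2) [simp del]

subsection \<open>Arithmetic\<close>

definition prd :: "trm" where
  "prd = Lam N (ncase N \<cdot> Zero \<cdot> Ic N \<cdot> Var 0)"

lemma prd_ty: "tyof [] prd = Some (N \<rightarrow> N)"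
  by (simp add: prd_def)

lemmas prd_simps [simp] = closed[OF prd_ty]
lemmas prd_app [simp] = app_lam1[OF prd_def, simplified]

definition plf :: "trm" where
  "plf = Lam N (Lam N (Succ \<cdot> Var 0))"

lemma plf_ty: "tyof [] plf = Some (N \<rightarrow> N \<rightarrow> N)"
  by (simp add: plf_def)

lemmas plf_simps [simp] = closed[OF plf_ty]
lemmas plf_app [simp] = app_lam2[OF plf_def, simplified]

definition mnf :: "trm" where
  "mnf = Lam N (Lam N (prd \<cdot> Var 0))"

lemma mnf_ty: "tyof [] mnf = Some (N \<rightarrow> N \<rightarrow> N)"
  by (simp add: mnf_def)

lemmas mnf_simps [simp] = closed[OF mnf_ty]
lemmas mnf_app [simp] = app_lam2[OF mnf_def, simplified]

definition mns :: "trm" where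
  "mns = Lam N (Lam N (Rec N \<cdot> Var 1 \<cdot> mnf \<cdot> Var 0))"

lemma mns_ty: "tyof [] mns = Some (N \<rightarrow> N \<rightarrow> N)"
  by (simp add: mns_def)

lemmas mns_simps [simp] = closed[OF mns_ty]
lemmas mns_app = app_lam2[OF mns_def, simplified]


lemma mns_Zero [simp]: "tyv w x = Some N \<Longrightarrow> app w (app w (den w mns) x) (den w Zero) = x"
  by (simp add: mns_app)

lemma mns_Succ [simp]: "tyv w x = Some N \<Longrightarrow> tyv w n = Some N \<Longrightarrow>
  app w (app w (den w mns) x) (app w (den w Succ) n) = app w (den w prd) (app w (app w (den w mns) x) n)"
  by (simp add: mns_app)

text \<open>Folds the inner abstraction into the constant \<open>plf\<close>, which has an
  application rule.\<close>

lemma nplus_eq: "nplus a b = Rec N \<cdot> a \<cdot> plf \<cdot> b"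
  by (simp add: nplus_def plf_def)

lemma mns_Succ_Succ:
  assumes "ty w x = Some N" "ty w y = Some N"
  shows "den w (mns \<cdot> (Succ \<cdot> x) \<cdot> (Succ \<cdot> y)) = den w (mns \<cdot> x \<cdot> y)"
proof -
  have "den w (sub (inst y) (mns \<cdot> (Succ \<cdot> shift x) \<cdot> (Succ \<cdot> Var 0))) = den w (sub (inst y) (mns \<cdot> shift x \<cdot> Var 0))"
    by (rule den_nat_induct[where \<rho> = N]) (use assms assms[THEN ty_up] in simp_all)
  then show ?thesis by simp
qed

lemma mns_self:
  assumes "ty w x = Some N" shows "den w (mns \<cdot> x \<cdot> x) = den w Zero"
proof -
  have "den w (sub (inst x) (mns \<cdot> Var 0 \<cdot> Var 0)) = den w (sub (inst x) Zero)"
  proof (rule den_nat_induct[where \<rho> = N])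
    fix w' m assume "ty w' m = Some N" "den w' (sub (inst m) (mns \<cdot> Var 0 \<cdot> Var 0)) = den w' (sub (inst m) Zero)"
    then show "den w' (sub (inst (Succ \<cdot> m)) (mns \<cdot> Var 0 \<cdot> Var 0)) = den w' (sub (inst (Succ \<cdot> m)) Zero)"
      using mns_Succ_Succ[of w' m m] by simp
  qed (use assms in simp_all)
  then show ?thesis by simp
qed

lemma mns_nplus:
  assumes "ty w a = Some N" "ty w j = Some N" shows "den w (mns \<cdot> a \<cdot> nplus a j) = den w Zero"
proof -
  have "den w (sub (inst j) (mns \<cdot> shift a \<cdot> nplus (shift a) (Var 0))) = den w (sub (inst j) Zero)"
    by (rule den_nat_induct[where \<rho> = N])
      (use assms assms[THEN ty_up] mns_self in \<open>simp_all add: nplus_eq\<close>)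
  then show ?thesis by (simp add: nplus_eq)
qed

lemma nplus_Zero:
  assumes "ty w j = Some N" shows "den w (nplus Zero j) = den w j"
proof -
  have "den w (sub (inst j) (nplus Zero (Var 0))) = den w (sub (inst j) (Var 0))"
    by (rule den_nat_induct[where \<rho> = N]) (use assms in \<open>simp_all add: nplus_eq\<close>)
  then show ?thesis by (simp add: nplus_eq)
qed

lemma nplus_Succ:
  assumes "ty w b = Some N" "ty w j = Some N" shows "den w (nplus (Succ \<cdot> b) j) = den w (Succ \<cdot> nplus b j)"
proof -
  have "den w (sub (inst j) (nplus (Succ \<cdot> shift b) (Var 0))) = den w (sub (inst j) (Succ \<cdot> nplus (shift b) (Var 0)))"
    by (rule den_nat_induct[where \<rho> = N])
      (use assms assms[THEN ty_up] in \<open>simp_all add: nplus_eq\<close>)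
  then show ?thesis by (simp add: nplus_eq)
qed

lemma mns_Succ_nplus:
  assumes "ty w b = Some N" "ty w j = Some N" shows "den w (mns \<cdot> (Succ \<cdot> nplus b j) \<cdot> b) = den w (Succ \<cdot> j)"
proof -
  have "den w (sub (inst b) (mns \<cdot> (Succ \<cdot> nplus (Var 0) (shift j)) \<cdot> Var 0)) = den w (sub (inst b) (Succ \<cdot> shift j))"
  proof (rule den_nat_induct[where \<rho> = N])
    show "den w (sub (inst Zero) (mns \<cdot> (Succ \<cdot> nplus (Var 0) (shift j)) \<cdot> Var 0)) = den w (sub (inst Zero) (Succ \<cdot> shift j))"
      using assms nplus_Zero[OF assms(2)] by (simp add: nplus_eq)
  next
    fix w' b assume w': "w \<sqsubseteq> w'" and b: "ty w' b = Some N"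
      and IH: "den w' (sub (inst b) (mns \<cdot> (Succ \<cdot> nplus (Var 0) (shift j)) \<cdot> Var 0)) = den w' (sub (inst b) (Succ \<cdot> shift j))"
    note t = b ty_mono[OF w' assms(2)]
    have "den w' (mns \<cdot> (Succ \<cdot> (Succ \<cdot> nplus b j)) \<cdot> (Succ \<cdot> b)) = den w' (mns \<cdot> (Succ \<cdot> nplus b j) \<cdot> b)"
      by (rule mns_Succ_Succ) (use t in \<open>simp_all add: nplus_eq\<close>)
    then show "den w' (sub (inst (Succ \<cdot> b)) (mns \<cdot> (Succ \<cdot> nplus (Var 0) (shift j)) \<cdot> Var 0)) = den w' (sub (inst (Succ \<cdot> b)) (Succ \<cdot> shift j))"
      using IH t nplus_Succ[OF t] by (simp add: nplus_eq del: mns_Succ)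
  qed (use assms in \<open>simp_all add: nplus_eq\<close>)
  then show ?thesis by (simp add: nplus_eq)
qed

text \<open>\<open>cnt \<tau> k s\<close> is \<open>(k + 1) - |s|\<close>, truncated at \<open>0\<close>.\<close>

definition cns :: "ty \<Rightarrow> trm" where
  "cns \<tau> = Lam (Seq \<tau>) (Lam \<tau> (Lam N (prd \<cdot> Var 0)))"

lemma cns_ty: "tyof [] (cns \<tau>) = Some ((Seq \<tau>) \<rightarrow> \<tau> \<rightarrow> N \<rightarrow> N)"
  by (simp add: cns_def)

lemmas cns_simps [simp] = closed[OF cns_ty]
lemmas cns_app [simp] = app_lam3[OF cns_def, simplified]

definition cnt :: "ty \<Rightarrow> trm" where
  "cnt \<tau> = Lam N (Lam (Seq \<tau>) (
     SRec \<tau> N \<cdot> (Succ \<cdot> Var 1) \<cdot> cns \<tau> \<cdot> Var 0))"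

lemma cnt_ty: "tyof [] (cnt \<tau>) = Some (N \<rightarrow> (Seq \<tau>) \<rightarrow> N)"
  by (simp add: cnt_def)

lemmas cnt_simps [simp] = closed[OF cnt_ty]
lemmas cnt_app = app_lam2[OF cnt_def, simplified]


lemma cnt_Emp [simp]: "tyv w k = Some N \<Longrightarrow> app w (app w (den w (cnt \<tau>)) k) (den w (Emp \<tau>)) = app w (den w Succ) k"
  by (simp add: cnt_app)

lemma cnt_Snoc [simp]: "tyv w k = Some N \<Longrightarrow> tyv w s = Some (Seq \<tau>) \<Longrightarrow> tyv w x = Some \<tau> \<Longrightarrow>
  app w (app w (den w (cnt \<tau>)) k) (app w (app w (den w (Snoc \<tau>)) s) x) = app w (den w prd) (app w (app w (den w (cnt \<tau>)) k) s)"
  by (simp add: cnt_app)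

lemma cnt_mns:
  assumes "ty w k = Some N" "ty w s = Some (Seq \<tau>)"
  shows "den w (cnt \<tau> \<cdot> k \<cdot> s) = den w (mns \<cdot> (Succ \<cdot> k) \<cdot> (len \<tau> \<cdot> s))"
proof -
  have "den w (sub (inst s) (cnt \<tau> \<cdot> shift k \<cdot> Var 0)) = den w (sub (inst s) (mns \<cdot> (Succ \<cdot> shift k) \<cdot> (len \<tau> \<cdot> Var 0)))"
    by (rule den_seq_induct[where \<rho> = N]) (use assms assms[THEN ty_up] in simp_all)
  then show ?thesis by simp
qed

text \<open>A witness \<open>j\<close> of the inequality gives \<open>|s| = a + (j + 1)\<close>, so
  the truncated difference of \<open>a + 1\<close> and \<open>|s|\<close> vanishes. With
  \<open>Geq_cnt\<close> this turns the two conditions of bar recursion into a case distinction on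
  one number.\<close>

lemma Less_cnt:
  assumes "w \<tturnstile> Less a (len \<tau> \<cdot> s)" "ty w a = Some N" "ty w s = Some (Seq \<tau>)"
  shows "den w (cnt \<tau> \<cdot> a \<cdot> s) = den w Zero"
proof (rule den_eqI)
  show "w \<tturnstile> Eq N (cnt \<tau> \<cdot> a \<cdot> s) Zero"
  proof (rule forces_ExE[OF assms(1)[unfolded Less_def]])
    fix w' j assume w': "w \<sqsubseteq> w'" and j: "ty w' j = Some N"
      and e: "w' \<tturnstile> fsub (inst j) (Eq N (shift (len \<tau> \<cdot> s)) (nplus (shift a) (Succ \<cdot> Var 0)))"
    note t = j assms(2,3)[THEN ty_mono[OF w']]
    have e: "den w' (len \<tau> \<cdot> s) = den w' (nplus a (Succ \<cdot> j))" by (rule den_eqI) (use e in \<open>simp add: nplus_eq\<close>)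
    have "den w' (mns \<cdot> (Succ \<cdot> a) \<cdot> (Succ \<cdot> nplus a j)) = den w' (mns \<cdot> a \<cdot> nplus a j)"
      by (rule mns_Succ_Succ) (use t in \<open>simp_all add: nplus_eq\<close>)
    then have "den w' (cnt \<tau> \<cdot> a \<cdot> s) = den w' Zero"
      using cnt_mns[of w' a s \<tau>] e mns_nplus[of w' a j] t by (simp add: nplus_eq del: mns_Succ)
    then show "w' \<tturnstile> Eq N (cnt \<tau> \<cdot> a \<cdot> s) Zero" by (rule den_eqD) (use t in simp)
  qed (use assms in simp)
qed

text \<open>Here \<open>a = |s| + j\<close>, and the \<open>1\<close> added in \<open>cnt\<close>
  makes the difference \<open>j + 1\<close>, visibly a successor.\<close>

lemma Geq_cnt:
  assumes "w \<tturnstile> Geq a (len \<tau> \<cdot> s)" "ty w a = Some N" "ty w s = Some (Seq \<tau>)" "wff (ctx w) C"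
    and "\<And>w' j. w \<sqsubseteq> w' \<Longrightarrow> ty w' j = Some N \<Longrightarrow> den w' (cnt \<tau> \<cdot> a \<cdot> s) = den w' (Succ \<cdot> j) \<Longrightarrow> w' \<tturnstile> C"
  shows "w \<tturnstile> C"
proof (rule forces_ExE[OF assms(1)[unfolded Geq_def] assms(4)])
  fix w' j assume w': "w \<sqsubseteq> w'" and j: "ty w' j = Some N"
    and e: "w' \<tturnstile> fsub (inst j) (Eq N (shift a) (nplus (shift (len \<tau> \<cdot> s)) (Var 0)))"
  note t = j assms(2,3)[THEN ty_mono[OF w']]
  have e: "den w' a = den w' (nplus (len \<tau> \<cdot> s) j)" by (rule den_eqI) (use e in \<open>simp add: nplus_eq\<close>)
  have "den w' (mns \<cdot> (Succ \<cdot> nplus (len \<tau> \<cdot> s) j) \<cdot> (len \<tau> \<cdot> s)) = den w' (Succ \<cdot> j)"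
    by (rule mns_Succ_nplus) (use t in simp_all)
  then have "den w' (cnt \<tau> \<cdot> a \<cdot> s) = den w' (Succ \<cdot> j)"
    using cnt_mns[of w' a s \<tau>] e t by (simp add: nplus_eq)
  then show "w' \<tturnstile> C" by (rule assms(5)[OF w' j])
qed

context bar_types
begin

subsection \<open>The generic sequence\<close>

definition p1 :: "trm" where
  "p1 = Lam (Seq \<tau>) (Lam N (Lam B (prepend \<tau> \<cdot> Var 2 \<cdot> Var 0 \<cdot> Var 1)))"

lemma p1_ty: "tyof [] p1 = Some ((Seq \<tau>) \<rightarrow> N \<rightarrow> B \<rightarrow> \<tau>)"
  by (simp add: p1_def)

lemmas p1_simps [simp] = closed[OF p1_ty]
lemmas p1_app [simp] = app_lam3[OF p1_def, simplified]

definition p2 :: "trm" where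
  "p2 = Lam (Seq \<tau>) (Lam N (Lam B (
     ncase \<tau> \<cdot> (prepend \<tau> \<cdot> Var 2 \<cdot> zero (N \<rightarrow> \<tau>)
      \<cdot> Var 1) \<cdot> Var 0 \<cdot> (cnt \<tau> \<cdot> Var 1 \<cdot> Var 2))))"

lemma p2_ty: "tyof [] p2 = Some ((Seq \<tau>) \<rightarrow> N \<rightarrow> B \<rightarrow> \<tau>)"
  by (simp add: p2_def)

lemmas p2_simps [simp] = closed[OF p2_ty]
lemmas p2_app [simp] = app_lam3[OF p2_def, simplified]


text \<open>Separates what depends on the tail \<open>b\<close>: if the count is zero, the entry is
  read off \<open>s\<close> with zeros behind it. This independence is why sequences longer than
  \<open>k\<close> secure the entry at \<open>k\<close>.\<close>

lemma prepend_cnt: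
  assumes "ty w s = Some (Seq \<tau>)" "ty w k = Some N" "ty w b = Some B"
  shows "den w (prepend \<tau> \<cdot> s \<cdot> b \<cdot> k) = den w (ncase \<tau> \<cdot> (prepend \<tau> \<cdot> s \<cdot> zero (N \<rightarrow> \<tau>) \<cdot> k) \<cdot> b \<cdot> (cnt \<tau> \<cdot> k \<cdot> s))"
proof -
  \<comment> \<open>Both sides are made functionals of the tail, because the step replaces
    \<open>b\<close> by \<open>scons x b\<close>; extensionality takes the place of a quantifier
    over tails.\<close>
  have "den w (sub (inst s) (p1 \<cdot> Var 0 \<cdot> shift k)) = den w (sub (inst s) (p2 \<cdot> Var 0 \<cdot> shift k))"
  proof (rule den_seq_induct[where \<rho> = "B \<rightarrow> \<tau>"])
    have "den w (p1 \<cdot> Emp \<tau> \<cdot> k) = den w (p2 \<cdot> Emp \<tau> \<cdot> k)"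
      by (rule den_ext[where \<rho> = B and \<eta> = \<tau>]) (use assms assms[THEN ty_up] in simp_all)
    then show "den w (sub (inst (Emp \<tau>)) (p1 \<cdot> Var 0 \<cdot> shift k)) = den w (sub (inst (Emp \<tau>)) (p2 \<cdot> Var 0 \<cdot> shift k))" by simp
  next
    fix w' s x assume w': "w \<sqsubseteq> w'" and sx: "ty w' s = Some (Seq \<tau>)" "ty w' x = Some \<tau>"
      and IH: "den w' (sub (inst s) (p1 \<cdot> Var 0 \<cdot> shift k)) = den w' (sub (inst s) (p2 \<cdot> Var 0 \<cdot> shift k))"
    note t = sx ty_mono[OF w' assms(2)]
    from IH have IH1: "den w' (p1 \<cdot> s \<cdot> k) = den w' (p2 \<cdot> s \<cdot> k)" by simp
    have IH': "den v (prepend \<tau> \<cdot> s \<cdot> b \<cdot> k) = den v (ncase \<tau> \<cdot> (prepend \<tau> \<cdot> s \<cdot> zero (N \<rightarrow> \<tau>) \<cdot> k) \<cdot> b \<cdot> (cnt \<tau> \<cdot> k \<cdot> s))"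
      if v: "w' \<sqsubseteq> v" and b: "ty v b = Some B" for v b
    proof -
      have "den v (p1 \<cdot> s \<cdot> k) = den v (p2 \<cdot> s \<cdot> k)" by (rule den_mono[OF v IH1]) (use t in simp)
      then have "den v (p1 \<cdot> s \<cdot> k \<cdot> b) = den v (p2 \<cdot> s \<cdot> k \<cdot> b)" by simp
      then show ?thesis using b t[THEN ty_mono[OF v]] by simp
    qed
    have "den w' (p1 \<cdot> (Snoc \<tau> \<cdot> s \<cdot> x) \<cdot> k) = den w' (p2 \<cdot> (Snoc \<tau> \<cdot> s \<cdot> x) \<cdot> k)"
    proof (rule den_ext[where \<rho> = B and \<eta> = \<tau>])
      fix v b assume v: "w' \<sqsubseteq> v" and b: "ty v b = Some B"
      note tv = b t[THEN ty_mono[OF v]]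
      show "den v (p1 \<cdot> (Snoc \<tau> \<cdot> s \<cdot> x) \<cdot> k \<cdot> b) = den v (p2 \<cdot> (Snoc \<tau> \<cdot> s \<cdot> x) \<cdot> k \<cdot> b)"
      proof (rule den_eq_cases[of _ "cnt \<tau> \<cdot> k \<cdot> s" _ \<tau>])
        fix u assume u: "v \<sqsubseteq> u" and c: "den u (cnt \<tau> \<cdot> k \<cdot> s) = den u Zero"
        note tu = tv[THEN ty_mono[OF u]]
        show "den u (p1 \<cdot> (Snoc \<tau> \<cdot> s \<cdot> x) \<cdot> k \<cdot> b) = den u (p2 \<cdot> (Snoc \<tau> \<cdot> s \<cdot> x) \<cdot> k \<cdot> b)"
          using c tu IH'[OF wle_trans[OF v u], of "scons \<tau> \<cdot> x \<cdot> b"]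
            IH'[OF wle_trans[OF v u], of "scons \<tau> \<cdot> x \<cdot> zero (N \<rightarrow> \<tau>)"] by simp
      next
        fix u m assume u: "v \<sqsubseteq> u" and m: "ty u m = Some N" and c: "den u (cnt \<tau> \<cdot> k \<cdot> s) = den u (Succ \<cdot> m)"
        note tu = m tv[THEN ty_mono[OF u]]
        show "den u (p1 \<cdot> (Snoc \<tau> \<cdot> s \<cdot> x) \<cdot> k \<cdot> b) = den u (p2 \<cdot> (Snoc \<tau> \<cdot> s \<cdot> x) \<cdot> k \<cdot> b)"
        \<comment> \<open>With \<open>m = 0\<close> the position is exactly \<open>|s|\<close> and
          holds the appended \<open>x\<close>; otherwise the tail \<open>b\<close> is read, one
          position earlier than in \<open>scons x b\<close>.\<close>
        proof (rule den_eq_cases[of _ m _ \<tau>])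
          fix z assume z: "u \<sqsubseteq> z" and cz: "den z m = den z Zero"
          note tz = tu[THEN ty_mono[OF z]]
          have "den z (cnt \<tau> \<cdot> k \<cdot> s) = den z (Succ \<cdot> m)" by (rule den_mono[OF z c]) (use tu in simp)
          then show "den z (p1 \<cdot> (Snoc \<tau> \<cdot> s \<cdot> x) \<cdot> k \<cdot> b) = den z (p2 \<cdot> (Snoc \<tau> \<cdot> s \<cdot> x) \<cdot> k \<cdot> b)"
            using cz tz IH'[OF wle_trans[OF wle_trans[OF v u] z], of "scons \<tau> \<cdot> x \<cdot> b"]
              IH'[OF wle_trans[OF wle_trans[OF v u] z], of "scons \<tau> \<cdot> x \<cdot> zero (N \<rightarrow> \<tau>)"] by simp
        next
          fix z i assume z: "u \<sqsubseteq> z" and i: "ty z i = Some N" and cz: "den z m = den z (Succ \<cdot> i)"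
          note tz = i tu[THEN ty_mono[OF z]]
          have "den z (cnt \<tau> \<cdot> k \<cdot> s) = den z (Succ \<cdot> m)" by (rule den_mono[OF z c]) (use tu in simp)
          then show "den z (p1 \<cdot> (Snoc \<tau> \<cdot> s \<cdot> x) \<cdot> k \<cdot> b) = den z (p2 \<cdot> (Snoc \<tau> \<cdot> s \<cdot> x) \<cdot> k \<cdot> b)"
            using cz tz IH'[OF wle_trans[OF wle_trans[OF v u] z], of "scons \<tau> \<cdot> x \<cdot> b"]
              IH'[OF wle_trans[OF wle_trans[OF v u] z], of "scons \<tau> \<cdot> x \<cdot> zero (N \<rightarrow> \<tau>)"] by simp
        qed (use tu in simp_all)
      qed (use tv in simp_all)
    qed (use t in simp_all)
    then show "den w' (sub (inst (Snoc \<tau> \<cdot> s \<cdot> x)) (p1 \<cdot> Var 0 \<cdot> shift k))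
      = den w' (sub (inst (Snoc \<tau> \<cdot> s \<cdot> x)) (p2 \<cdot> Var 0 \<cdot> shift k))" by simp
  qed (use assms in simp_all)
  then have "den w (p1 \<cdot> s \<cdot> k) = den w (p2 \<cdot> s \<cdot> k)" by simp
  then have "den w (p1 \<cdot> s \<cdot> k \<cdot> b) = den w (p2 \<cdot> s \<cdot> k \<cdot> b)" by simp
  then show ?thesis using assms by simp
qed

text \<open>\<open>genN a k\<close> is related to \<open>\<lambda>\<alpha>. a (\<alpha> k)\<close>, whose value is secured by the sequences longer than \<open>k\<close>.\<close>

definition genW :: "trm" where
  "genW = Lam (\<tau> \<rightarrow> N) (Lam N (Lam (Seq \<tau>) (
     cnd N \<cdot> (Succ \<cdot> (Var 2 \<cdot> (prepend \<tau> \<cdot> Var 0 \<cdot> zero (N \<rightarrow> \<tau>)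
      \<cdot> Var 1))) \<cdot> Zero \<cdot> (cnt \<tau> \<cdot> Var 1 \<cdot> Var 0))))"

lemma genW_ty: "tyof [] genW = Some ((\<tau> \<rightarrow> N) \<rightarrow> N \<rightarrow> (Seq \<tau>) \<rightarrow> N)"
  by (simp add: genW_def)

lemmas genW_simps [simp] = closed[OF genW_ty]
lemmas genW_app [simp] = app_lam3[OF genW_def, simplified]

definition genS :: "trm" where
  "genS = Lam HT (Lam N (Lam GT (Lam (Seq \<tau>) (
     Var 3 \<cdot> Var 0 \<cdot> (nxt \<cdot> Var 1 \<cdot> Var 0)))))"

lemma genS_ty: "tyof [] genS = Some (HT \<rightarrow> N \<rightarrow> GT \<rightarrow> (Seq \<tau>) \<rightarrow> \<sigma>)"
  by (simp add: genS_def)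

lemmas genS_simps [simp] = closed[OF genS_ty]
lemmas genS_app [simp] = app_lam4[OF genS_def, simplified]

text \<open>Bar recursion up to length greater than \<open>k\<close> is primitive recursive:
  \<open>cnt\<close> gives the number of missing elements, and \<open>H\<close> is applied that many
  times.\<close>

definition genB :: "trm" where
  "genB = Lam N (Lam GT (Lam HT (Lam (Seq \<tau>) (
     Rec GT \<cdot> Var 2 \<cdot> (genS \<cdot> Var 1) \<cdot> (cnt \<tau>
      \<cdot> Var 3 \<cdot> Var 0) \<cdot> Var 0))))"

lemma genB_ty: "tyof [] genB = Some (N \<rightarrow> GT \<rightarrow> HT \<rightarrow> (Seq \<tau>) \<rightarrow> \<sigma>)"
  by (simp add: genB_def)

lemmas genB_simps [simp] = closed[OF genB_ty]
lemmas genB_app [simp] = app_lam4[OF genB_def, simplified]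

definition genN :: "trm" where
  "genN = Lam (\<tau> \<rightarrow> N) (Lam N (
     Pair WT BT \<cdot> (genW \<cdot> Var 1 \<cdot> Var 0) \<cdot> (genB \<cdot> Var 0)))"

lemma genN_ty: "tyof [] genN = Some ((\<tau> \<rightarrow> N) \<rightarrow> N \<rightarrow> N0)"
  by (simp add: genN_def)

lemmas genN_simps [simp] = closed[OF genN_ty]
lemmas genN_app [simp] = app_lam2[OF genN_def, simplified]

definition qy :: "ty \<Rightarrow> trm" where
  "qy \<rho> = Lam (\<tau> \<rightarrow> \<rho>) (Lam N (Lam B (Var 2 \<cdot> (Var 0 \<cdot> Var 1))))"

lemma qy_ty: "tyof [] (qy \<rho>) = Some ((\<tau> \<rightarrow> \<rho>) \<rightarrow> N \<rightarrow> B \<rightarrow> \<rho>)"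
  by (simp add: qy_def)

lemmas qy_simps [simp] = closed[OF qy_ty]
lemmas qy_app [simp] = app_lam3[OF qy_def, simplified]


lemma genN_realizes:
  assumes a: "ty w a = Some (\<tau> \<rightarrow> N)" and k: "ty w k = Some N"
  shows "RR w N (genN \<cdot> a \<cdot> k) (qy N \<cdot> a \<cdot> k)"
proof -
  let ?m = "genN \<cdot> a \<cdot> k" and ?z = "zero (N \<rightarrow> \<tau>)"
  \<comment> \<open>A positive \<open>W s\<close> comes only from the zero branch of
    \<open>cnd\<close>, that is from \<open>|s| > k\<close>; its predecessor is then the value read
    off \<open>s\<close>.\<close>
  have C: "den v (cnt \<tau> \<cdot> k \<cdot> s) = den v Zero \<and> den v (a \<cdot> (prepend \<tau> \<cdot> s \<cdot> ?z \<cdot> k)) = den v j"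
    if v: "w \<sqsubseteq> v" and s: "ty v s = Some (Seq \<tau>)" and j: "ty v j = Some N" and W: "den v (fW \<cdot> ?m \<cdot> s) = den v (Succ \<cdot> j)"
    for v s j
  proof -
    note t = s j ty_mono[OF v a] ty_mono[OF v k]
    have c: "den v (cnt \<tau> \<cdot> k \<cdot> s) = den v Zero"
    proof (rule den_eq_cases[of _ "cnt \<tau> \<cdot> k \<cdot> s" _ N])
      fix u i assume u: "v \<sqsubseteq> u" and i: "ty u i = Some N" and c: "den u (cnt \<tau> \<cdot> k \<cdot> s) = den u (Succ \<cdot> i)"
      note tu = i t[THEN ty_mono[OF u]]
      have "den u (fW \<cdot> ?m \<cdot> s) = den u (Succ \<cdot> j)" by (rule den_mono[OF u W]) (use t in simp)
      then show "den u (cnt \<tau> \<cdot> k \<cdot> s) = den u Zero"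
        by - (rule den_absurd[of u j _ N], use c tu in simp_all)
    qed (use t in simp_all)
    have "den v (a \<cdot> (prepend \<tau> \<cdot> s \<cdot> ?z \<cdot> k)) = den v j"
      by (rule den_Succ_inj) (use c W t in simp_all)
    with c show ?thesis by blast
  qed
  have "w \<tturnstile> RN ?m (qy N \<cdot> a \<cdot> k)"
  proof (rule RN_I)
    fix v s g h assume v: "w \<sqsubseteq> v" and t: "ty v s = Some (Seq \<tau>)" "ty v g = Some GT" "ty v h = Some HT"
      and z: "den v (fW \<cdot> ?m \<cdot> s) = den v Zero"
    note t = t ty_mono[OF v a] ty_mono[OF v k]
    show "den v (fB \<cdot> ?m \<cdot> g \<cdot> h \<cdot> s) = den v (h \<cdot> s \<cdot> (nxt \<cdot> (fB \<cdot> ?m \<cdot> g \<cdot> h) \<cdot> s))"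
    proof (rule den_eq_cases[of _ "cnt \<tau> \<cdot> k \<cdot> s" _ \<sigma>])
      fix u assume u: "v \<sqsubseteq> u" and c: "den u (cnt \<tau> \<cdot> k \<cdot> s) = den u Zero"
      note tu = t[THEN ty_mono[OF u]]
      have "den u (fW \<cdot> ?m \<cdot> s) = den u Zero" by (rule den_mono[OF u z]) (use t in simp)
      then show "den u (fB \<cdot> ?m \<cdot> g \<cdot> h \<cdot> s) = den u (h \<cdot> s \<cdot> (nxt \<cdot> (fB \<cdot> ?m \<cdot> g \<cdot> h) \<cdot> s))"
        by - (rule den_absurd[of u "a \<cdot> (prepend \<tau> \<cdot> s \<cdot> ?z \<cdot> k)" _ \<sigma>], use c tu in simp_all)
    next
      fix u m assume u: "v \<sqsubseteq> u" and m: "ty u m = Some N" and c: "den u (cnt \<tau> \<cdot> k \<cdot> s) = den u (Succ \<cdot> m)"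
      note tu = m t[THEN ty_mono[OF u]]
      \<comment> \<open>One more element lowers the count from \<open>m + 1\<close> to
        \<open>m\<close>, so at \<open>s * x\<close> exactly \<open>m\<close> rounds of the
        recursion remain.\<close>
      have "den u (nxt \<cdot> (Rec GT \<cdot> g \<cdot> (genS \<cdot> h) \<cdot> m) \<cdot> s) = den u (nxt \<cdot> (fB \<cdot> ?m \<cdot> g \<cdot> h) \<cdot> s)"
      proof (rule nxt_Snoc_cong)
        fix z x assume z: "u \<sqsubseteq> z" and x: "ty z x = Some \<tau>"
        note tz = x tu[THEN ty_mono[OF z]]
        have "den z (cnt \<tau> \<cdot> k \<cdot> s) = den z (Succ \<cdot> m)" by (rule den_mono[OF z c]) (use tu in simp)
        then show "den z (Rec GT \<cdot> g \<cdot> (genS \<cdot> h) \<cdot> m \<cdot> (Snoc \<tau> \<cdot> s \<cdot> x)) = den z (fB \<cdot> ?m \<cdot> g \<cdot> h \<cdot> (Snoc \<tau> \<cdot> s \<cdot> x))"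
          using tz by simp
      qed (use tu in simp_all)
      then show "den u (fB \<cdot> ?m \<cdot> g \<cdot> h \<cdot> s) = den u (h \<cdot> s \<cdot> (nxt \<cdot> (fB \<cdot> ?m \<cdot> g \<cdot> h) \<cdot> s))"
        using c tu by simp
    qed (use t in simp_all)
  next
    fix v s j b assume v: "w \<sqsubseteq> v" and t: "ty v s = Some (Seq \<tau>)" "ty v j = Some N" and W: "den v (fW \<cdot> ?m \<cdot> s) = den v (Succ \<cdot> j)"
      and b: "ty v b = Some B"
    note t = t b ty_mono[OF v a] ty_mono[OF v k]
    \<comment> \<open>As \<open>k < |s|\<close>, the entry at \<open>k\<close> is the same for the
      tail \<open>b\<close> and for the tail of zeros.\<close>
    show "den v (qy N \<cdot> a \<cdot> k \<cdot> (prepend \<tau> \<cdot> s \<cdot> b)) = den v j"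
      using C[OF v t(1,2) W] prepend_cnt[OF t(1) t(5) t(3)] t by simp
  next
    fix v s j x assume v: "w \<sqsubseteq> v" and t: "ty v s = Some (Seq \<tau>)" "ty v j = Some N" and W: "den v (fW \<cdot> ?m \<cdot> s) = den v (Succ \<cdot> j)"
      and b: "ty v x = Some \<tau>"
    note t = t b ty_mono[OF v a] ty_mono[OF v k]
    \<comment> \<open>\<open>s * x\<close> followed by zeros is \<open>s\<close> followed by
      \<open>x\<close> and zeros, so \<open>W\<close> reads the same entry as at
      \<open>s\<close>.\<close>
    show "den v (fW \<cdot> ?m \<cdot> (Snoc \<tau> \<cdot> s \<cdot> x)) = den v (Succ \<cdot> j)"
      using C[OF v t(1,2) W] prepend_cnt[OF t(1) t(5), of "scons \<tau> \<cdot> x \<cdot> ?z"] t by simp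
  next
    fix v s j g h assume v: "w \<sqsubseteq> v" and t: "ty v s = Some (Seq \<tau>)" "ty v j = Some N" and W: "den v (fW \<cdot> ?m \<cdot> s) = den v (Succ \<cdot> j)"
      and gh: "ty v g = Some GT" "ty v h = Some HT"
    note t = t gh ty_mono[OF v a] ty_mono[OF v k]
    show "den v (fB \<cdot> ?m \<cdot> g \<cdot> h \<cdot> s) = den v (g \<cdot> s)"
      using C[OF v t(1,2) W] t by simp
  qed (use a k in simp_all)
  then show ?thesis using a k by (simp add: RR_def)
qed

text \<open>The element \<open>\<alpha> k\<close> is generalized to \<open>a (\<alpha> k)\<close>
  for arbitrary \<open>a : \<tau> \<rightarrow> \<rho>\<close>. So the construction can recurse on
  \<rho> while \<tau> stays fixed; the identity as \<open>a\<close> gives \<open>\<alpha> k\<close>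
  back.\<close>

definition gen_ok :: "ty \<Rightarrow> trm \<Rightarrow> bool" where
  "gen_ok \<rho> G \<longleftrightarrow> tyof [] G = Some ((\<tau> \<rightarrow> \<rho>) \<rightarrow> N \<rightarrow> st \<rho>) \<and>
    (\<forall>w a k. ty w a = Some (\<tau> \<rightarrow> \<rho>) \<longrightarrow> ty w k = Some N \<longrightarrow> RR w \<rho> (G \<cdot> a \<cdot> k) (qy \<rho> \<cdot> a \<cdot> k))"

lemma gen_okD:
  "gen_ok \<rho> G \<Longrightarrow> ty w a = Some (\<tau> \<rightarrow> \<rho>) \<Longrightarrow> ty w k = Some N \<Longrightarrow> RR w \<rho> (G \<cdot> a \<cdot> k) (qy \<rho> \<cdot> a \<cdot> k)"
  by (simp add: gen_ok_def)

lemma gen_ok_N: "gen_ok N genN"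
  unfolding gen_ok_def using genN_realizes by (simp add: genN_ty)

definition genF1 :: "ty \<Rightarrow> ty \<Rightarrow> ty \<Rightarrow> trm" where
  "genF1 \<delta> \<eta> \<eta>' = Lam ((\<tau> \<rightarrow> \<eta>) \<rightarrow> N \<rightarrow> \<eta>') (Lam (\<tau> \<rightarrow> \<delta> \<rightarrow> \<eta>) (Lam N (Lam \<delta> (
     Var 3 \<cdot> (Flp \<tau> \<delta> \<eta> \<cdot> Var 2 \<cdot> Var 0) \<cdot> Var 1))))"

lemma genF1_ty: "tyof [] (genF1 \<delta> \<eta> \<eta>') = Some (((\<tau> \<rightarrow> \<eta>) \<rightarrow> N \<rightarrow> \<eta>') \<rightarrow> (\<tau> \<rightarrow> \<delta> \<rightarrow> \<eta>) \<rightarrow> N \<rightarrow> \<delta> \<rightarrow> \<eta>')"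
  by (simp add: genF1_def)

lemmas genF1_simps [simp] = closed[OF genF1_ty]
lemmas genF1_app [simp] = app_lam4[OF genF1_def, simplified]

definition genF :: "ty \<Rightarrow> ty \<Rightarrow> ty \<Rightarrow> ty \<Rightarrow> trm" where
  "genF \<delta> \<delta>' \<eta> \<eta>' = Lam ((\<delta> \<rightarrow> \<eta>') \<rightarrow> \<delta>' \<rightarrow> \<eta>') (Lam ((\<tau> \<rightarrow> \<eta>) \<rightarrow> N \<rightarrow> \<eta>') (Lam (\<tau> \<rightarrow> \<delta> \<rightarrow> \<eta>) (Lam N (Lam \<delta>' (
     Var 4 \<cdot> (genF1 \<delta> \<eta> \<eta>' \<cdot> Var 3
      \<cdot> Var 2 \<cdot> Var 1) \<cdot> Var 0)))))"

lemma genF_ty: "tyof [] (genF \<delta> \<delta>' \<eta> \<eta>') = Some (((\<delta> \<rightarrow> \<eta>') \<rightarrow> \<delta>' \<rightarrow> \<eta>') \<rightarrow> ((\<tau> \<rightarrow> \<eta>) \<rightarrow> N \<rightarrow> \<eta>') \<rightarrow> (\<tau> \<rightarrow> \<delta> \<rightarrow> \<eta>) \<rightarrow> N \<rightarrow> \<delta>' \<rightarrow> \<eta>')"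
  by (simp add: genF_def)

lemmas genF_simps [simp] = closed[OF genF_ty]
lemmas genF_app [simp] = app_lam5[OF genF_def, simplified]

definition qf :: "ty \<Rightarrow> ty \<Rightarrow> trm" where
  "qf \<delta> \<eta> = Lam (\<tau> \<rightarrow> \<delta> \<rightarrow> \<eta>) (Lam N (Lam B (Lam \<delta> (
     Var 3 \<cdot> (Var 1 \<cdot> Var 2) \<cdot> Var 0))))"

lemma qf_ty: "tyof [] (qf \<delta> \<eta>) = Some ((\<tau> \<rightarrow> \<delta> \<rightarrow> \<eta>) \<rightarrow> N \<rightarrow> B \<rightarrow> \<delta> \<rightarrow> \<eta>)"
  by (simp add: qf_def)

lemmas qf_simps [simp] = closed[OF qf_ty]
lemmas qf_app [simp] = app_lam4[OF qf_def, simplified]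


text \<open>\<open>D\<close> secures the translated argument to a true \<open>d : \<delta>\<close>,
  which \<open>Flp\<close> then absorbs into \<open>a\<close>, leaving a function into \<eta>. This
  is where level 0 of the argument type enters: it supplies \<open>D\<close>.\<close>

lemma gen_ok_fun:
  assumes D: "dext_ok \<delta> \<eta> D" and G: "gen_ok \<eta> G" shows "gen_ok (\<delta> \<rightarrow> \<eta>) (genF \<delta> (st \<delta>) \<eta> (st \<eta>) \<cdot> D \<cdot> G)"
  unfolding gen_ok_def
proof (intro conjI allI impI)
  have tD: "tyof [] D = Some ((\<delta> \<rightarrow> st \<eta>) \<rightarrow> st \<delta> \<rightarrow> st \<eta>)" and tG: "tyof [] G = Some ((\<tau> \<rightarrow> \<eta>) \<rightarrow> N \<rightarrow> st \<eta>)"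
    using assms by (simp_all add: dext_ok_def gen_ok_def)
  note [simp] = closed[OF tD] closed[OF tG]
  let ?Q = "genF \<delta> (st \<delta>) \<eta> (st \<eta>) \<cdot> D \<cdot> G"
  show "tyof [] ?Q = Some ((\<tau> \<rightarrow> \<delta> \<rightarrow> \<eta>) \<rightarrow> N \<rightarrow> st (\<delta> \<rightarrow> \<eta>))" by simp
  fix w a k assume t: "ty w a = Some (\<tau> \<rightarrow> \<delta> \<rightarrow> \<eta>)" "ty w k = Some N"
  show "RR w (\<delta> \<rightarrow> \<eta>) (?Q \<cdot> a \<cdot> k) (qy (\<delta> \<rightarrow> \<eta>) \<cdot> a \<cdot> k)"
  proof (rule RR_funI)
    fix v x x' assume v: "w \<sqsubseteq> v" and x: "RR v \<delta> x x'"
    note tv = t[THEN ty_mono[OF v]] RR_ty[OF x]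
    have "RR v \<eta> (D \<cdot> (genF1 \<delta> \<eta> (st \<eta>) \<cdot> G \<cdot> a \<cdot> k) \<cdot> x) (pw \<delta> \<eta> (qf \<delta> \<eta> \<cdot> a \<cdot> k) x')"
    proof (rule dext_okD[OF D _ _ x])
      fix u d assume u: "v \<sqsubseteq> u" and d: "ty u d = Some \<delta>"
      note tu = d tv[THEN ty_mono[OF u]]
      have "RR u \<eta> (G \<cdot> (Flp \<tau> \<delta> \<eta> \<cdot> a \<cdot> d) \<cdot> k) (qy \<eta> \<cdot> (Flp \<tau> \<delta> \<eta> \<cdot> a \<cdot> d) \<cdot> k)"
        by (rule gen_okD[OF G]) (use tu in simp_all)
      then show "RR u \<eta> (genF1 \<delta> \<eta> (st \<eta>) \<cdot> G \<cdot> a \<cdot> k \<cdot> d) (pw \<delta> \<eta> (qf \<delta> \<eta> \<cdot> a \<cdot> k) (kk \<delta> d))"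
        by (rule RR_cong') (use tu tu[THEN ty_up] in simp_all)
    qed (use tv in simp_all)
    then show "RR v \<eta> (?Q \<cdot> a \<cdot> k \<cdot> x) (pw \<delta> \<eta> (qy (\<delta> \<rightarrow> \<eta>) \<cdot> a \<cdot> k) x')"
      by (rule RR_cong') (use tv tv[THEN ty_up] in simp_all)
  qed (use t in simp_all)
qed

definition genP :: "ty \<Rightarrow> ty \<Rightarrow> ty \<Rightarrow> ty \<Rightarrow> trm" where
  "genP \<rho> \<rho>' \<eta> \<eta>' = Lam ((\<tau> \<rightarrow> \<rho>) \<rightarrow> N \<rightarrow> \<rho>') (Lam ((\<tau> \<rightarrow> \<eta>) \<rightarrow> N \<rightarrow> \<eta>') (Lam (\<tau> \<rightarrow> \<rho> \<otimes> \<eta>) (Lam N (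
     Pair \<rho>' \<eta>' \<cdot> (Var 3 \<cdot> (Cmp \<tau> (\<rho> \<otimes> \<eta>) \<rho> \<cdot> Fst \<rho> \<eta> \<cdot> Var 1) \<cdot> Var 0)
      \<cdot> (Var 2 \<cdot> (Cmp \<tau> (\<rho> \<otimes> \<eta>) \<eta> \<cdot> Snd \<rho> \<eta> \<cdot> Var 1) \<cdot> Var 0)))))"

lemma genP_ty: "tyof [] (genP \<rho> \<rho>' \<eta> \<eta>') = Some (((\<tau> \<rightarrow> \<rho>) \<rightarrow> N \<rightarrow> \<rho>') \<rightarrow> ((\<tau> \<rightarrow> \<eta>) \<rightarrow> N \<rightarrow> \<eta>') \<rightarrow> (\<tau> \<rightarrow> \<rho> \<otimes> \<eta>) \<rightarrow> N \<rightarrow> (\<rho>' \<otimes> \<eta>'))"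
  by (simp add: genP_def)

lemmas genP_simps [simp] = closed[OF genP_ty]
lemmas genP_app [simp] = app_lam4[OF genP_def, simplified]


lemma gen_ok_prod:
  assumes F: "gen_ok \<rho> F" and G: "gen_ok \<eta> G" shows "gen_ok (\<rho> \<otimes> \<eta>) (genP \<rho> (st \<rho>) \<eta> (st \<eta>) \<cdot> F \<cdot> G)"
  unfolding gen_ok_def
proof (intro conjI allI impI)
  have tF: "tyof [] F = Some ((\<tau> \<rightarrow> \<rho>) \<rightarrow> N \<rightarrow> st \<rho>)" and tG: "tyof [] G = Some ((\<tau> \<rightarrow> \<eta>) \<rightarrow> N \<rightarrow> st \<eta>)"
    using assms by (simp_all add: gen_ok_def)
  note [simp] = closed[OF tF] closed[OF tG]
  let ?Q = "genP \<rho> (st \<rho>) \<eta> (st \<eta>) \<cdot> F \<cdot> G"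
  show "tyof [] ?Q = Some ((\<tau> \<rightarrow> \<rho> \<otimes> \<eta>) \<rightarrow> N \<rightarrow> st (\<rho> \<otimes> \<eta>))" by simp
  fix w a k assume t: "ty w a = Some (\<tau> \<rightarrow> \<rho> \<otimes> \<eta>)" "ty w k = Some N"
  let ?a = "Cmp \<tau> (\<rho> \<otimes> \<eta>) \<rho> \<cdot> Fst \<rho> \<eta> \<cdot> a" and ?b = "Cmp \<tau> (\<rho> \<otimes> \<eta>) \<eta> \<cdot> Snd \<rho> \<eta> \<cdot> a"
  have a: "RR w \<rho> (F \<cdot> ?a \<cdot> k) (qy \<rho> \<cdot> ?a \<cdot> k)"
    by (rule gen_okD[OF F]) (use t in simp_all)
  have b: "RR w \<eta> (G \<cdot> ?b \<cdot> k) (qy \<eta> \<cdot> ?b \<cdot> k)"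
    by (rule gen_okD[OF G]) (use t in simp_all)
  have "RR w \<rho> (Fst (st \<rho>) (st \<eta>) \<cdot> (?Q \<cdot> a \<cdot> k)) (pk (\<rho> \<otimes> \<eta>) \<rho> (Fst \<rho> \<eta>) (qy (\<rho> \<otimes> \<eta>) \<cdot> a \<cdot> k))"
    by (rule RR_cong'[OF a]) (use t t[THEN ty_up] in simp_all)
  moreover have "RR w \<eta> (Snd (st \<rho>) (st \<eta>) \<cdot> (?Q \<cdot> a \<cdot> k)) (pk (\<rho> \<otimes> \<eta>) \<eta> (Snd \<rho> \<eta>) (qy (\<rho> \<otimes> \<eta>) \<cdot> a \<cdot> k))"
    by (rule RR_cong'[OF b]) (use t t[THEN ty_up] in simp_all)
  ultimately show "RR w (\<rho> \<otimes> \<eta>) (?Q \<cdot> a \<cdot> k) (qy (\<rho> \<otimes> \<eta>) \<cdot> a \<cdot> k)"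
    using t by (subst RR_prod) simp_all
qed

definition genC :: "ty \<Rightarrow> ty \<Rightarrow> ty \<Rightarrow> trm" where
  "genC \<rho> \<kappa> \<kappa>' = Lam (\<rho> \<rightarrow> \<kappa>) (Lam ((\<tau> \<rightarrow> \<kappa>) \<rightarrow> N \<rightarrow> \<kappa>') (Lam (\<tau> \<rightarrow> \<rho>) (Lam N (
     Var 2 \<cdot> (Cmp \<tau> \<rho> \<kappa> \<cdot> Var 3 \<cdot> Var 1) \<cdot> Var 0))))"

lemma genC_ty: "tyof [] (genC \<rho> \<kappa> \<kappa>') = Some ((\<rho> \<rightarrow> \<kappa>) \<rightarrow> ((\<tau> \<rightarrow> \<kappa>) \<rightarrow> N \<rightarrow> \<kappa>') \<rightarrow> (\<tau> \<rightarrow> \<rho>) \<rightarrow> N \<rightarrow> \<kappa>')"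
  by (simp add: genC_def)

lemmas genC_simps [simp] = closed[OF genC_ty]
lemmas genC_app [simp] = app_lam4[OF genC_def, simplified]


text \<open>A map into sequences is composed with \<open>code\<close> and treated as a map into
  codes.\<close>

lemma gen_ok_Seq:
  assumes G: "gen_ok (N \<otimes> (N \<rightarrow> \<rho>)) G"
  shows "gen_ok (Seq \<rho>) (genC (Seq \<rho>) (N \<otimes> (N \<rightarrow> \<rho>)) (N0 \<otimes> (N0 \<rightarrow> st \<rho>)) \<cdot> code \<rho> \<cdot> G)"
  unfolding gen_ok_def
proof (intro conjI allI impI)
  let ?\<kappa> = "N \<otimes> (N \<rightarrow> \<rho>)"
  have tG: "tyof [] G = Some ((\<tau> \<rightarrow> ?\<kappa>) \<rightarrow> N \<rightarrow> N0 \<otimes> (N0 \<rightarrow> st \<rho>))"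
    using assms by (simp add: gen_ok_def)
  note [simp] = closed[OF tG]
  let ?Q = "genC (Seq \<rho>) ?\<kappa> (N0 \<otimes> (N0 \<rightarrow> st \<rho>)) \<cdot> code \<rho> \<cdot> G"
  show "tyof [] ?Q = Some ((\<tau> \<rightarrow> Seq \<rho>) \<rightarrow> N \<rightarrow> st (Seq \<rho>))" by simp
  fix w a k assume t: "ty w a = Some (\<tau> \<rightarrow> Seq \<rho>)" "ty w k = Some N"
  let ?a = "Cmp \<tau> (Seq \<rho>) ?\<kappa> \<cdot> code \<rho> \<cdot> a"
  have a: "RR w ?\<kappa> (G \<cdot> ?a \<cdot> k) (qy ?\<kappa> \<cdot> ?a \<cdot> k)"
    by (rule gen_okD[OF G]) (use t in simp_all)
  have "RR w ?\<kappa> (?Q \<cdot> a \<cdot> k) (pk (Seq \<rho>) ?\<kappa> (code \<rho>) (qy (Seq \<rho>) \<cdot> a \<cdot> k))"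
    by (rule RR_cong'[OF a]) (use t t[THEN ty_up] in simp_all)
  then show "RR w (Seq \<rho>) (?Q \<cdot> a \<cdot> k) (qy (Seq \<rho>) \<cdot> a \<cdot> k)"
    using t by (subst RR_Seq) simp_all
qed

text \<open>At level at most 1 every argument type has level 0, so \<open>dext_ex\<close> applies.
  For sequences, the code type has functions with arguments in \<open>N\<close> only.\<close>

lemma gen_ex: "level \<rho> \<le> 1 \<Longrightarrow> \<exists>G. gen_ok \<rho> G"
proof (induction \<rho>)
  case N
  then show ?case using gen_ok_N by blast
next
  case (Fun \<delta> \<eta>)
  then obtain G where "gen_ok \<eta> G" by auto
  moreover obtain D where "dext_ok \<delta> \<eta> D" using dext_ex[of \<delta> \<eta>] Fun.prems by auto
  ultimately show ?case using gen_ok_fun by blast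
next
  case (Prod \<rho> \<eta>)
  then show ?case using gen_ok_prod by fastforce
next
  case (Seq \<rho>)
  then obtain G where G: "gen_ok \<rho> G" by auto
  obtain D where "dext_ok N \<rho> D" using dext_ex[of N \<rho>] by auto
  from gen_ok_Seq[OF gen_ok_prod[OF gen_ok_N gen_ok_fun[OF this G]]] show ?case by blast
qed

text \<open>\<open>gen_ok\<close> for the identity gives the element at a true index
  \<open>k\<close>; \<open>ext_ok\<close> admits translated indices, and the result realizes the
  family that sends each infinite sequence to itself.\<close>

lemma generic_ex:
  assumes "level \<tau> \<le> 1"
  obtains \<Omega> where "tyof [] \<Omega> = Some (N0 \<rightarrow> st \<tau>)" "\<And>w. RR w (N \<rightarrow> \<tau>) \<Omega> (Ic B)"
proof -
  obtain G where G: "gen_ok \<tau> G" using gen_ex[OF assms] by blast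
  obtain E where E: "ext_ok \<tau> E" using ext_ex by blast
  have "tyof [] G = Some ((\<tau> \<rightarrow> \<tau>) \<rightarrow> N \<rightarrow> st \<tau>)" "tyof [] E = Some ((N \<rightarrow> st \<tau>) \<rightarrow> N0 \<rightarrow> st \<tau>)"
    using G E by (simp_all add: gen_ok_def ext_ok_def)
  note [simp] = this[THEN tyof_closed] this[THEN sub_closed] this[THEN ren_closed]
  let ?F = "G \<cdot> Ic \<tau>"
  have "RR w (N \<rightarrow> \<tau>) (E \<cdot> ?F) (Ic B)" for w
  proof (rule RR_funI)
    fix v n y assume n: "RR v N n y"
    show "RR v \<tau> (E \<cdot> ?F \<cdot> n) (pw N \<tau> (Ic B) y)"
    proof (rule ext_okD[OF E _ _ n])
      fix u k assume k: "ty u k = Some N"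
      have "RR u \<tau> (?F \<cdot> k) (qy \<tau> \<cdot> Ic \<tau> \<cdot> k)"
        by (rule gen_okD[OF G]) (use k in simp_all)
      then show "RR u \<tau> (?F \<cdot> k) (pw N \<tau> (Ic B) (kk N k))"
        by (rule RR_cong') (use k k[THEN ty_up] in simp_all)
    qed simp_all
  qed simp_all
  then show ?thesis by (intro that[of "E \<cdot> ?F"]) simp_all
qed

subsection \<open>Spector's bar recursion\<close>

text \<open>
  The recursor of \<open>q\<close> stops at \<open>s\<close> only if \<open>s\<close> secures \<open>T\<close> and is longer than its value, which implies
  Spector's condition; \<open>xih\<close> makes it return \<open>G s\<close> whenever that condition holds earlier.
\<close>

definition xih :: "trm" where
  "xih = Lam (B \<rightarrow> N) (Lam GT (Lam HT (Lam (Seq \<tau>) (Lam (\<tau> \<rightarrow> \<sigma>) (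
     cnd \<sigma> \<cdot> (Var 3 \<cdot> Var 1) \<cdot> (Var 2 \<cdot> Var 1 \<cdot> Var 0)
      \<cdot> (cnt \<tau> \<cdot> (Var 4 \<cdot> (hat \<tau> \<cdot> Var 1)) \<cdot> Var 1))))))"

lemma xih_ty: "tyof [] xih = Some ((B \<rightarrow> N) \<rightarrow> GT \<rightarrow> HT \<rightarrow> (Seq \<tau>) \<rightarrow> (\<tau> \<rightarrow> \<sigma>) \<rightarrow> \<sigma>)"
  by (simp add: xih_def)

lemmas xih_simps [simp] = closed[OF xih_ty]
lemmas xih_app [simp] = app_lam5[OF xih_def, simplified]

definition xi :: "trm" where
  "xi = Lam (B \<rightarrow> N) (Lam N0 (Lam GT (Lam HT (Lam (Seq \<tau>) (
     fB \<cdot> Var 3 \<cdot> Var 2 \<cdot> (xih \<cdot> Var 4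
      \<cdot> Var 2 \<cdot> Var 1) \<cdot> Var 0)))))"

lemma xi_ty: "tyof [] xi = Some ((B \<rightarrow> N) \<rightarrow> N0 \<rightarrow> GT \<rightarrow> HT \<rightarrow> (Seq \<tau>) \<rightarrow> \<sigma>)"
  by (simp add: xi_def)

lemmas xi_simps [simp] = closed[OF xi_ty]
lemmas xi_app [simp] = app_lam5[OF xi_def, simplified]


lemma bar_recursor_ex:
  assumes lev: "level \<tau> \<le> 1" and T: "tyof [] T = Some (B \<rightarrow> N)"
  obtains X where "tyof [] X = Some BT"
    and "\<And>w g h s. ty w g = Some GT \<Longrightarrow> ty w h = Some HT \<Longrightarrow> ty w s = Some (Seq \<tau>)
      \<Longrightarrow> den w (cnt \<tau> \<cdot> (T \<cdot> (hat \<tau> \<cdot> s)) \<cdot> s) = den w Zero \<Longrightarrow> den w (X \<cdot> g \<cdot> h \<cdot> s) = den w (g \<cdot> s)"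
    and "\<And>w g h s j. ty w g = Some GT \<Longrightarrow> ty w h = Some HT \<Longrightarrow> ty w s = Some (Seq \<tau>) \<Longrightarrow> ty w j = Some N
      \<Longrightarrow> den w (cnt \<tau> \<cdot> (T \<cdot> (hat \<tau> \<cdot> s)) \<cdot> s) = den w (Succ \<cdot> j)
      \<Longrightarrow> den w (X \<cdot> g \<cdot> h \<cdot> s) = den w (h \<cdot> s \<cdot> (nxt \<cdot> (X \<cdot> g \<cdot> h) \<cdot> s))"
proof -
  obtain \<Omega> where \<Omega>: "tyof [] \<Omega> = Some (N0 \<rightarrow> st \<tau>)" "\<And>w. RR w (N \<rightarrow> \<tau>) \<Omega> (Ic B)"
    using generic_ex[OF lev] by blast
  obtain T0 where T0: "tyof [] T0 = Some (st (B \<rightarrow> N))" "\<And>w. RR w (B \<rightarrow> N) T0 (kk (B \<rightarrow> N) T)"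
    using Rz_closed[OF T] unfolding Rz_def by blast
  note [simp] = closed[OF T] closed[OF \<Omega>(1)] closed[OF T0(1), simplified]
  define m where "m = T0 \<cdot> \<Omega>"
  have m_ty: "tyof [] m = Some N0" by (simp add: m_def)
  \<comment> \<open>The family obtained is \<open>T\<close> composed with the identity on infinite
    sequences, which is \<open>T\<close>.\<close>
  have mR: "RR w N m T" for w
    unfolding m_def by (rule RR_cong'[OF RR_funE[OF T0(2) \<Omega>(2)]]) simp_all
  note [simp] = closed[OF m_ty]
  \<comment> \<open>With the constant function \<open>0\<close>, \<open>genN\<close> contributes no
    information but a bar: composed after \<open>m\<close>, it asks \<open>s\<close> to be longer
    than the value \<open>k\<close> secured for \<open>T\<close>.\<close>
  define a0 where "a0 = Kc N \<tau> \<cdot> Zero"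
  have a0_ty: "tyof [] a0 = Some (\<tau> \<rightarrow> N)" by (simp add: a0_def)
  note [simp] = closed[OF a0_ty]
  define q where "q = extN \<cdot> (genN \<cdot> a0) \<cdot> m"
  have q_ty: "tyof [] q = Some N0" by (simp add: q_def)
  have qR: "RR w N q (pw N N (Flp N B N \<cdot> (qy N \<cdot> a0)) T)" for w
    unfolding q_def
  proof (rule extN[OF _ _ mR])
    fix v k assume k: "ty v k = Some N"
    have "RR v N (genN \<cdot> a0 \<cdot> k) (qy N \<cdot> a0 \<cdot> k)" by (rule genN_realizes) (use k in simp_all)
    then show "RR v N (genN \<cdot> a0 \<cdot> k) (pw N N (Flp N B N \<cdot> (qy N \<cdot> a0)) (kk N k))"
      by (rule RR_cong') (use k k[THEN ty_up] in simp_all)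
  qed simp_all
  note [simp] = closed[OF q_ty]
  have qN: "w \<tturnstile> RN q (pw N N (Flp N B N \<cdot> (qy N \<cdot> a0)) T)" and mN: "w \<tturnstile> RN m T" for w
    using qR[of w] mR[of w] by (simp_all add: RR_def)
  let ?X = "xi \<cdot> T \<cdot> q"
  show ?thesis
  proof (rule that)
    show "tyof [] ?X = Some BT" by simp
  next
    fix w g h s assume t: "ty w g = Some GT" "ty w h = Some HT" "ty w s = Some (Seq \<tau>)"
      and c: "den w (cnt \<tau> \<cdot> (T \<cdot> (hat \<tau> \<cdot> s)) \<cdot> s) = den w Zero"
    show "den w (?X \<cdot> g \<cdot> h \<cdot> s) = den w (g \<cdot> s)"
    \<comment> \<open>Either the recursor of \<open>q\<close> continues at \<open>s\<close> and
      \<open>xih\<close> takes its \<open>G\<close> branch, or it has stopped and returns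
      \<open>G s\<close> itself.\<close>
    proof (rule den_eq_cases[of _ "fW \<cdot> q \<cdot> s" _ \<sigma>])
      fix v assume v: "w \<sqsubseteq> v" and W: "den v (fW \<cdot> q \<cdot> s) = den v Zero"
      note tv = t[THEN ty_mono[OF v]]
      have "den v (cnt \<tau> \<cdot> (T \<cdot> (hat \<tau> \<cdot> s)) \<cdot> s) = den v Zero" by (rule den_mono[OF v c]) (use t in simp)
      then show "den v (?X \<cdot> g \<cdot> h \<cdot> s) = den v (g \<cdot> s)"
        using RN_Zero[OF qN _ _ _ _ W, of g "xih \<cdot> T \<cdot> g \<cdot> h"] tv by simp
    next
      fix v k assume v: "w \<sqsubseteq> v" and k: "ty v k = Some N" and W: "den v (fW \<cdot> q \<cdot> s) = den v (Succ \<cdot> k)"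
      note tv = k t[THEN ty_mono[OF v]]
      show "den v (?X \<cdot> g \<cdot> h \<cdot> s) = den v (g \<cdot> s)"
        using RN_Succ(3)[OF qN _ _ _ _ W, of g "xih \<cdot> T \<cdot> g \<cdot> h"] tv by simp
    qed (use t in simp_all)
  next
    fix w g h s j assume t: "ty w g = Some GT" "ty w h = Some HT" "ty w s = Some (Seq \<tau>)" "ty w j = Some N"
      and c: "den w (cnt \<tau> \<cdot> (T \<cdot> (hat \<tau> \<cdot> s)) \<cdot> s) = den w (Succ \<cdot> j)"
    \<comment> \<open>If \<open>s\<close> secured \<open>T\<close> with value \<open>k\<close>, then
      \<open>k\<close> would be the value of \<open>T\<close> at \<open>s\<close> continued by
      zeros. By \<open>c\<close> this is not below \<open>|s|\<close>, so the second bar,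
      \<open>|s| > k\<close>, is not yet reached.\<close>
    have W: "den w (fW \<cdot> q \<cdot> s) = den w Zero"
    proof (rule den_eq_cases[of _ "fW \<cdot> m \<cdot> s" _ N])
      fix v assume v: "w \<sqsubseteq> v" and W: "den v (fW \<cdot> m \<cdot> s) = den v Zero"
      show "den v (fW \<cdot> q \<cdot> s) = den v Zero" unfolding q_def using W t[THEN ty_mono[OF v]] by simp
    next
      fix v k assume v: "w \<sqsubseteq> v" and k: "ty v k = Some N" and W: "den v (fW \<cdot> m \<cdot> s) = den v (Succ \<cdot> k)"
      note tv = k t[THEN ty_mono[OF v]]
      have c': "den v (cnt \<tau> \<cdot> (T \<cdot> (hat \<tau> \<cdot> s)) \<cdot> s) = den v (Succ \<cdot> j)" by (rule den_mono[OF v c]) (use t in simp)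
      have "den v (T \<cdot> (prepend \<tau> \<cdot> s \<cdot> zero (N \<rightarrow> \<tau>))) = den v k"
        by (rule RN_Succ(1)[OF mN _ _ _ _ W]) (use tv in simp_all)
      then show "den v (fW \<cdot> q \<cdot> s) = den v Zero" unfolding q_def using W c' tv by simp
    qed (use t in simp_all)
    have n: "den w (nxt \<cdot> (fB \<cdot> q \<cdot> g \<cdot> (xih \<cdot> T \<cdot> g \<cdot> h)) \<cdot> s) = den w (nxt \<cdot> (?X \<cdot> g \<cdot> h) \<cdot> s)"
      by (rule nxt_Snoc_cong) (use t t[THEN ty_up] in simp_all)
    show "den w (?X \<cdot> g \<cdot> h \<cdot> s) = den w (h \<cdot> s \<cdot> (nxt \<cdot> (?X \<cdot> g \<cdot> h) \<cdot> s))"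
      using RN_Zero[OF qN _ _ _ _ W, of g "xih \<cdot> T \<cdot> g \<cdot> h"] c n t by simp
  qed
qed

section \<open>The defining clauses as derivable formulas\<close>

lemma BR_clauses_sub:
  assumes "tyof [] T = Some (B \<rightarrow> N)"
  shows "fsub \<theta> (BR_clauses \<tau> \<sigma> G H T X s) = BR_clauses \<tau> \<sigma> (sub \<theta> G) (sub \<theta> H) T (sub \<theta> X) (sub \<theta> s)"
  by (simp add: BR_clauses_def Less_def Geq_def nplus_eq closed[OF assms])

lemma BR_clauses_wff:
  assumes "tyof [] T = Some (B \<rightarrow> N)" "tyof \<Gamma> G = Some GT" "tyof \<Gamma> H = Some HT" "tyof \<Gamma> X = Some GT" "tyof \<Gamma> s = Some (Seq \<tau>)"
  shows "wff \<Gamma> (BR_clauses \<tau> \<sigma> G H T X s)"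
  using assms by (simp add: BR_clauses_def Less_def Geq_def nplus_eq closed[OF assms(1)])

theorem bar_recursion_definable:
  assumes lev: "level \<tau> \<le> 1" and T: "tyof [] T = Some (B \<rightarrow> N)"
  obtains X where "tyof [] X = Some BT"
    and "\<And>w g h s. ty w g = Some GT \<Longrightarrow> ty w h = Some HT \<Longrightarrow> ty w s = Some (Seq \<tau>)
      \<Longrightarrow> w \<tturnstile> BR_clauses \<tau> \<sigma> g h T (X \<cdot> g \<cdot> h) s"
proof -
  obtain X where X: "tyof [] X = Some BT"
    and X1: "\<And>w g h s. ty w g = Some GT \<Longrightarrow> ty w h = Some HT \<Longrightarrow> ty w s = Some (Seq \<tau>)
      \<Longrightarrow> den w (cnt \<tau> \<cdot> (T \<cdot> (hat \<tau> \<cdot> s)) \<cdot> s) = den w Zero \<Longrightarrow> den w (X \<cdot> g \<cdot> h \<cdot> s) = den w (g \<cdot> s)"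
    and X2: "\<And>w g h s j. ty w g = Some GT \<Longrightarrow> ty w h = Some HT \<Longrightarrow> ty w s = Some (Seq \<tau>) \<Longrightarrow> ty w j = Some N
      \<Longrightarrow> den w (cnt \<tau> \<cdot> (T \<cdot> (hat \<tau> \<cdot> s)) \<cdot> s) = den w (Succ \<cdot> j)
      \<Longrightarrow> den w (X \<cdot> g \<cdot> h \<cdot> s) = den w (h \<cdot> s \<cdot> (nxt \<cdot> (X \<cdot> g \<cdot> h) \<cdot> s))"
    using bar_recursor_ex[OF lev T] by blast
  note [simp] = closed[OF T] closed[OF X]
  have "w \<tturnstile> BR_clauses \<tau> \<sigma> g h T (X \<cdot> g \<cdot> h) s"
    if t: "ty w g = Some GT" "ty w h = Some HT" "ty w s = Some (Seq \<tau>)" for w g h s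
  proof -
    have "wff (ctx w) (BR_clauses \<tau> \<sigma> g h T (X \<cdot> g \<cdot> h) s)" by (rule BR_clauses_wff[OF T]) (use t in simp_all)
    then have wf: "wff (ctx w) (Less (T \<cdot> (hat \<tau> \<cdot> s)) (len \<tau> \<cdot> s))" "wff (ctx w) (Geq (T \<cdot> (hat \<tau> \<cdot> s)) (len \<tau> \<cdot> s))"
      by (simp_all add: BR_clauses_def)
    \<comment> \<open>The continuation in the clauses is an explicit abstraction; extensionality
      identifies it with the lambda lifted \<open>nxt\<close>.\<close>
    let ?L = "Lam \<tau> (shift (X \<cdot> g \<cdot> h) \<cdot> (Snoc \<tau> \<cdot> shift s \<cdot> Var 0))"
    have L: "den v ?L = den v (nxt \<cdot> (X \<cdot> g \<cdot> h) \<cdot> s)" if v: "w \<sqsubseteq> v" for v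
    proof (rule den_ext[where \<rho> = \<tau> and \<eta> = \<sigma>])
      fix u x assume u: "v \<sqsubseteq> u" and x: "ty u x = Some \<tau>"
      note tu = x t[THEN ty_mono[OF wle_trans[OF v u]]]
      have "den u (?L \<cdot> x) = den u (sub (inst x) (shift (X \<cdot> g \<cdot> h) \<cdot> (Snoc \<tau> \<cdot> shift s \<cdot> Var 0)))"
        by (rule den_Beta[where \<eta> = \<sigma>]) (use tu in simp_all)
      also have "\<dots> = den u (nxt \<cdot> (X \<cdot> g \<cdot> h) \<cdot> s \<cdot> x)" using tu by simp
      finally show "den u (?L \<cdot> x) = den u (nxt \<cdot> (X \<cdot> g \<cdot> h) \<cdot> s \<cdot> x)" .
    qed (use t[THEN ty_mono[OF v]] in simp_all)
    have "w \<tturnstile> Imp (Less (T \<cdot> (hat \<tau> \<cdot> s)) (len \<tau> \<cdot> s)) (Eq \<sigma> (X \<cdot> g \<cdot> h \<cdot> s) (g \<cdot> s))"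
    proof (rule forces_ImpI[OF wf(1)])
      fix v assume v: "w \<sqsubseteq> v" and l: "v \<tturnstile> Less (T \<cdot> (hat \<tau> \<cdot> s)) (len \<tau> \<cdot> s)"
      note tv = t[THEN ty_mono[OF v]]
      have "den v (cnt \<tau> \<cdot> (T \<cdot> (hat \<tau> \<cdot> s)) \<cdot> s) = den v Zero" by (rule Less_cnt[OF l]) (use tv in simp_all)
      from X1[OF tv this] show "v \<tturnstile> Eq \<sigma> (X \<cdot> g \<cdot> h \<cdot> s) (g \<cdot> s)" by (rule den_eqD) (use tv in simp)
    qed
    moreover have "w \<tturnstile> Imp (Geq (T \<cdot> (hat \<tau> \<cdot> s)) (len \<tau> \<cdot> s)) (Eq \<sigma> (X \<cdot> g \<cdot> h \<cdot> s) (h \<cdot> s \<cdot> ?L))"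
    proof (rule forces_ImpI[OF wf(2)])
      fix v assume v: "w \<sqsubseteq> v" and l: "v \<tturnstile> Geq (T \<cdot> (hat \<tau> \<cdot> s)) (len \<tau> \<cdot> s)"
      note tv = t[THEN ty_mono[OF v]]
      show "v \<tturnstile> Eq \<sigma> (X \<cdot> g \<cdot> h \<cdot> s) (h \<cdot> s \<cdot> ?L)"
      proof (rule Geq_cnt[OF l])
        fix u j assume u: "v \<sqsubseteq> u" and j: "ty u j = Some N" and c: "den u (cnt \<tau> \<cdot> (T \<cdot> (hat \<tau> \<cdot> s)) \<cdot> s) = den u (Succ \<cdot> j)"
        note tu = tv[THEN ty_mono[OF u]]
        have "den u (X \<cdot> g \<cdot> h \<cdot> s) = den u (h \<cdot> s \<cdot> ?L)"
          using X2[OF tu j c] L[OF wle_trans[OF v u]] by simp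
        then show "u \<tturnstile> Eq \<sigma> (X \<cdot> g \<cdot> h \<cdot> s) (h \<cdot> s \<cdot> ?L)" by (rule den_eqD) (use tu in simp)
      qed (use tv in simp_all)
    qed
    ultimately show ?thesis by (simp add: BR_clauses_def forces_And)
  qed
  with X show ?thesis by (rule that)
qed

end

theorem mainTheorem1:
  fixes \<tau> \<sigma> :: ty and t :: trm
  assumes "level \<tau> \<le> 1"
    and "[] \<turnstile> t : (N \<rightarrow> \<tau>) \<rightarrow> N"
  shows "\<exists>\<xi>. [] \<turnstile> \<xi> : (Seq \<tau> \<rightarrow> \<sigma>) \<rightarrow> (Seq \<tau> \<rightarrow> (\<tau> \<rightarrow> \<sigma>) \<rightarrow> \<sigma>) \<rightarrow> Seq \<tau> \<rightarrow> \<sigma> \<and>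
    HA [] {}
      (All (Seq \<tau> \<rightarrow> \<sigma>) (All (Seq \<tau> \<rightarrow> (\<tau> \<rightarrow> \<sigma>) \<rightarrow> \<sigma>) (All (Seq \<tau>)
        (let G = Var 2; H = Var 1; s = Var 0
         in BR_clauses \<tau> \<sigma> G H t (\<xi> \<cdot> G \<cdot> H) s))))"
proof -
  interpret bar_types \<tau> \<sigma> .
  have t: "tyof [] t = Some (B \<rightarrow> N)" using assms(2) by (simp add: wt_iff)
  obtain X where X: "tyof [] X = Some BT"
    and BR: "\<And>w g h s. ty w g = Some GT \<Longrightarrow> ty w h = Some HT \<Longrightarrow> ty w s = Some (Seq \<tau>)
      \<Longrightarrow> w \<tturnstile> BR_clauses \<tau> \<sigma> g h t (X \<cdot> g \<cdot> h) s"
    using bar_recursion_definable[OF assms(1) t] by blast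
  note [simp] = closed[OF X]
  \<comment> \<open>Forcing in the empty world is derivability without variables and hypotheses; the
    three quantifiers are introduced semantically, with \<open>shift\<close> marking the binders
    still open.\<close>
  let ?w = "mkw [] {}"
  have w: "ctx ?w = []" "hyp ?w = {}" by (rule mkw_simps; simp)+
  have "?w \<tturnstile> All GT (All HT (All (Seq \<tau>) (BR_clauses \<tau> \<sigma> (Var 2) (Var 1) t (X \<cdot> Var 2 \<cdot> Var 1) (Var 0))))"
  proof (rule forces_AllI)
    fix w1 g assume g: "ty w1 g = Some GT"
    have "w1 \<tturnstile> All HT (All (Seq \<tau>) (BR_clauses \<tau> \<sigma> (shift (shift g)) (Var 1) t (X \<cdot> shift (shift g) \<cdot> Var 1) (Var 0)))"
    proof (rule forces_AllI)
      fix w2 h assume h: "w1 \<sqsubseteq> w2" "ty w2 h = Some HT"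
      have "w2 \<tturnstile> All (Seq \<tau>) (BR_clauses \<tau> \<sigma> (shift g) (shift h) t (X \<cdot> shift g \<cdot> shift h) (Var 0))"
      proof (rule forces_AllI)
        fix w3 s assume s: "w2 \<sqsubseteq> w3" "ty w3 s = Some (Seq \<tau>)"
        have "w3 \<tturnstile> BR_clauses \<tau> \<sigma> g h t (X \<cdot> g \<cdot> h) s"
          by (rule BR[OF ty_mono[OF wle_trans[OF h(1) s(1)] g] ty_mono[OF s(1) h(2)] s(2)])
        then show "w3 \<tturnstile> fsub (inst s) (BR_clauses \<tau> \<sigma> (shift g) (shift h) t (X \<cdot> shift g \<cdot> shift h) (Var 0))"
          by (simp add: BR_clauses_sub[OF t])
      qed (use ty_mono[OF h(1) g] h in \<open>simp add: BR_clauses_wff[OF t]\<close>)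
      then show "w2 \<tturnstile> fsub (inst h) (All (Seq \<tau>) (BR_clauses \<tau> \<sigma> (shift (shift g)) (Var 1) t (X \<cdot> shift (shift g) \<cdot> Var 1) (Var 0)))"
        by (simp add: BR_clauses_sub[OF t])
    qed (use g in \<open>simp add: BR_clauses_wff[OF t]\<close>)
    then show "w1 \<tturnstile> fsub (inst g) (All HT (All (Seq \<tau>) (BR_clauses \<tau> \<sigma> (Var 2) (Var 1) t (X \<cdot> Var 2 \<cdot> Var 1) (Var 0))))"
      by (simp add: BR_clauses_sub[OF t] numeral_2_eq_2)
  qed (simp add: BR_clauses_wff[OF t])
  then show ?thesis
    using X by (intro exI[of _ X]) (simp add: forces_def w wt_iff Let_def)
qed

end
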